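(* Let $\mu_h$ be a probability measure on $\mathbb{R}$ of the form $d\mu_h(x)=e^{-h(x)}\,dx$ with $h\colon\mathbb{R}\to\mathbb{R}$ a symmetric function of class $\mathcal{D}^{(4)}$ such that $c\le h''\le C$, where $c,C$ are positive numbers. Set $V(x):=\frac12(1-h''(x))-\frac14(x^2-h'(x)^2)$, and assume that $V$ is bounded below and that $\sup_{x\ge0}V''(x)<\infty$. Let $(\mathcal{P}_t)_{t\ge0}$ be the semi-group associated to the diffusion operator $L_h:=\frac{\partial^2}{\partial x^2}-h'(x)\frac{\partial}{\partial x}$, symmetric in $\mathbb{L}^2(\mu_h)$. Then, for all $s>0$, there exists a constant $D$ (that depends only on $s$, $c$, $C$ and $\sup_{x\ge0}V''(x)$) such that for all non-negative $g\in\mathbb{L}^1(\mu_h)$ with $\int g\,d\mu_h>0$, $$\mu_h\Bigl(\Bigl\{\mathcal{P}_sg\ge t\int g\,d\mu_h\Bigr\}\Bigr)\le D\,\frac{1}{t\sqrt{\log t}},\qquad\forall t\ge2.$$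
   Context: $\mathcal{D}^{(k)}$ denotes the set of $\mathcal{C}^k$ real-valued functions which, together with their derivatives (up to order $k$), have polynomial growth. Symmetric function means even function. $L_h$ is essentially self-adjoint on $\mathcal{C}_K^\infty$ (smooth compactly supported functions) in $\mathbb{L}^2(\mu_h)$; $(\mathcal{P}_t)_{t\ge0}$ is the (Markov) semi-group it generates on $\mathbb{L}^2(\mu_h)$, extended to non-negative functions of $\mathbb{L}^1(\mu_h)$ by monotone limits $\mathcal{P}_sg=\lim_n\mathcal{P}_s(g\wedge n)$. *)

theory Defs
  imports "HOL-Probability.Probability"
begin

definition Ck :: "nat \<Rightarrow> (real \<Rightarrow> real) \<Rightarrow> bool" where
  "Ck k f \<longleftrightarrow>
     (\<forall>j<k. \<forall>x. (deriv ^^ j) f differentiable (at x)) \<and> continuous_on UNIV ((deriv ^^ k) f)"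

definition polynomial_growth :: "(real \<Rightarrow> real) \<Rightarrow> bool" where
  "polynomial_growth f \<longleftrightarrow> (\<exists>A. \<exists>m::nat. \<forall>x. \<bar>f x\<bar> \<le> A * (1 + \<bar>x\<bar> ^ m))"

definition class_D :: "nat \<Rightarrow> (real \<Rightarrow> real) set" where
  "class_D k = {f. Ck k f \<and> (\<forall>j\<le>k. polynomial_growth ((deriv ^^ j) f))}"

definition test_functions :: "(real \<Rightarrow> real) set" where
  "test_functions = {f. (\<forall>k. Ck k f) \<and> compact (closure {x. f x \<noteq> 0})}"

definition mu :: "(real \<Rightarrow> real) \<Rightarrow> real measure" where
  "mu h = density lborel (\<lambda>x. ennreal (exp (- h x)))"

definition L_op :: "(real \<Rightarrow> real) \<Rightarrow> (real \<Rightarrow> real) \<Rightarrow> real \<Rightarrow> real" where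
  "L_op h f x = (deriv ^^ 2) f x - deriv h x * deriv f x"

definition V_pot :: "(real \<Rightarrow> real) \<Rightarrow> real \<Rightarrow> real" where
  "V_pot h x = (1 / 2) * (1 - (deriv ^^ 2) h x) - (1 / 4) * (x ^ 2 - (deriv h x) ^ 2)"

text \<open>Elements of \<open>L\<^sup>2\<close> are represented by functions, not by classes modulo almost everywhere
  equality. Operators act on representatives, and all identities between images are required only
  almost everywhere.\<close>

definition L2_space :: "'a measure \<Rightarrow> ('a \<Rightarrow> real) set" where
  "L2_space M = {f \<in> borel_measurable M. integrable M (\<lambda>x. (f x) ^ 2)}"

definition L2_nrm :: "'a measure \<Rightarrow> ('a \<Rightarrow> real) \<Rightarrow> real" where
  "L2_nrm M f = sqrt (\<integral>x. (f x) ^ 2 \<partial>M)"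

definition L2_operator :: "'a measure \<Rightarrow> (('a \<Rightarrow> real) \<Rightarrow> ('a \<Rightarrow> real)) \<Rightarrow> bool" where
  "L2_operator M T \<longleftrightarrow>
     (\<forall>f\<in>L2_space M. T f \<in> L2_space M) \<and>
     (\<forall>f\<in>L2_space M. \<forall>g\<in>L2_space M.
        (AE x in M. f x = g x) \<longrightarrow> (AE x in M. T f x = T g x)) \<and>
     (\<forall>f\<in>L2_space M. \<forall>g\<in>L2_space M. \<forall>a b.
        AE x in M. T (\<lambda>y. a * f y + b * g y) x = a * T f x + b * T g x) \<and>
     (\<exists>B. \<forall>f\<in>L2_space M. L2_nrm M (T f) \<le> B * L2_nrm M f)"

definition C0_semigroup :: "'a measure \<Rightarrow> (real \<Rightarrow> ('a \<Rightarrow> real) \<Rightarrow> ('a \<Rightarrow> real)) \<Rightarrow> bool" where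
  "C0_semigroup M P \<longleftrightarrow>
     (\<forall>t\<ge>0. L2_operator M (P t)) \<and>
     (\<forall>f\<in>L2_space M. AE x in M. P 0 f x = f x) \<and>
     (\<forall>s\<ge>0. \<forall>t\<ge>0. \<forall>f\<in>L2_space M. AE x in M. P (s + t) f x = P s (P t f) x) \<and>
     (\<forall>f\<in>L2_space M. ((\<lambda>t. L2_nrm M (\<lambda>x. P t f x - f x)) \<longlongrightarrow> 0) (at_right 0))"

text \<open>Unbounded operators on \<open>L\<^sup>2\<close> are represented by their graphs.\<close>

definition generator_graph ::
  "'a measure \<Rightarrow> (real \<Rightarrow> ('a \<Rightarrow> real) \<Rightarrow> ('a \<Rightarrow> real)) \<Rightarrow> (('a \<Rightarrow> real) \<times> ('a \<Rightarrow> real)) set" where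
  "generator_graph M P =
     {(f, g). f \<in> L2_space M \<and> g \<in> L2_space M \<and>
        ((\<lambda>t. L2_nrm M (\<lambda>x. (P t f x - f x) / t - g x)) \<longlongrightarrow> 0) (at_right 0)}"

definition closure_graph ::
  "'a measure \<Rightarrow> (('a \<Rightarrow> real) \<times> ('a \<Rightarrow> real)) set \<Rightarrow> (('a \<Rightarrow> real) \<times> ('a \<Rightarrow> real)) set" where
  "closure_graph M A =
     {(f, g). f \<in> L2_space M \<and> g \<in> L2_space M \<and>
        (\<exists>u v. (\<forall>n::nat. (u n, v n) \<in> A) \<and>
           (\<lambda>n. L2_nrm M (\<lambda>x. u n x - f x)) \<longlonglongrightarrow> 0 \<and>
           (\<lambda>n. L2_nrm M (\<lambda>x. v n x - g x)) \<longlonglongrightarrow> 0)}"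

definition L2_symmetric :: "'a measure \<Rightarrow> (('a \<Rightarrow> real) \<Rightarrow> ('a \<Rightarrow> real)) \<Rightarrow> bool" where
  "L2_symmetric M T \<longleftrightarrow>
     (\<forall>f\<in>L2_space M. \<forall>g\<in>L2_space M. (\<integral>x. T f x * g x \<partial>M) = (\<integral>x. f x * T g x \<partial>M))"

definition markov_operator :: "'a measure \<Rightarrow> (('a \<Rightarrow> real) \<Rightarrow> ('a \<Rightarrow> real)) \<Rightarrow> bool" where
  "markov_operator M T \<longleftrightarrow>
     (\<forall>f\<in>L2_space M. (AE x in M. 0 \<le> f x) \<longrightarrow> (AE x in M. 0 \<le> T f x)) \<and>
     (AE x in M. T (\<lambda>_. 1) x = 1)"

text \<open>\<open>L_h\<close> is essentially self-adjoint on \<open>C\<^sub>K\<^sup>\<infinity>\<close>, so its unique self-adjoint extension is its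
  closure. The semigroup it generates is therefore the one whose generator is the closure of
  \<open>L_h\<close> restricted to \<open>C\<^sub>K\<^sup>\<infinity>\<close>, which determines \<open>P t\<close>, for \<open>t \<ge> 0\<close>, up to null sets.\<close>

definition semigroup_of :: "(real \<Rightarrow> real) \<Rightarrow> (real \<Rightarrow> (real \<Rightarrow> real) \<Rightarrow> (real \<Rightarrow> real)) \<Rightarrow> bool" where
  "semigroup_of h P \<longleftrightarrow>
     C0_semigroup (mu h) P \<and>
     generator_graph (mu h) P = closure_graph (mu h) {(f, L_op h f) | f. f \<in> test_functions} \<and>
     (\<forall>t\<ge>0. L2_symmetric (mu h) (P t) \<and> markov_operator (mu h) (P t))"

text \<open>Extension to non-negative \<open>g\<close> in \<open>L\<^sup>1\<close>. By positivity the sequence is almost everywhere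
  non-negative and non-decreasing in \<open>n\<close>, so that its limit is the supremum.\<close>

definition extend_L1 ::
  "((real \<Rightarrow> real) \<Rightarrow> (real \<Rightarrow> real)) \<Rightarrow> (real \<Rightarrow> real) \<Rightarrow> real \<Rightarrow> ennreal" where
  "extend_L1 T g x = (SUP n::nat. ennreal (T (\<lambda>y. min (g y) (real n)) x))"

end

(* Proof idea. Write w = exp (- h). It suffices to show the pointwise bound
   P_s f <= D exp(h) * ||f||_{L^1(mu)}: then {P_s g >= t ||g||_1} lies in {h >= ln (t / D)}, whose measure
   is of order 1 / (t sqrt (ln t)) because h is even with c <= h'' <= C.

   The density rho = w P_t f solves rho_t = rho_xx + (h' rho)_x.  With u = exp(- C t) P_t f and
   Y = || w u ||_{L^2(dx)}^2 one has Y' = - 2 q where q >= || (w u)_x ||_2^2, since h'' <= C; the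
   one-dimensional Sobolev inequality (w u)^2 <= a Y + q / a together with the L^1 contraction gives
   Nash's inequality Y^3 <= 4 m^4 q, hence Y <= m^2 / sqrt t.  By the mean value theorem q is bounded at
   some time t in (s/2, s), and there w u is bounded; a maximum principle, obtained by differentiating
   the integral of a convex function of w u that vanishes below the bound, propagates it to time s.
   Both inequalities are checked by an integration by parts on test functions and extended to the
   generator by closure.  The general case follows since the test functions are dense in L^2(mu). *)

theory Submission
  imports Defs
begin

subsection \<open>Square integrable functions\<close>

text \<open>The factor exp(h) appears because the flow is measured in Lebesgue terms: rho = w P_t f
  is a Fokker-Planck density whose Lebesgue L^1 norm is the L^1(mu) norm of f, and on the line an
  L^2 bound on rho and rho_x already controls the supremum. Expanded, the drift leaves the
  zero-order term h'' rho, which the damping exp(- C t) dominates. This flow is not symmetric in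
  L^2(dx), so the usual self-duality step from L^1-L^2 to L^2-L^infinity is not at hand; a maximum
  principle takes its place. The obstacle is regularity: P_t f is known only as an element of the
  generator domain, that is, as an L^2 limit of test functions, with no spatial derivatives. Hence q
  is defined as a pairing with the generator and not as a Dirichlet integral, the Sobolev inequality
  is kept linear in Y and q by means of the free parameter a, and the convex function has a
  Lipschitz derivative. Each of these survives a limit in the graph norm. That the final constant
  does not involve h(0) rests on exp(h(0)) <= sqrt(2 pi / c), a consequence of total mass 1 and h''
  >= c.\<close>

lemma L2_spaceI:
  "f \<in> borel_measurable M \<Longrightarrow> integrable M (\<lambda>x. (f x) ^ 2) \<Longrightarrow> f \<in> L2_space M"
  by (simp add: L2_space_def)

lemma L2_measurable [measurable_dest]: "f \<in> L2_space M \<Longrightarrow> f \<in> borel_measurable M"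
  by (simp add: L2_space_def)

lemma L2_integrable_square: "f \<in> L2_space M \<Longrightarrow> integrable M (\<lambda>x. (f x) ^ 2)"
  by (simp add: L2_space_def)

lemma L2_integrable_mult:
  assumes "f \<in> L2_space M" "g \<in> L2_space M"
  shows "integrable M (\<lambda>x. f x * g x)"
proof (rule Bochner_Integration.integrable_bound)
  show "integrable M (\<lambda>x. (f x)^2 + (g x)^2)"
    using assms by (intro Bochner_Integration.integrable_add L2_integrable_square)
  show "(\<lambda>x. f x * g x) \<in> borel_measurable M" using assms by measurable
  have "\<bar>a * b\<bar> \<le> a^2 + b^2" for a b :: real
  proof -
    have "0 \<le> \<bar>a\<bar> * \<bar>b\<bar>" by simp
    with sum_squares_bound[of "\<bar>a\<bar>" "\<bar>b\<bar>"] show ?thesis unfolding abs_mult power2_abs by linarith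
  qed
  then show "AE x in M. norm (f x * g x) \<le> norm ((f x)^2 + (g x)^2)" by simp
qed

lemma L2_lincomb:
  assumes "f \<in> L2_space M" "g \<in> L2_space M"
  shows "(\<lambda>x. a * f x + b * g x) \<in> L2_space M"
proof (rule L2_spaceI)
  show "(\<lambda>x. a * f x + b * g x) \<in> borel_measurable M" using assms by measurable
  have "integrable M (\<lambda>x. a^2 * (f x)^2 + 2*a*b * (f x * g x) + b^2 * (g x)^2)"
    using assms by (intro Bochner_Integration.integrable_add integrable_mult_right
        L2_integrable_square L2_integrable_mult)
  moreover have "(\<lambda>x. a^2 * (f x)^2 + 2*a*b * (f x * g x) + b^2 * (g x)^2)
      = (\<lambda>x. (a * f x + b * g x)^2)"
    by (rule ext) (simp add: power2_eq_square algebra_simps)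
  ultimately show "integrable M (\<lambda>x. (a * f x + b * g x)^2)" by simp
qed

lemma L2_cmult: "f \<in> L2_space M \<Longrightarrow> (\<lambda>x. a * f x) \<in> L2_space M"
  using L2_lincomb[of f M f a 0] by simp

lemma L2_diff: "f \<in> L2_space M \<Longrightarrow> g \<in> L2_space M \<Longrightarrow> (\<lambda>x. f x - g x) \<in> L2_space M"
  using L2_lincomb[of f M g 1 "-1"] by simp

lemma L2_dominated:
  assumes "f \<in> L2_space M" "g \<in> borel_measurable M" "AE x in M. \<bar>g x\<bar> \<le> K * \<bar>f x\<bar>"
  shows "g \<in> L2_space M"
proof (rule L2_spaceI[OF assms(2)])
  show "integrable M (\<lambda>x. (g x)^2)"
  proof (rule Bochner_Integration.integrable_bound)
    show "integrable M (\<lambda>x. (K * f x)^2)" using L2_integrable_square[OF L2_cmult[OF assms(1)]] .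
    show "(\<lambda>x. (g x)^2) \<in> borel_measurable M" using assms(2) by measurable
    show "AE x in M. norm ((g x)^2) \<le> norm ((K * f x)^2)"
      using assms(3)
    proof eventually_elim
      case (elim x)
      have "\<bar>g x\<bar> \<le> \<bar>K * f x\<bar>" using elim mult_right_mono[OF abs_ge_self[of K] abs_ge_zero[of "f x"]]
        unfolding abs_mult by linarith
      then show ?case by (simp add: abs_le_square_iff)
    qed
  qed
qed

lemma L2_nrm_nonneg [simp]: "0 \<le> L2_nrm M f"
  by (simp add: L2_nrm_def)

lemma L2_nrm_square: "(L2_nrm M f)^2 = (\<integral>x. (f x)^2 \<partial>M)"
  by (simp add: L2_nrm_def)

lemma L2_nrm_cong_AE:
  assumes "f \<in> borel_measurable M" "g \<in> borel_measurable M" "AE x in M. f x = g x"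
  shows "L2_nrm M f = L2_nrm M g"
  unfolding L2_nrm_def using assms
  by (intro arg_cong[of _ _ sqrt] integral_cong_AE) auto

lemma L2_nrm_mono:
  assumes "f \<in> L2_space M" "g \<in> borel_measurable M" "AE x in M. \<bar>g x\<bar> \<le> \<bar>f x\<bar>"
  shows "L2_nrm M g \<le> L2_nrm M f"
proof -
  have "g \<in> L2_space M" using L2_dominated[of f M g 1] assms by simp
  then show ?thesis unfolding L2_nrm_def using assms
    by (intro real_sqrt_le_mono integral_mono_AE L2_integrable_square)
      (auto simp: abs_le_square_iff)
qed

lemma L2_nrm_cmult: "L2_nrm M (\<lambda>x. a * f x) = \<bar>a\<bar> * L2_nrm M f"
  by (simp add: L2_nrm_def power_mult_distrib real_sqrt_mult)

lemma L2_nrm_minus: "L2_nrm M (\<lambda>x. f x - g x) = L2_nrm M (\<lambda>x. g x - f x)"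
  by (simp add: L2_nrm_def power2_commute)

lemma L2_Cauchy_Schwarz:
  assumes f: "f \<in> L2_space M" and g: "g \<in> L2_space M"
  shows "\<bar>\<integral>x. f x * g x \<partial>M\<bar> \<le> L2_nrm M f * L2_nrm M g"
proof -
  define A B D where "A = (\<integral>x. (f x)^2 \<partial>M)" and "B = (\<integral>x. f x * g x \<partial>M)"
    and "D = (\<integral>x. (g x)^2 \<partial>M)"
  have A0: "A \<ge> 0" and D0: "D \<ge> 0" by (auto simp: A_def D_def)
  have *: "0 \<le> A - 2 * r * B + r^2 * D" for r
  proof -
    have "0 \<le> (\<integral>x. (f x - r * g x)^2 \<partial>M)" by simp
    also have "\<dots> = (\<integral>x. (f x)^2 - 2 * r * (f x * g x) + r^2 * (g x)^2 \<partial>M)"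
      by (intro Bochner_Integration.integral_cong) (simp_all add: power2_eq_square algebra_simps)
    also have "\<dots> = A - 2 * r * B + r^2 * D" unfolding A_def B_def D_def
      using L2_integrable_square[OF f] L2_integrable_square[OF g] L2_integrable_mult[OF f g] by simp
    finally show ?thesis .
  qed
  have "B^2 \<le> A * D"
  proof (cases "D = 0")
    case True
    have "B = 0"
    proof (rule ccontr)
      assume "B \<noteq> 0"
      with *[of "(A+1)/(2*B)"] True show False by simp
    qed
    then show ?thesis using A0 D0 by simp
  next
    case False
    with D0 *[of "B/D"] show ?thesis by (simp add: field_simps power2_eq_square)
  qed
  then have "sqrt (B^2) \<le> sqrt (A * D)" by (rule real_sqrt_le_mono)
  then show ?thesis by (simp add: A_def B_def D_def L2_nrm_def real_sqrt_mult)
qed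

lemma L2_triangle:
  assumes f: "f \<in> L2_space M" and g: "g \<in> L2_space M"
  shows "L2_nrm M (\<lambda>x. f x + g x) \<le> L2_nrm M f + L2_nrm M g"
proof (rule power2_le_imp_le)
  have "(L2_nrm M (\<lambda>x. f x + g x))^2 = (\<integral>x. (f x)^2 + 2 * (f x * g x) + (g x)^2 \<partial>M)"
    unfolding L2_nrm_square
    by (intro Bochner_Integration.integral_cong) (auto simp: power2_eq_square algebra_simps)
  also have "\<dots> = (L2_nrm M f)^2 + 2 * (\<integral>x. f x * g x \<partial>M) + (L2_nrm M g)^2"
    unfolding L2_nrm_square
    using L2_integrable_square[OF f] L2_integrable_square[OF g] L2_integrable_mult[OF f g] by simp
  also have "\<dots> \<le> (L2_nrm M f + L2_nrm M g)^2"
    using L2_Cauchy_Schwarz[OF f g] by (simp add: power2_sum)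
  finally show "(L2_nrm M (\<lambda>x. f x + g x))\<^sup>2 \<le> (L2_nrm M f + L2_nrm M g)\<^sup>2" .
qed simp

lemma L2_triangle_diff:
  assumes "f \<in> L2_space M" "g \<in> L2_space M" "k \<in> L2_space M"
  shows "L2_nrm M (\<lambda>x. f x - k x) \<le> L2_nrm M (\<lambda>x. f x - g x) + L2_nrm M (\<lambda>x. g x - k x)"
  using L2_triangle[OF L2_diff[OF assms(1,2)] L2_diff[OF assms(2,3)]] by simp

text \<open>The Lipschitz bound compares values at the same point \<open>x\<close>, so it also
  covers maps that depend on \<open>x\<close>, such as \<open>\<phi> (weight x * f x)\<close> with a
  bounded \<open>weight\<close>.\<close>

lemma L2_tendsto_Lipschitz:
  assumes "\<And>n. u n \<in> L2_space M" "v \<in> L2_space M"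
    and "\<And>n. u' n \<in> borel_measurable M" "v' \<in> borel_measurable M"
    and "\<And>n x. \<bar>u' n x - v' x\<bar> \<le> K * \<bar>u n x - v x\<bar>"
    and "((\<lambda>n. L2_nrm M (\<lambda>x. u n x - v x)) \<longlongrightarrow> 0) F"
  shows "((\<lambda>n. L2_nrm M (\<lambda>x. u' n x - v' x)) \<longlongrightarrow> 0) F"
proof (rule tendsto_sandwich[OF _ _ tendsto_const])
  show "((\<lambda>n. \<bar>K\<bar> * L2_nrm M (\<lambda>x. u n x - v x)) \<longlongrightarrow> 0) F"
    using tendsto_mult_left[OF assms(6), of "\<bar>K\<bar>"] by simp
  have "L2_nrm M (\<lambda>x. u' n x - v' x) \<le> L2_nrm M (\<lambda>x. K * (u n x - v x))" for n
  proof (rule L2_nrm_mono)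
    show "(\<lambda>x. K * (u n x - v x)) \<in> L2_space M" using assms by (intro L2_cmult L2_diff)
    show "(\<lambda>x. u' n x - v' x) \<in> borel_measurable M" using assms by measurable
    have "K * \<bar>y\<bar> \<le> \<bar>K * y\<bar>" for y by (simp add: abs_mult mult_right_mono)
    then show "AE x in M. \<bar>u' n x - v' x\<bar> \<le> \<bar>K * (u n x - v x)\<bar>"
      using assms(5) by (intro AE_I2) (meson order_trans)
  qed
  then show "\<forall>\<^sub>F n in F. L2_nrm M (\<lambda>x. u' n x - v' x) \<le> \<bar>K\<bar> * L2_nrm M (\<lambda>x. u n x - v x)"
    by (simp add: L2_nrm_cmult)
qed simp

text \<open>Both factors converge in norm, so the difference of the products splits into three
  terms, each controlled by Cauchy-Schwarz. Inequalities between such pairings therefore pass from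
  test functions to the closure of the operator.\<close>

lemma L2_tendsto_inner:
  assumes u: "\<And>n. u n \<in> L2_space M" "u0 \<in> L2_space M" and v: "\<And>n. v n \<in> L2_space M" "v0 \<in> L2_space M"
    and cu: "((\<lambda>n. L2_nrm M (\<lambda>x. u n x - u0 x)) \<longlongrightarrow> 0) F"
    and cv: "((\<lambda>n. L2_nrm M (\<lambda>x. v n x - v0 x)) \<longlongrightarrow> 0) F"
  shows "((\<lambda>n. \<integral>x. u n x * v n x \<partial>M) \<longlongrightarrow> (\<integral>x. u0 x * v0 x \<partial>M)) F"
proof (rule LIM_zero_cancel, rule Lim_null_comparison)
  let ?a = "\<lambda>n. L2_nrm M (\<lambda>x. u n x - u0 x)" and ?b = "\<lambda>n. L2_nrm M (\<lambda>x. v n x - v0 x)"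
  show "((\<lambda>n. ?a n * ?b n + ?a n * L2_nrm M v0 + L2_nrm M u0 * ?b n) \<longlongrightarrow> 0) F"
    by (auto intro!: tendsto_eq_intros cu cv)
  have "norm ((\<integral>x. u n x * v n x \<partial>M) - (\<integral>x. u0 x * v0 x \<partial>M))
      \<le> ?a n * ?b n + ?a n * L2_nrm M v0 + L2_nrm M u0 * ?b n" for n
  proof -
    have du: "(\<lambda>x. u n x - u0 x) \<in> L2_space M" and dv: "(\<lambda>x. v n x - v0 x) \<in> L2_space M"
      using u v by (auto intro: L2_diff)
    have "(\<integral>x. u n x * v n x \<partial>M) - (\<integral>x. u0 x * v0 x \<partial>M) = (\<integral>x. u n x * v n x - u0 x * v0 x \<partial>M)"
      using u v by (simp add: L2_integrable_mult)
    also have "\<dots> = (\<integral>x. (u n x - u0 x) * (v n x - v0 x) + (u n x - u0 x) * v0 x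
        + u0 x * (v n x - v0 x) \<partial>M)"
      by (intro Bochner_Integration.integral_cong) (auto simp: algebra_simps)
    also have "\<dots> = (\<integral>x. (u n x - u0 x) * (v n x - v0 x) \<partial>M) + (\<integral>x. (u n x - u0 x) * v0 x \<partial>M)
        + (\<integral>x. u0 x * (v n x - v0 x) \<partial>M)"
      using u v du dv L2_integrable_mult[OF du dv] L2_integrable_mult[OF du v(2)]
        L2_integrable_mult[OF u(2) dv] by simp
    finally show ?thesis
      using L2_Cauchy_Schwarz[OF du dv] L2_Cauchy_Schwarz[OF du v(2)] L2_Cauchy_Schwarz[OF u(2) dv]
      by simp
  qed
  then show "\<forall>\<^sub>F n in F. norm ((\<integral>x. u n x * v n x \<partial>M) - (\<integral>x. u0 x * v0 x \<partial>M))
      \<le> ?a n * ?b n + ?a n * L2_nrm M v0 + L2_nrm M u0 * ?b n" by simp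
qed

lemma L2_tendsto_AE_subseq:
  assumes "\<And>n. u n \<in> L2_space M" "v \<in> L2_space M"
    and "(\<lambda>n. L2_nrm M (\<lambda>x. u n x - v x)) \<longlonglongrightarrow> 0"
  obtains r :: "nat \<Rightarrow> nat" where "strict_mono r" "AE x in M. (\<lambda>n. u (r n) x) \<longlonglongrightarrow> v x"
proof -
  have "(\<lambda>n. (L2_nrm M (\<lambda>x. u n x - v x))^2) \<longlonglongrightarrow> 0"
    using tendsto_power[OF assms(3), of 2] by simp
  then have "(\<lambda>n. \<integral>x. norm ((u n x - v x)^2) \<partial>M) \<longlonglongrightarrow> 0" by (simp add: L2_nrm_square)
  from tendsto_L1_AE_subseq[OF L2_integrable_square[OF L2_diff[OF assms(1,2)]] this]
  obtain r where r: "strict_mono r" "AE x in M. (\<lambda>n. (u (r n) x - v x)^2) \<longlonglongrightarrow> 0" by auto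
  have "AE x in M. (\<lambda>n. u (r n) x) \<longlonglongrightarrow> v x"
    using r(2)
  proof eventually_elim
    case (elim x)
    then have "(\<lambda>n. sqrt ((u (r n) x - v x)^2)) \<longlonglongrightarrow> sqrt 0" by (rule tendsto_real_sqrt)
    then show ?case by (simp add: tendsto_rabs_zero_iff LIM_zero_cancel)
  qed
  with r(1) show thesis by (rule that)
qed

context finite_measure
begin

lemma L2_bounded:
  assumes "f \<in> borel_measurable M" "AE x in M. \<bar>f x\<bar> \<le> B"
  shows "f \<in> L2_space M"
proof (rule L2_spaceI[OF assms(1)])
  show "integrable M (\<lambda>x. (f x)\<^sup>2)"
  proof (rule integrable_const_bound[of _ "B^2"])
    show "AE x in M. norm ((f x)\<^sup>2) \<le> B\<^sup>2"
      using assms(2) by eventually_elim (simp add: abs_le_square_iff[symmetric])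
  qed (use assms(1) in measurable)
qed

lemma L2_const: "(\<lambda>_. a) \<in> L2_space M"
  by (rule L2_bounded[of _ "\<bar>a\<bar>"]) auto

lemma L2_integrable: "f \<in> L2_space M \<Longrightarrow> integrable M f"
  using L2_integrable_mult[OF _ L2_const[of 1], of f] by simp

end

subsection \<open>Symmetric Markov semigroups\<close>

lemma L2_dominated_convergence:
  assumes "\<And>n. u n \<in> borel_measurable M" "v \<in> borel_measurable M" "g \<in> L2_space M"
    and lim: "AE x in M. (\<lambda>n. u n x) \<longlonglongrightarrow> v x"
    and bound: "\<And>n. AE x in M. \<bar>u n x\<bar> \<le> \<bar>g x\<bar>" "AE x in M. \<bar>v x\<bar> \<le> \<bar>g x\<bar>"
  shows "(\<lambda>n. L2_nrm M (\<lambda>x. u n x - v x)) \<longlonglongrightarrow> 0"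
proof -
  have "(\<lambda>n. \<integral>x. (u n x - v x)^2 \<partial>M) \<longlonglongrightarrow> (\<integral>x. 0 \<partial>M)"
  proof (rule integral_dominated_convergence)
    show "integrable M (\<lambda>x. (2 * g x)^2)" by (intro L2_integrable_square L2_cmult assms)
    show "AE x in M. (\<lambda>n. (u n x - v x)^2) \<longlonglongrightarrow> 0"
      using lim by eventually_elim (auto intro!: tendsto_eq_intros)
    show "AE x in M. norm ((u n x - v x)^2) \<le> (2 * g x)^2" for n
      using bound(1)[of n] bound(2)
    proof eventually_elim
      case (elim x)
      have "\<bar>u n x - v x\<bar> \<le> \<bar>2 * g x\<bar>" using elim by (simp add: abs_mult)
      then show ?case by (simp add: abs_le_square_iff)
    qed
  qed (use assms in measurable)
  from tendsto_real_sqrt[OF this] show ?thesis by (simp add: L2_nrm_def)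
qed

locale symmetric_markov_semigroup = prob_space M for M :: "'a measure" +
  fixes P :: "real \<Rightarrow> ('a \<Rightarrow> real) \<Rightarrow> ('a \<Rightarrow> real)"
  assumes C0: "C0_semigroup M P"
    and symmetric: "\<And>t. 0 \<le> t \<Longrightarrow> L2_symmetric M (P t)"
    and markov: "\<And>t. 0 \<le> t \<Longrightarrow> markov_operator M (P t)"
begin

section \<open>Positivity, invariance of the measure and contraction\<close>

lemma P_L2 [intro]: "0 \<le> t \<Longrightarrow> f \<in> L2_space M \<Longrightarrow> P t f \<in> L2_space M"
  using C0 by (auto simp: C0_semigroup_def L2_operator_def)

lemma P_measurable: "0 \<le> t \<Longrightarrow> f \<in> L2_space M \<Longrightarrow> P t f \<in> borel_measurable M"
  using P_L2 L2_measurable by blast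

lemma P_lincomb:
  "0 \<le> t \<Longrightarrow> f \<in> L2_space M \<Longrightarrow> g \<in> L2_space M \<Longrightarrow>
    AE x in M. P t (\<lambda>y. a * f y + b * g y) x = a * P t f x + b * P t g x"
  using C0 by (auto simp: C0_semigroup_def L2_operator_def)

lemma P_diff:
  "0 \<le> t \<Longrightarrow> f \<in> L2_space M \<Longrightarrow> g \<in> L2_space M \<Longrightarrow>
    AE x in M. P t (\<lambda>y. f y - g y) x = P t f x - P t g x"
  using P_lincomb[of t f g 1 "-1"] by simp

lemma P_cong:
  "0 \<le> t \<Longrightarrow> f \<in> L2_space M \<Longrightarrow> g \<in> L2_space M \<Longrightarrow> AE x in M. f x = g x \<Longrightarrow>
    AE x in M. P t f x = P t g x"
  using C0 unfolding C0_semigroup_def L2_operator_def by blast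

lemma P_add_time:
  "0 \<le> s \<Longrightarrow> 0 \<le> t \<Longrightarrow> f \<in> L2_space M \<Longrightarrow> AE x in M. P (s + t) f x = P s (P t f) x"
  using C0 unfolding C0_semigroup_def by blast

lemma P_nonneg:
  "0 \<le> t \<Longrightarrow> f \<in> L2_space M \<Longrightarrow> AE x in M. 0 \<le> f x \<Longrightarrow> AE x in M. 0 \<le> P t f x"
  using markov by (auto simp: markov_operator_def)

lemma P_mono:
  assumes "0 \<le> t" "f \<in> L2_space M" "g \<in> L2_space M" "AE x in M. f x \<le> g x"
  shows "AE x in M. P t f x \<le> P t g x"
proof -
  have "AE x in M. 0 \<le> P t (\<lambda>y. g y - f y) x"
    using assms by (intro P_nonneg L2_diff) auto
  with P_diff[OF assms(1,3,2)] show ?thesis by eventually_elim simp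
qed

lemma P_one: "0 \<le> t \<Longrightarrow> AE x in M. P t (\<lambda>_. 1) x = 1"
  using markov by (auto simp: markov_operator_def)

lemma P_abs:
  assumes "0 \<le> t" "f \<in> L2_space M"
  shows "AE x in M. \<bar>P t f x\<bar> \<le> P t (\<lambda>y. \<bar>f y\<bar>) x"
proof -
  have a: "(\<lambda>y. \<bar>f y\<bar>) \<in> L2_space M" using assms(2) by (intro L2_dominated[OF assms(2), of _ 1]) auto
  have "(\<lambda>y. - 1 * f y) \<in> L2_space M" using assms by (intro L2_cmult)
  then have "AE x in M. P t (\<lambda>y. - 1 * f y) x \<le> P t (\<lambda>y. \<bar>f y\<bar>) x"
    using assms a by (intro P_mono) auto
  moreover have "AE x in M. P t f x \<le> P t (\<lambda>y. \<bar>f y\<bar>) x"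
    using assms a by (intro P_mono) auto
  moreover have "AE x in M. P t (\<lambda>y. - 1 * f y) x = - P t f x"
    using P_lincomb[OF assms assms(2), of "-1" 0] by simp
  ultimately show ?thesis by eventually_elim simp
qed

text \<open>Symmetry tested against the constant 1, which \<open>P t\<close> fixes, makes
  \<open>M\<close> invariant.\<close>

lemma P_integral:
  assumes "0 \<le> t" "f \<in> L2_space M"
  shows "(\<integral>x. P t f x \<partial>M) = (\<integral>x. f x \<partial>M)"
proof -
  have "(\<integral>x. P t f x * 1 \<partial>M) = (\<integral>x. f x * P t (\<lambda>_. 1) x \<partial>M)"
    by (rule bspec[OF bspec[OF symmetric[OF assms(1), unfolded L2_symmetric_def] assms(2)] L2_const])
  also have "\<dots> = (\<integral>x. f x \<partial>M)"
    using P_one[OF assms(1)] assms P_L2[OF assms(1) L2_const[of 1]]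
    by (intro integral_cong_AE) auto
  finally show ?thesis by simp
qed

lemma P_L1:
  assumes "0 \<le> t" "f \<in> L2_space M"
  shows "(\<integral>x. \<bar>P t f x\<bar> \<partial>M) \<le> (\<integral>x. \<bar>f x\<bar> \<partial>M)"
proof -
  have a: "(\<lambda>y. \<bar>f y\<bar>) \<in> L2_space M" using assms(2) by (intro L2_dominated[OF assms(2), of _ 1]) auto
  have "(\<integral>x. \<bar>P t f x\<bar> \<partial>M) \<le> (\<integral>x. P t (\<lambda>y. \<bar>f y\<bar>) x \<partial>M)"
    using assms a P_abs[OF assms] by (intro integral_mono_AE integrable_abs L2_integrable) auto
  then show ?thesis using P_integral[OF assms(1) a] by simp
qed

text \<open>Jensen's inequality \<open>(P t f)^2 \<le> P t (f^2)\<close> followed by invariance of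
  the measure. Positivity of \<open>P t ((f - a)^2)\<close> for every \<open>a\<close> gives a
  quadratic in \<open>a\<close> whose discriminant yields Jensen. Boundedness of \<open>f\<close>
  keeps \<open>f^2\<close> in L2, where \<open>P t\<close> is defined.\<close>

lemma P_contraction_bounded:
  assumes t: "0 \<le> t" and f: "f \<in> borel_measurable M" "\<And>x. \<bar>f x\<bar> \<le> B"
  shows "L2_nrm M (P t f) \<le> L2_nrm M f"
proof -
  have fL: "f \<in> L2_space M" using f by (intro L2_bounded[of f B]) auto
  have f2: "(\<lambda>x. (f x)^2) \<in> L2_space M"
  proof (rule L2_dominated[OF fL])
    have "\<bar>f x\<bar> * \<bar>f x\<bar> \<le> B * \<bar>f x\<bar>" for x by (rule mult_right_mono[OF f(2) abs_ge_zero])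
    then show "AE x in M. \<bar>(f x)\<^sup>2\<bar> \<le> B * \<bar>f x\<bar>" by (simp add: power2_eq_square)
  qed (use f in measurable)
  have "AE x in M. 0 \<le> P t (\<lambda>x. (f x)^2) x - 2 * a * P t f x + a^2" for a
  proof -
    have l1: "(\<lambda>x. 1 * (f x)^2 + (- 2 * a) * f x) \<in> L2_space M" by (intro L2_lincomb f2 fL)
    have l2: "(\<lambda>x. 1 * (1 * (f x)^2 + (- 2 * a) * f x) + a^2 * 1) \<in> L2_space M"
      by (intro L2_lincomb[OF l1] L2_const)
    have sq: "1 * (1 * (f x)^2 + (- 2 * a) * f x) + a^2 * 1 = (f x - a)^2" for x
      by (simp add: power2_eq_square algebra_simps)
    have "AE x in M. 0 \<le> P t (\<lambda>x. 1 * (1 * (f x)^2 + (- 2 * a) * f x) + a^2 * 1) x"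
    proof (rule P_nonneg[OF t l2], rule AE_I2)
      show "0 \<le> 1 * (1 * (f x)^2 + (- 2 * a) * f x) + a^2 * 1" for x
        unfolding sq by simp
    qed
    with P_lincomb[OF t l1 L2_const[of 1], of 1 "a^2"] P_lincomb[OF t f2 fL, of 1 "-2*a"] P_one[OF t]
    show ?thesis by eventually_elim simp
  qed
  \<comment> \<open>The null set depends on \<open>a\<close>, so only countably many values are
    used; density of the rationals recovers the discriminant inequality.\<close>
  then have "AE x in M. \<forall>a\<in>\<rat>. 0 \<le> P t (\<lambda>x. (f x)^2) x - 2 * a * P t f x + a^2"
    by (simp add: AE_ball_countable countable_rat)
  then have le: "AE x in M. (P t f x)^2 \<le> P t (\<lambda>x. (f x)^2) x"
  proof eventually_elim
    case (elim x)
    show ?case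
    proof (rule ccontr)
      assume "\<not> ?case"
      then have pos: "0 < (P t f x)^2 - P t (\<lambda>x. (f x)^2) x" by simp
      define \<delta> where "\<delta> = sqrt ((P t f x)^2 - P t (\<lambda>x. (f x)^2) x)"
      have d: "0 < \<delta>" "\<delta>^2 = (P t f x)^2 - P t (\<lambda>x. (f x)^2) x"
        using pos by (auto simp: \<delta>_def)
      obtain a where a: "a \<in> \<rat>" "P t f x < a" "a < P t f x + \<delta>"
        using Rats_dense_in_real[of "P t f x" "P t f x + \<delta>"] d(1) by auto
      have "(a - P t f x)^2 < \<delta>^2" using a by (intro power_strict_mono) auto
      moreover have "0 \<le> P t (\<lambda>x. (f x)^2) x - 2 * a * P t f x + a^2" using elim a by blast
      ultimately show False using d(2) by (simp add: power2_eq_square algebra_simps)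
    qed
  qed
  have "(\<integral>x. (P t f x)^2 \<partial>M) \<le> (\<integral>x. P t (\<lambda>x. (f x)^2) x \<partial>M)"
    using le t fL f2 by (intro integral_mono_AE L2_integrable_square L2_integrable) auto
  also have "\<dots> = (\<integral>x. (f x)^2 \<partial>M)" by (rule P_integral[OF t f2])
  finally show ?thesis by (simp add: L2_nrm_def)
qed

text \<open>\<open>L2_operator\<close> supplies only some operator bound \<open>B\<close>. After
  truncation at height \<open>n\<close>, \<open>B\<close> multiplies just the truncation error,
  which tends to 0, and the main part has norm ratio 1.\<close>

lemma P_contraction:
  assumes t: "0 \<le> t" and f: "f \<in> L2_space M"
  shows "L2_nrm M (P t f) \<le> L2_nrm M f"
proof -
  have "L2_operator M (P t)" using C0 t by (simp add: C0_semigroup_def)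
  then have "\<exists>B. \<forall>f\<in>L2_space M. L2_nrm M (P t f) \<le> B * L2_nrm M f"
    by (simp add: L2_operator_def)
  then obtain B where "\<forall>f\<in>L2_space M. L2_nrm M (P t f) \<le> B * L2_nrm M f" ..
  then have B: "L2_nrm M (P t f) \<le> B * L2_nrm M f" if "f \<in> L2_space M" for f using that by simp
  define u where "u n x = max (- real n) (min (real n) (f x))" for n x
  have m: "u n \<in> borel_measurable M" for n using f unfolding u_def by measurable
  have le: "\<bar>u n x\<bar> \<le> \<bar>f x\<bar>" for n x by (auto simp: u_def)
  have uL: "u n \<in> L2_space M" for n using le by (intro L2_dominated[OF f m, of _ 1]) auto
  have "(\<lambda>n. u n x) \<longlonglongrightarrow> f x" for x
  proof (rule tendsto_eventually)
    obtain N where "\<bar>f x\<bar> \<le> real N" using real_arch_simple by blast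
    then have "u n x = f x" if "N \<le> n" for n using that by (auto simp: u_def)
    then show "\<forall>\<^sub>F n in sequentially. u n x = f x" by (auto simp: eventually_sequentially)
  qed
  then have lim: "(\<lambda>n. L2_nrm M (\<lambda>x. u n x - f x)) \<longlonglongrightarrow> 0"
    using m f le by (intro L2_dominated_convergence[where g = f]) auto
  have "L2_nrm M (P t f) \<le> L2_nrm M f + B * L2_nrm M (\<lambda>x. u n x - f x)" for n
  proof -
    have "L2_nrm M (P t f) = L2_nrm M (\<lambda>x. P t (\<lambda>y. f y - u n y) x + P t (u n) x)"
    proof (rule L2_nrm_cong_AE)
      show "AE x in M. P t f x = P t (\<lambda>y. f y - u n y) x + P t (u n) x"
        using P_diff[OF t f uL[of n]] by eventually_elim simp
    qed (use t f uL L2_diff[OF f uL[of n]] in \<open>auto intro!: borel_measurable_add P_measurable\<close>)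
    also have "\<dots> \<le> L2_nrm M (P t (\<lambda>y. f y - u n y)) + L2_nrm M (P t (u n))"
      using t f uL by (intro L2_triangle P_L2 L2_diff) auto
    also have "\<dots> \<le> B * L2_nrm M (\<lambda>y. f y - u n y) + L2_nrm M (u n)"
      by (intro add_mono B L2_diff f uL P_contraction_bounded[OF t m, of n "real n"])
        (auto simp: u_def)
    also have "L2_nrm M (u n) \<le> L2_nrm M f" using le by (intro L2_nrm_mono f m) auto
    finally show ?thesis by (simp add: L2_nrm_minus[of M f])
  qed
  moreover have "(\<lambda>n. L2_nrm M f + B * L2_nrm M (\<lambda>x. u n x - f x)) \<longlonglongrightarrow> L2_nrm M f + B * 0"
    by (intro tendsto_intros lim)
  ultimately show ?thesis by (intro LIMSEQ_le_const[of _ "L2_nrm M f"]) auto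
qed

section \<open>Generator and differentiability in time\<close>

lemma generator_L2:
  "(f, g) \<in> generator_graph M P \<Longrightarrow> f \<in> L2_space M"
  "(f, g) \<in> generator_graph M P \<Longrightarrow> g \<in> L2_space M"
  by (auto simp: generator_graph_def)

lemma generator_tendsto:
  "(f, g) \<in> generator_graph M P \<Longrightarrow>
    ((\<lambda>t. L2_nrm M (\<lambda>x. (P t f x - f x) / t - g x)) \<longlongrightarrow> 0) (at_right 0)"
  by (auto simp: generator_graph_def)

text \<open>The left side is the norm of \<open>P t\<close> applied to the defect of the difference
  quotient at time 0, and \<open>P t\<close> is a contraction.\<close>

lemma P_step_right:
  assumes fg: "(f, g) \<in> generator_graph M P" and t: "0 \<le> t" and r: "0 < r"
  shows "L2_nrm M (\<lambda>x. (P (t + r) f x - P t f x) / r - P t g x)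
    \<le> L2_nrm M (\<lambda>x. (P r f x - f x) / r - g x)"
proof -
  note f = generator_L2(1)[OF fg] and g = generator_L2(2)[OF fg]
  have Pf: "P r f \<in> L2_space M" using r f by auto
  have q: "(\<lambda>x. inverse r * P r f x + (- inverse r) * f x) \<in> L2_space M" by (intro L2_lincomb f Pf)
  have "L2_nrm M (\<lambda>x. (P (t + r) f x - P t f x) / r - P t g x)
      = L2_nrm M (P t (\<lambda>x. (inverse r * P r f x + (- inverse r) * f x) - g x))"
  proof (rule L2_nrm_cong_AE)
    show "AE x in M. (P (t + r) f x - P t f x) / r - P t g x =
         P t (\<lambda>x. inverse r * P r f x + - inverse r * f x - g x) x"
      using P_diff[OF t q g] P_lincomb[OF t Pf f, of "inverse r" "- inverse r"]
        P_add_time[OF t less_imp_le[OF r] f]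
      by eventually_elim (simp add: divide_inverse algebra_simps)
  qed (use t r f g q in \<open>auto intro!: borel_measurable_diff borel_measurable_divide P_measurable L2_diff\<close>)
  also have "\<dots> \<le> L2_nrm M (\<lambda>x. (inverse r * P r f x + (- inverse r) * f x) - g x)"
    by (intro P_contraction t L2_diff q g)
  finally show ?thesis by (simp add: divide_inverse algebra_simps)
qed

lemma P_generator:
  assumes fg: "(f, g) \<in> generator_graph M P" and t: "0 \<le> t"
  shows "(P t f, P t g) \<in> generator_graph M P"
proof -
  note f = generator_L2(1)[OF fg] and g = generator_L2(2)[OF fg]
  have "((\<lambda>r. L2_nrm M (\<lambda>x. (P r (P t f) x - P t f x) / r - P t g x)) \<longlongrightarrow> 0) (at_right 0)"
  proof (rule tendsto_sandwich[OF _ _ tendsto_const generator_tendsto[OF fg]])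
    show "\<forall>\<^sub>F r in at_right 0. L2_nrm M (\<lambda>x. (P r (P t f) x - P t f x) / r - P t g x)
        \<le> L2_nrm M (\<lambda>x. (P r f x - f x) / r - g x)"
      using eventually_at_right_less[of 0]
    proof eventually_elim
      case (elim r)
      have "L2_nrm M (\<lambda>x. (P r (P t f) x - P t f x) / r - P t g x)
        = L2_nrm M (\<lambda>x. (P (t + r) f x - P t f x) / r - P t g x)"
      proof (rule L2_nrm_cong_AE)
        show "AE x in M. (P r (P t f) x - P t f x) / r - P t g x
          = (P (t + r) f x - P t f x) / r - P t g x"
          using P_add_time[of r t f] elim t f by (auto simp: add.commute)
      qed (use elim t f g in \<open>auto intro!: borel_measurable_diff borel_measurable_divide P_measurable\<close>)
      then show ?case using P_step_right[OF fg t elim] by simp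
    qed
  qed simp
  then show ?thesis using t f g by (auto simp: generator_graph_def)
qed

text \<open>A backward quotient at \<open>t\<close> is a forward quotient at \<open>t - r\<close>,
  whose limit there is \<open>P (t - r) g\<close>. Replacing it by
  \<open>P t g = P (t - r) (P r g)\<close> costs the second term, which strong continuity makes
  small.\<close>

lemma P_step_left:
  assumes fg: "(f, g) \<in> generator_graph M P" and r: "0 < r" "r \<le> t"
  shows "L2_nrm M (\<lambda>x. (P (t - r) f x - P t f x) / (- r) - P t g x)
    \<le> L2_nrm M (\<lambda>x. (P r f x - f x) / r - g x) + L2_nrm M (\<lambda>x. P r g x - g x)"
proof -
  note f = generator_L2(1)[OF fg] and g = generator_L2(2)[OF fg]
  have tr: "0 \<le> t - r" "0 \<le> r" "0 \<le> t" using r by auto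
  have Pg: "P r g \<in> L2_space M" using r g by auto
  have L1: "(\<lambda>x. (P t f x - P (t - r) f x) / r - P (t - r) g x) \<in> L2_space M"
    using L2_diff[OF L2_cmult[OF L2_diff[OF P_L2[OF tr(3) f] P_L2[OF tr(1) f]], of "inverse r"] P_L2[OF tr(1) g]]
    by (simp add: divide_inverse mult.commute)
  have L2: "P (t - r) (\<lambda>y. P r g y - g y) \<in> L2_space M" using tr g Pg by (auto intro!: L2_diff)
  have "L2_nrm M (\<lambda>x. (P (t - r) f x - P t f x) / (- r) - P t g x)
      = L2_nrm M (\<lambda>x. ((P t f x - P (t - r) f x) / r - P (t - r) g x)
          + - 1 * P (t - r) (\<lambda>y. P r g y - g y) x)"
  proof (rule L2_nrm_cong_AE)
    show "AE x in M. (P (t - r) f x - P t f x) / (- r) - P t g x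
      = ((P t f x - P (t - r) f x) / r - P (t - r) g x) + - 1 * P (t - r) (\<lambda>y. P r g y - g y) x"
      using P_diff[OF tr(1) Pg g] P_add_time[OF tr(1,2) g]
      by eventually_elim (simp add: diff_divide_distrib)
  qed (use tr f g L2_diff[OF Pg g] in \<open>auto intro!: borel_measurable_diff borel_measurable_add
        borel_measurable_uminus borel_measurable_divide P_measurable\<close>)
  also have "\<dots> \<le> L2_nrm M (\<lambda>x. (P t f x - P (t - r) f x) / r - P (t - r) g x)
      + L2_nrm M (\<lambda>x. - 1 * P (t - r) (\<lambda>y. P r g y - g y) x)"
    by (intro L2_triangle L1 L2_cmult L2)
  also have "\<dots> \<le> L2_nrm M (\<lambda>x. (P r f x - f x) / r - g x) + L2_nrm M (\<lambda>y. P r g y - g y)"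
  proof (rule add_mono)
    show "L2_nrm M (\<lambda>x. (P t f x - P (t - r) f x) / r - P (t - r) g x)
        \<le> L2_nrm M (\<lambda>x. (P r f x - f x) / r - g x)"
      using P_step_right[OF fg tr(1) r(1)] by simp
    show "L2_nrm M (\<lambda>x. - 1 * P (t - r) (\<lambda>y. P r g y - g y) x) \<le> L2_nrm M (\<lambda>y. P r g y - g y)"
      using P_contraction[OF tr(1) L2_diff[OF Pg g]] L2_nrm_cmult[of M "-1"] by simp
  qed
  finally show ?thesis .
qed

text \<open>The generator is defined by a limit from the right only. The two-sided limit is what
  turns functionals of the curve into functions with a \<open>has_real_derivative\<close>, to which
  mean value arguments apply.\<close>

lemma P_derivative:
  assumes fg: "(f, g) \<in> generator_graph M P" and t: "0 < t"
  shows "((\<lambda>r. L2_nrm M (\<lambda>x. (P (t + r) f x - P t f x) / r - P t g x)) \<longlongrightarrow> 0) (at 0)"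
proof -
  note f = generator_L2(1)[OF fg] and g = generator_L2(2)[OF fg]
  have right: "((\<lambda>r. L2_nrm M (\<lambda>x. (P (t + r) f x - P t f x) / r - P t g x)) \<longlongrightarrow> 0) (at_right 0)"
  proof (rule tendsto_sandwich[OF _ _ tendsto_const generator_tendsto[OF fg]])
    show "\<forall>\<^sub>F r in at_right 0. L2_nrm M (\<lambda>x. (P (t + r) f x - P t f x) / r - P t g x)
        \<le> L2_nrm M (\<lambda>x. (P r f x - f x) / r - g x)"
      using eventually_at_right_less[of 0]
      by eventually_elim (use P_step_right[OF fg] t in auto)
  qed simp
  have "((\<lambda>r. L2_nrm M (\<lambda>x. (P (t - r) f x - P t f x) / (- r) - P t g x)) \<longlongrightarrow> 0) (at_right 0)"
  proof (rule tendsto_sandwich[OF _ _ tendsto_const])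
    show "((\<lambda>r. L2_nrm M (\<lambda>x. (P r f x - f x) / r - g x) + L2_nrm M (\<lambda>x. P r g x - g x)) \<longlongrightarrow> 0) (at_right 0)"
      using tendsto_add[OF generator_tendsto[OF fg]] C0 g by (force simp: C0_semigroup_def)
    have "\<forall>\<^sub>F r in at_right 0. r < t" using t by (rule eventually_at_right_real[THEN eventually_mono]) auto
    with eventually_at_right_less[of 0]
    show "\<forall>\<^sub>F r in at_right 0. L2_nrm M (\<lambda>x. (P (t - r) f x - P t f x) / (- r) - P t g x)
        \<le> L2_nrm M (\<lambda>x. (P r f x - f x) / r - g x) + L2_nrm M (\<lambda>x. P r g x - g x)"
      by eventually_elim (use P_step_left[OF fg] in auto)
  qed simp
  then have "((\<lambda>r. L2_nrm M (\<lambda>x. (P (t + r) f x - P t f x) / r - P t g x)) \<longlongrightarrow> 0) (at_left 0)"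
    unfolding at_left_minus[of 0] filterlim_filtermap by simp
  with right show ?thesis by (simp add: filterlim_at_split)
qed

end

subsection \<open>Convex functionals along a curve\<close>

text \<open>For \<open>r > D\<close> this is \<open>x^2 / (1 + x)\<close> with
  \<open>x = r - D\<close>: quadratic at the threshold and of linear growth. Its primitive is thus
  convex, vanishes exactly for \<open>r \<le> D\<close>, and has a 1-Lipschitz first and a
  continuous second derivative. The simpler primitive \<open>x^2 / 2\<close> would have a second
  derivative that jumps at \<open>D\<close>.\<close>

definition excess :: "real \<Rightarrow> real \<Rightarrow> real" where
  "excess D r = (let x = max 0 (r - D) in x - 1 + 1 / (1 + x))"

definition excess_primitive :: "real \<Rightarrow> real \<Rightarrow> real" where
  "excess_primitive D r = (let x = max 0 (r - D) in x\<^sup>2 / 2 - x + ln (1 + x))"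

definition excess_deriv :: "real \<Rightarrow> real \<Rightarrow> real" where
  "excess_deriv D r = (let x = max 0 (r - D) in 1 - 1 / (1 + x)\<^sup>2)"

text \<open>The condition \<open>F' 0 = 0\<close> matches the one-sided derivatives at the kink
  \<open>r = D\<close>.\<close>

lemma DERIV_comp_positive_part:
  fixes F F' :: "real \<Rightarrow> real"
  assumes F: "\<And>x. 0 \<le> x \<Longrightarrow> (F has_real_derivative F' x) (at x)" and z: "F' 0 = 0"
  shows "((\<lambda>r. F (max 0 (r - D))) has_real_derivative F' (max 0 (r - D))) (at r)"
proof -
  consider "r < D" | "r = D" | "D < r" by linarith
  then show ?thesis
  proof cases
    case 1
    have "((\<lambda>r. F 0) has_real_derivative 0) (at r)" by simp
    then have "((\<lambda>r. F (max 0 (r - D))) has_real_derivative 0) (at r)"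
      by (rule has_field_derivative_transform_within_open[of _ _ _ "{..<D}"]) (use 1 in auto)
    then show ?thesis using 1 z by simp
  next
    case 3
    have "((\<lambda>r. F (r - D)) has_real_derivative F' (r - D) * 1) (at r)"
      by (rule DERIV_chain2[where g = "\<lambda>r. r - D"]) (use 3 in \<open>auto intro!: F derivative_eq_intros\<close>)
    then have "((\<lambda>r. F (r - D)) has_real_derivative F' (r - D)) (at r)" by simp
    then have "((\<lambda>r. F (max 0 (r - D))) has_real_derivative F' (r - D)) (at r)"
      by (rule has_field_derivative_transform_within_open[of _ _ _ "{D<..}"])
        (use 3 in auto)
    then show ?thesis using 3 by simp
  next
    case 2
    have "(F has_real_derivative 0) (at 0)" using F[of 0] z by simp
    then have "((\<lambda>h. (F h - F 0) / h) \<longlongrightarrow> 0) (at 0)" by (simp add: DERIV_def)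
    then have r: "((\<lambda>h. (F h - F 0) / h) \<longlongrightarrow> 0) (at_right 0)" by (rule filterlim_at_split[THEN iffD1, THEN conjunct2])
    have "((\<lambda>h. (F (max 0 (r + h - D)) - F (max 0 (r - D))) / h) \<longlongrightarrow> 0) (at 0)"
      unfolding filterlim_at_split
    proof
      show "((\<lambda>h. (F (max 0 (r + h - D)) - F (max 0 (r - D))) / h) \<longlongrightarrow> 0) (at_right 0)"
        by (rule Lim_transform_eventually[OF r], rule eventually_mono[OF eventually_at_right_less[of 0]])
          (use 2 in simp)
      have l: "\<forall>\<^sub>F h in at_left (0::real). h < 0" by (auto simp: eventually_at_filter)
      show "((\<lambda>h. (F (max 0 (r + h - D)) - F (max 0 (r - D))) / h) \<longlongrightarrow> 0) (at_left 0)"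
        by (rule tendsto_eventually, rule eventually_mono[OF l]) (use 2 in simp)
    qed
    then show ?thesis using 2 z by (simp add: DERIV_def)
  qed
qed

lemma DERIV_excess_primitive: "(excess_primitive D has_real_derivative excess D r) (at r)"
proof -
  have "((\<lambda>x. x\<^sup>2 / 2 - x + ln (1 + x)) has_real_derivative x - 1 + 1 / (1 + x)) (at x)"
    if "0 \<le> x" for x :: real
    using that by (auto intro!: derivative_eq_intros)
  from DERIV_comp_positive_part[OF this, of D r] show ?thesis
    by (simp add: excess_def excess_primitive_def[abs_def] Let_def)
qed

lemma DERIV_excess: "(excess D has_real_derivative excess_deriv D r) (at r)"
proof -
  have "((\<lambda>x. x - 1 + 1 / (1 + x)) has_real_derivative 1 - 1 / (1 + x)\<^sup>2) (at x)"
    if "0 \<le> x" for x :: real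
    using that by (auto intro!: derivative_eq_intros simp: power2_eq_square)
  from DERIV_comp_positive_part[OF this, of D r] show ?thesis
    by (simp add: excess_def[abs_def] excess_deriv_def Let_def)
qed

lemma excess_deriv_bounds: "0 \<le> excess_deriv D r" "excess_deriv D r \<le> 1"
proof -
  have "1 \<le> (1 + max 0 (r - D))\<^sup>2" by (rule one_le_power) simp
  then show "0 \<le> excess_deriv D r" "excess_deriv D r \<le> 1" by (auto simp: excess_deriv_def Let_def)
qed

lemma continuous_excess_deriv: "continuous_on A (excess_deriv D)"
proof -
  have "1 + max 0 (r - D) \<noteq> 0" for r by linarith
  then show ?thesis unfolding excess_deriv_def[abs_def] Let_def
    by (intro continuous_intros) auto
qed

lemma excess_primitive_eq_0: "r \<le> D \<Longrightarrow> excess_primitive D r = 0"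
  by (simp add: excess_primitive_def)

lemma excess_eq_0: "r \<le> D \<Longrightarrow> excess D r = 0"
  by (simp add: excess_def)

lemma excess_pos:
  assumes "D < r" shows "0 < excess D r"
proof -
  have "excess D r = (r - D)\<^sup>2 / (1 + (r - D))"
    using assms by (simp add: excess_def field_simps power2_eq_square)
  then show ?thesis using assms by simp
qed

lemma excess_nonneg: "0 \<le> excess D r"
  using excess_pos[of D r] excess_eq_0[of r D] by linarith

lemma excess_primitive_mono: "a \<le> b \<Longrightarrow> excess_primitive D a \<le> excess_primitive D b"
  by (rule DERIV_nonneg_imp_nondecreasing[of a b])
    (blast intro: DERIV_excess_primitive excess_nonneg)+

lemma excess_primitive_nonneg: "0 \<le> excess_primitive D r"
  using excess_primitive_mono[of "min r D" r D] excess_primitive_eq_0[of "min r D" D] by simp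

lemma excess_primitive_pos:
  assumes "D < r" shows "0 < excess_primitive D r"
proof -
  have "excess_primitive D D < excess_primitive D r"
  proof (rule DERIV_pos_imp_increasing_open[OF assms])
    show "\<exists>y. (excess_primitive D has_real_derivative y) (at x) \<and> 0 < y" if "D < x" for x
      using DERIV_excess_primitive excess_pos[OF that] by blast
    show "continuous_on {D..r} (excess_primitive D)"
      using DERIV_excess_primitive by (blast intro: continuous_at_imp_continuous_on DERIV_isCont)
  qed
  then show ?thesis by (simp add: excess_primitive_eq_0)
qed

lemma DERIV_bounded_Lipschitz:
  fixes f :: "real \<Rightarrow> real"
  assumes "\<And>x. (f has_real_derivative f' x) (at x)" "\<And>x. \<bar>f' x\<bar> \<le> L"
  shows "\<bar>f a - f b\<bar> \<le> L * \<bar>a - b\<bar>"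
  using field_differentiable_bound[of UNIV f f' L a b] assms by auto

lemma excess_Lipschitz: "\<bar>excess D a - excess D b\<bar> \<le> \<bar>a - b\<bar>"
  using DERIV_bounded_Lipschitz[of "excess D" "excess_deriv D" 1 a b] DERIV_excess excess_deriv_bounds
  by (simp add: abs_le_iff)

lemma first_order_Taylor_bound:
  fixes G \<phi> :: "real \<Rightarrow> real"
  assumes G: "\<And>x. (G has_real_derivative \<phi> x) (at x)" and L: "\<And>a b. \<bar>\<phi> a - \<phi> b\<bar> \<le> \<bar>a - b\<bar>"
  shows "\<bar>G b - G a - \<phi> a * (b - a)\<bar> \<le> (b - a)\<^sup>2"
proof -
  have "\<exists>x. G b - G a = \<phi> x * (b - a) \<and> \<bar>x - a\<bar> \<le> \<bar>b - a\<bar>"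
  proof -
    consider "a < b" | "a = b" | "b < a" by linarith
    then show ?thesis
    proof cases
      case 1
      from MVT2[OF 1 G] obtain x where "a < x" "x < b" "G b - G a = (b - a) * \<phi> x" by blast
      then show ?thesis by (intro exI[of _ x]) auto
    next
      case 3
      from MVT2[OF 3 G] obtain x where "b < x" "x < a" "G a - G b = (a - b) * \<phi> x" by blast
      then show ?thesis by (intro exI[of _ x]) (auto simp: algebra_simps)
    qed auto
  qed
  then obtain x where x: "G b - G a = \<phi> x * (b - a)" "\<bar>x - a\<bar> \<le> \<bar>b - a\<bar>" by blast
  have "G b - G a - \<phi> a * (b - a) = (\<phi> x - \<phi> a) * (b - a)" using x(1) by (simp add: algebra_simps)
  then have "\<bar>G b - G a - \<phi> a * (b - a)\<bar> = \<bar>\<phi> x - \<phi> a\<bar> * \<bar>b - a\<bar>" by (simp add: abs_mult)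
  also have "\<dots> \<le> \<bar>b - a\<bar> * \<bar>b - a\<bar>" using L[of x a] x(2) by (intro mult_right_mono) auto
  finally show ?thesis by (simp add: power2_eq_square)
qed

text \<open>If \<open>M\<close> has Lebesgue density \<open>w\<close>, the integral of
  \<open>G (w u) / w\<close> over \<open>M\<close> is the Lebesgue integral of \<open>G\<close> of
  the density \<open>w u\<close>. It exists because \<open>G\<close> is at most quadratic near and
  far from 0, so that the integrand is at most \<open>w u^2\<close>, and \<open>w\<close> is
  bounded.\<close>

lemma L2_weighted_entropy:
  fixes G \<phi> :: "real \<Rightarrow> real"
  assumes w: "w \<in> borel_measurable M" "\<And>x. 0 < w x" "\<And>x. w x \<le> \<kappa>"
    and G: "\<And>x. (G has_real_derivative \<phi> x) (at x)" and L: "\<And>a b. \<bar>\<phi> a - \<phi> b\<bar> \<le> \<bar>a - b\<bar>"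
    and z: "G 0 = 0" "\<phi> 0 = 0" and u: "u \<in> L2_space M"
  shows L2_weighted_derivative: "(\<lambda>x. \<phi> (w x * u x)) \<in> L2_space M"
    and integrable_weighted_entropy: "integrable M (\<lambda>x. G (w x * u x) / w x)"
proof -
  have contG: "continuous_on UNIV G" using G by (auto intro!: continuous_at_imp_continuous_on DERIV_isCont)
  have cont\<phi>: "continuous_on UNIV \<phi>"
    by (rule continuous_on_iff[THEN iffD2]) (metis L dist_real_def le_less_trans)
  note [measurable] = borel_measurable_continuous_onI[OF contG] borel_measurable_continuous_onI[OF cont\<phi>]
    w(1) L2_measurable[OF u]
  have wb: "\<bar>w x * u x\<bar> \<le> \<kappa> * \<bar>u x\<bar>" for x
    using w(2,3)[of x] by (simp add: abs_mult mult_right_mono)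
  have "\<bar>\<phi> (w x * u x)\<bar> \<le> \<kappa> * \<bar>u x\<bar>" for x
    using L[of "w x * u x" 0] z wb[of x] by simp
  then show "(\<lambda>x. \<phi> (w x * u x)) \<in> L2_space M" by (intro L2_dominated[OF u]) auto
  show "integrable M (\<lambda>x. G (w x * u x) / w x)"
  proof (rule Bochner_Integration.integrable_bound)
    show "integrable M (\<lambda>x. \<kappa> * (u x)\<^sup>2)" by (intro integrable_mult_right L2_integrable_square u)
    have "\<bar>G (w x * u x) / w x\<bar> \<le> \<kappa> * (u x)\<^sup>2" for x
    proof -
      have "\<bar>G (w x * u x)\<bar> \<le> (w x * u x)\<^sup>2"
        using first_order_Taylor_bound[OF G L, of "w x * u x" 0] z by simp
      then have "\<bar>G (w x * u x) / w x\<bar> \<le> (w x * u x)\<^sup>2 / w x"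
        using w(2)[of x] by (simp add: divide_right_mono)
      also have "\<dots> = w x * (u x)\<^sup>2" using w(2)[of x] by (simp add: power2_eq_square)
      also have "\<dots> \<le> \<kappa> * (u x)\<^sup>2" using w(3)[of x] by (intro mult_right_mono) auto
      finally show ?thesis .
    qed
    then show "AE x in M. norm (G (w x * u x) / w x) \<le> norm (\<kappa> * (u x)\<^sup>2)"
      by (intro AE_I2) (metis abs_ge_self order_trans real_norm_def)
  qed measurable
qed

text \<open>A chain rule for a curve that is differentiable only in the L2 norm: a Lipschitz
  derivative \<open>\<phi>\<close> makes the second order error quadratic in the increment, hence
  integrable and negligible, without any pointwise differentiability of the curve.\<close>

lemma DERIV_weighted_entropy:
  fixes G \<phi> :: "real \<Rightarrow> real"
  assumes w: "w \<in> borel_measurable M" "\<And>x. 0 < w x" "\<And>x. w x \<le> \<kappa>"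
    and G: "\<And>x. (G has_real_derivative \<phi> x) (at x)" and L: "\<And>a b. \<bar>\<phi> a - \<phi> b\<bar> \<le> \<bar>a - b\<bar>"
    and z: "G 0 = 0" "\<phi> 0 = 0"
    and U: "\<forall>\<^sub>F r in at 0. U (t + r) \<in> L2_space M" "U t \<in> L2_space M" and Z: "Z \<in> L2_space M"
    and lim: "((\<lambda>r. L2_nrm M (\<lambda>x. (U (t + r) x - U t x) / r - Z x)) \<longlongrightarrow> 0) (at 0)"
  shows "((\<lambda>t. \<integral>x. G (w x * U t x) / w x \<partial>M) has_real_derivative
    (\<integral>x. \<phi> (w x * U t x) * Z x \<partial>M)) (at t)"
  unfolding DERIV_def
proof (rule LIM_zero_cancel, rule Lim_null_comparison)
  let ?e = "\<lambda>r. L2_nrm M (\<lambda>x. (U (t + r) x - U t x) / r - Z x)"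
  let ?n = "L2_nrm M (\<lambda>x. \<phi> (w x * U t x))"
  note int = integrable_weighted_entropy[OF w G L z] and L2\<phi> = L2_weighted_derivative[OF w G L z]
  show "((\<lambda>r. ?n * ?e r + \<kappa> * \<bar>r\<bar> * (?e r + L2_nrm M Z)\<^sup>2) \<longlongrightarrow> 0) (at 0)"
    by (auto intro!: tendsto_eq_intros lim)
  show "\<forall>\<^sub>F r in at 0. norm (((\<integral>x. G (w x * U (t + r) x) / w x \<partial>M) - (\<integral>x. G (w x * U t x) / w x \<partial>M)) / r
      - (\<integral>x. \<phi> (w x * U t x) * Z x \<partial>M)) \<le> ?n * ?e r + \<kappa> * \<bar>r\<bar> * (?e r + L2_nrm M Z)\<^sup>2"
    using U(1) eventually_neq_at_within[of 0]
  proof eventually_elim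
    case (elim r)
    define d where "d x = (U (t + r) x - U t x) / r" for x
    have dL: "d \<in> L2_space M"
      using L2_cmult[OF L2_diff[OF elim(1) U(2)], of "inverse r"]
      by (simp add: d_def[abs_def] divide_inverse mult.commute)
    have rd: "U (t + r) x - U t x = r * d x" for x using elim by (simp add: d_def)
    have \<phi>L: "(\<lambda>x. \<phi> (w x * U t x)) \<in> L2_space M" by (rule L2\<phi>[OF U(2)])
    have i1: "integrable M (\<lambda>x. \<phi> (w x * U t x) * d x)" by (rule L2_integrable_mult[OF \<phi>L dL])
    \<comment> \<open>\<open>R\<close> is the first order Taylor remainder. It is at most
      \<open>\<kappa> * r^2 * d^2\<close>, hence of order \<open>\<bar>r\<bar>\<close> in mean after
      division by \<open>r\<close>; the linear part converges by Cauchy-Schwarz.\<close>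
    define R where "R x = G (w x * U (t + r) x) / w x - G (w x * U t x) / w x - r * (\<phi> (w x * U t x) * d x)" for x
    have Ri: "integrable M R" unfolding R_def
      by (intro Bochner_Integration.integrable_diff int elim(1) U(2) integrable_mult_right i1)
    have Rb: "\<bar>R x\<bar> \<le> \<kappa> * (r\<^sup>2 * (d x)\<^sup>2)" for x
    proof -
      have wx: "0 < w x" by (rule w(2))
      have "R x = (G (w x * U (t + r) x) - G (w x * U t x)
          - \<phi> (w x * U t x) * (w x * U (t + r) x - w x * U t x)) / w x"
        using wx rd[of x] unfolding R_def by (simp add: diff_divide_distrib right_diff_distrib[symmetric])
      then have "\<bar>R x\<bar> = \<bar>G (w x * U (t + r) x) - G (w x * U t x)
          - \<phi> (w x * U t x) * (w x * U (t + r) x - w x * U t x)\<bar> / w x" using wx by simp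
      also have "\<dots> \<le> (w x * U (t + r) x - w x * U t x)\<^sup>2 / w x"
        using wx by (intro divide_right_mono first_order_Taylor_bound[OF G L]) auto
      also have "\<dots> = w x * (r\<^sup>2 * (d x)\<^sup>2)"
        using wx by (simp add: right_diff_distrib[symmetric] rd power2_eq_square)
      also have "\<dots> \<le> \<kappa> * (r\<^sup>2 * (d x)\<^sup>2)" using w(3) by (intro mult_right_mono) auto
      finally show ?thesis .
    qed
    have "\<bar>\<integral>x. R x \<partial>M\<bar> \<le> (\<integral>x. \<bar>R x\<bar> \<partial>M)" by (rule integral_abs_bound)
    also have "\<dots> \<le> (\<integral>x. \<kappa> * (r\<^sup>2 * (d x)\<^sup>2) \<partial>M)"
      by (intro integral_mono integrable_abs Ri integrable_mult_right L2_integrable_square dL Rb)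
    also have "\<dots> = \<kappa> * r\<^sup>2 * (L2_nrm M d)\<^sup>2" by (simp add: L2_nrm_square)
    also have "\<dots> \<le> \<kappa> * r\<^sup>2 * (?e r + L2_nrm M Z)\<^sup>2"
    proof (intro mult_left_mono power_mono)
      show "L2_nrm M d \<le> ?e r + L2_nrm M Z"
        using L2_triangle[OF L2_diff[OF dL Z] Z] by (simp add: d_def[abs_def])
      show "0 \<le> \<kappa> * r\<^sup>2" using w(2,3)[of undefined] by simp
    qed simp
    finally have R: "\<bar>\<integral>x. R x \<partial>M\<bar> \<le> \<kappa> * r\<^sup>2 * (?e r + L2_nrm M Z)\<^sup>2" .
    have alg: "(a - b) / r - z = R / r + j" if "R = a - b - r * i" "j = i - z" "r \<noteq> 0"
      for R a b i j z :: real using that(3) unfolding that(1,2) by (simp add: field_simps)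
    have "(\<integral>x. R x \<partial>M) = (\<integral>x. G (w x * U (t + r) x) / w x \<partial>M) - (\<integral>x. G (w x * U t x) / w x \<partial>M)
        - r * (\<integral>x. \<phi> (w x * U t x) * d x \<partial>M)"
      unfolding R_def using int[OF elim(1)] int[OF U(2)] i1 by simp
    moreover have "(\<integral>x. \<phi> (w x * U t x) * (d x - Z x) \<partial>M)
        = (\<integral>x. \<phi> (w x * U t x) * d x \<partial>M) - (\<integral>x. \<phi> (w x * U t x) * Z x \<partial>M)"
      unfolding right_diff_distrib using i1 L2_integrable_mult[OF \<phi>L Z] by simp
    ultimately have "((\<integral>x. G (w x * U (t + r) x) / w x \<partial>M) - (\<integral>x. G (w x * U t x) / w x \<partial>M)) / r
      - (\<integral>x. \<phi> (w x * U t x) * Z x \<partial>M)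
      = (\<integral>x. R x \<partial>M) / r + (\<integral>x. \<phi> (w x * U t x) * (d x - Z x) \<partial>M)"
      using elim(2) by (intro alg)
    moreover have "\<bar>(\<integral>x. R x \<partial>M) / r\<bar> \<le> \<kappa> * \<bar>r\<bar> * (?e r + L2_nrm M Z)\<^sup>2"
    proof -
      have "\<bar>(\<integral>x. R x \<partial>M) / r\<bar> \<le> \<kappa> * r\<^sup>2 * (?e r + L2_nrm M Z)\<^sup>2 / \<bar>r\<bar>"
        using R by (simp add: divide_right_mono)
      also have "\<dots> = \<kappa> * \<bar>r\<bar> * (?e r + L2_nrm M Z)\<^sup>2"
      proof -
        have "a * (b * b) * c / b = a * b * c" if "b \<noteq> 0" for a b c :: real using that by simp
        from this[of "\<bar>r\<bar>"] show ?thesis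
          using elim(2) unfolding power2_abs[of r, symmetric] power2_eq_square[of "\<bar>r\<bar>"] by simp
      qed
      finally show ?thesis .
    qed
    moreover have "\<bar>\<integral>x. \<phi> (w x * U t x) * (d x - Z x) \<partial>M\<bar> \<le> ?n * ?e r"
      using L2_Cauchy_Schwarz[OF \<phi>L L2_diff[OF dL Z]] by (simp add: d_def)
    ultimately show ?case unfolding real_norm_def by linarith
  qed
qed

text \<open>The function \<open>1 / Y^2\<close> has derivative \<open>4 q / Y^3\<close>, which is at
  least \<open>1 / m^4\<close>. Its value at \<open>a\<close> is only used to be nonnegative, so the
  bound does not depend on how large \<open>Y a\<close> is.\<close>

lemma cubic_decay:
  fixes Y q :: "real \<Rightarrow> real"
  assumes Y: "\<And>t. a \<le> t \<Longrightarrow> t \<le> b \<Longrightarrow> (Y has_real_derivative - 2 * q t) (at t)"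
    and nonneg: "\<And>t. a \<le> t \<Longrightarrow> t \<le> b \<Longrightarrow> 0 \<le> Y t"
    and q: "\<And>t. a \<le> t \<Longrightarrow> t \<le> b \<Longrightarrow> Y t ^ 3 \<le> 4 * m ^ 4 * q t" and m: "0 < m" and ab: "a < b"
  shows "(Y b)\<^sup>2 \<le> m ^ 4 / (b - a)"
proof (cases "Y b = 0")
  case True
  then show ?thesis using m ab by simp
next
  case False
  then have Yb: "0 < Y b" using nonneg[of b] ab by simp
  have q0: "0 \<le> q t" if "a \<le> t" "t \<le> b" for t
  proof -
    have "0 \<le> Y t ^ 3" using nonneg[OF that] by simp
    also have "\<dots> \<le> 4 * m ^ 4 * q t" by (rule q[OF that])
    finally show ?thesis using m by (simp add: zero_le_mult_iff)
  qed
  \<comment> \<open>\<open>Y\<close> is nonincreasing, so positivity at \<open>b\<close> propagates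
    backwards and \<open>1 / Y^2\<close> is defined on the whole interval.\<close>
  have pos: "0 < Y t" if "a \<le> t" "t \<le> b" for t
  proof -
    have "Y b \<le> Y t"
    proof (rule DERIV_nonpos_imp_nonincreasing[OF that(2)])
      fix x assume "t \<le> x" "x \<le> b"
      with that have "a \<le> x" "x \<le> b" by auto
      with Y[of x] q0[of x] show "\<exists>y. (Y has_real_derivative y) (at x) \<and> y \<le> 0"
        by (intro exI[of _ "- 2 * q x"]) auto
    qed
    then show ?thesis using Yb by simp
  qed
  have "1 / (Y a)\<^sup>2 - a / m ^ 4 \<le> 1 / (Y b)\<^sup>2 - b / m ^ 4"
  proof (rule DERIV_nonneg_imp_nondecreasing[where f = "\<lambda>t. 1 / (Y t)\<^sup>2 - t / m ^ 4"])
    fix t assume t: "a \<le> t" "t \<le> b"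
    have "((\<lambda>t. 1 / (Y t)\<^sup>2) has_real_derivative 4 * q t / (Y t) ^ 3) (at t)"
      using pos[OF t]
      by (intro DERIV_cong[OF DERIV_divide[OF DERIV_const DERIV_power[OF Y[OF t]]]])
        (simp_all add: field_simps power2_eq_square power3_eq_cube)
    then have "((\<lambda>t. 1 / (Y t)\<^sup>2 - t / m ^ 4) has_real_derivative 4 * q t / (Y t) ^ 3 - 1 / m ^ 4) (at t)"
      by (intro DERIV_diff DERIV_cdivide DERIV_ident)
    moreover have "0 \<le> 4 * q t / (Y t) ^ 3 - 1 / m ^ 4"
      using q[OF t] pos[OF t] m by (simp add: field_simps)
    ultimately show "\<exists>y. ((\<lambda>t. 1 / (Y t)\<^sup>2 - t / m ^ 4) has_real_derivative y) (at t) \<and> 0 \<le> y" by blast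
  qed (use ab in simp)
  moreover have "0 \<le> 1 / (Y a)\<^sup>2" by simp
  ultimately have "(b - a) / m ^ 4 \<le> 1 / (Y b)\<^sup>2" unfolding diff_divide_distrib by linarith
  then show ?thesis using Yb m ab by (simp add: field_simps)
qed

subsection \<open>Nash inequality and maximum principle\<close>

context symmetric_markov_semigroup
begin

lemma generator_scale:
  assumes fg: "(f, g) \<in> generator_graph M P"
  shows "((\<lambda>x. c * f x), (\<lambda>x. c * g x)) \<in> generator_graph M P"
proof -
  note f = generator_L2(1)[OF fg] and g = generator_L2(2)[OF fg]
  have "((\<lambda>r. L2_nrm M (\<lambda>x. (P r (\<lambda>x. c * f x) x - c * f x) / r - c * g x)) \<longlongrightarrow> 0) (at_right 0)"
  proof (rule Lim_transform_eventually)
    show "((\<lambda>r. \<bar>c\<bar> * L2_nrm M (\<lambda>x. (P r f x - f x) / r - g x)) \<longlongrightarrow> 0) (at_right 0)"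
      using tendsto_mult_left[OF generator_tendsto[OF fg], of "\<bar>c\<bar>"] by simp
    show "\<forall>\<^sub>F r in at_right 0. \<bar>c\<bar> * L2_nrm M (\<lambda>x. (P r f x - f x) / r - g x)
        = L2_nrm M (\<lambda>x. (P r (\<lambda>x. c * f x) x - c * f x) / r - c * g x)"
      using eventually_at_right_less[of 0]
    proof eventually_elim
      case (elim r)
      have r: "0 \<le> r" using elim by simp
      have "L2_nrm M (\<lambda>x. c * ((P r f x - f x) / r - g x))
          = L2_nrm M (\<lambda>x. (P r (\<lambda>x. c * f x) x - c * f x) / r - c * g x)"
      proof (rule L2_nrm_cong_AE)
        have "AE x in M. P r (\<lambda>x. c * f x) x = c * P r f x"
          using P_lincomb[OF r f f, of c 0] by simp
        then show "AE x in M. c * ((P r f x - f x) / r - g x)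
            = (P r (\<lambda>x. c * f x) x - c * f x) / r - c * g x"
          by eventually_elim (simp add: algebra_simps)
      qed (use P_measurable[OF r f] P_measurable[OF r L2_cmult[OF f, of c]] L2_measurable[OF f]
          L2_measurable[OF g] in measurable)
      then show ?case by (simp add: L2_nrm_cmult)
    qed
  qed
  then show ?thesis using L2_cmult[OF f, of c] L2_cmult[OF g, of c] by (auto simp: generator_graph_def)
qed

text \<open>The product rule in L2. The error splits into the defect of the derivative of
  \<open>P\<close>, the variation of the exponential, and the defect of the derivative of the
  exponential; each tends to 0 by itself.\<close>

lemma damped_derivative:
  assumes fg: "(f, g) \<in> generator_graph M P" and t: "0 < t"
  shows "((\<lambda>r. L2_nrm M (\<lambda>x. (exp (- C * (t + r)) * P (t + r) f x - exp (- C * t) * P t f x) / r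
    - exp (- C * t) * (P t g x - C * P t f x))) \<longlongrightarrow> 0) (at 0)"
proof (rule Lim_null_comparison)
  note f = generator_L2(1)[OF fg] and g = generator_L2(2)[OF fg]
  let ?e = "\<lambda>r. exp (- C * (t + r))" and ?k = "exp (- C * t)"
  let ?d = "\<lambda>r. L2_nrm M (\<lambda>x. (P (t + r) f x - P t f x) / r - P t g x)"
  have e: "(?e \<longlongrightarrow> ?k) (at 0)" by (auto intro!: tendsto_eq_intros)
  have "((\<lambda>t. exp (- C * t)) has_real_derivative - C * ?k) (at t)"
    by (auto intro!: derivative_eq_intros)
  then have e': "((\<lambda>r. (?e r - ?k) / r) \<longlongrightarrow> - C * ?k) (at 0)" by (simp add: DERIV_def)
  show "((\<lambda>r. \<bar>?e r\<bar> * ?d r + (\<bar>?e r - ?k\<bar> * L2_nrm M (P t g)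
      + \<bar>(?e r - ?k) / r + C * ?k\<bar> * L2_nrm M (P t f))) \<longlongrightarrow> 0) (at 0)"
    by (rule tendsto_eq_intros P_derivative[OF fg t] e e' refl | simp)+
  have "\<forall>\<^sub>F r in at 0. - t < r" using t
    by (intro eventually_at_ball[of t 0, THEN eventually_mono]) (auto simp: dist_real_def)
  with eventually_neq_at_within[of 0]
  show "\<forall>\<^sub>F r in at 0. norm (L2_nrm M (\<lambda>x. (?e r * P (t + r) f x - ?k * P t f x) / r
    - ?k * (P t g x - C * P t f x))) \<le> \<bar>?e r\<bar> * ?d r + (\<bar>?e r - ?k\<bar> * L2_nrm M (P t g)
      + \<bar>(?e r - ?k) / r + C * ?k\<bar> * L2_nrm M (P t f))"
  proof eventually_elim
    case (elim r)
    have tr: "0 \<le> t + r" "0 \<le> t" using elim t by auto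
    note Pf = P_L2[OF tr(2) f] and Pg = P_L2[OF tr(2) g] and Pf' = P_L2[OF tr(1) f]
    have "(a * x - b * y) / r - b * (z - C * y)
        = a * ((x - y) / r - z) + ((a - b) * z + ((a - b) / r + C * b) * y)" for a b x y z
      using elim(1) by (simp add: field_simps)
    then have eq: "(\<lambda>x. (?e r * P (t + r) f x - ?k * P t f x) / r - ?k * (P t g x - C * P t f x))
        = (\<lambda>x. ?e r * ((P (t + r) f x - P t f x) / r - P t g x)
          + ((?e r - ?k) * P t g x + ((?e r - ?k) / r + C * ?k) * P t f x))"
      by (intro ext)
    have q: "(\<lambda>x. (P (t + r) f x - P t f x) / r - P t g x) \<in> L2_space M"
      using L2_diff[OF L2_cmult[OF L2_diff[OF Pf' Pf], of "inverse r"] Pg]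
      by (simp add: divide_inverse mult.commute)
    have "L2_nrm M (\<lambda>x. ?e r * ((P (t + r) f x - P t f x) / r - P t g x)
          + ((?e r - ?k) * P t g x + ((?e r - ?k) / r + C * ?k) * P t f x))
        \<le> L2_nrm M (\<lambda>x. ?e r * ((P (t + r) f x - P t f x) / r - P t g x))
          + L2_nrm M (\<lambda>x. (?e r - ?k) * P t g x + ((?e r - ?k) / r + C * ?k) * P t f x)"
      by (rule L2_triangle[OF L2_cmult[OF q] L2_lincomb[OF Pg Pf]])
    also have "\<dots> \<le> L2_nrm M (\<lambda>x. ?e r * ((P (t + r) f x - P t f x) / r - P t g x))
          + (L2_nrm M (\<lambda>x. (?e r - ?k) * P t g x) + L2_nrm M (\<lambda>x. ((?e r - ?k) / r + C * ?k) * P t f x))"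
      by (rule add_left_mono[OF L2_triangle[OF L2_cmult[OF Pg] L2_cmult[OF Pf]]])
    finally show ?case unfolding eq by (simp only: L2_nrm_cmult real_norm_def abs_of_nonneg[OF L2_nrm_nonneg])
  qed
qed

text \<open>Assumption \<open>sup\<close> is the one-dimensional Sobolev inequality with free
  parameter \<open>a\<close>, and \<open>exc\<close> states that the part of \<open>w u\<close>
  above a level is dissipated. Both pair with \<open>v - C u\<close>, the time derivative of the
  damped curve \<open>U\<close>, and both concern only pairs in the generator, which are all that is
  known about \<open>P t f\<close>.\<close>

theorem ultracontractive_bound:
  fixes w :: "'a \<Rightarrow> real"
  assumes w: "w \<in> borel_measurable M" "\<And>x. 0 < w x" "\<And>x. w x \<le> \<kappa>" and C: "0 \<le> C"
    and sup: "\<And>u v a. (u, v) \<in> generator_graph M P \<Longrightarrow> 0 < a \<Longrightarrow>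
      AE x in M. (w x * u x)\<^sup>2 \<le> a * (\<integral>x. w x * (u x)\<^sup>2 \<partial>M)
        - (\<integral>x. w x * u x * (v x - C * u x) \<partial>M) / a"
    and exc: "\<And>u v D. (u, v) \<in> generator_graph M P \<Longrightarrow> 0 \<le> D \<Longrightarrow>
      (\<integral>x. excess D (w x * u x) * (v x - C * u x) \<partial>M) \<le> 0"
    and fg: "(f, g) \<in> generator_graph M P" and s: "0 < s"
    and m: "0 < m" "(\<integral>x. \<bar>f x\<bar> \<partial>M) \<le> m"
  shows "AE x in M. w x * P s f x \<le> exp (C * s) * (m * sqrt (2 / sqrt s * (1 + 1 / s)))"
proof -
  note f = generator_L2(1)[OF fg] and g = generator_L2(2)[OF fg]
  define U where "U t x = exp (- C * t) * P t f x" for t x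
  define Z where "Z t x = exp (- C * t) * (P t g x - C * P t f x)" for t x
  define Y where "Y t = (\<integral>x. w x * (U t x)\<^sup>2 \<partial>M)" for t
  define q where "q t = - (\<integral>x. w x * U t x * Z t x \<partial>M)" for t
  have UL: "U t \<in> L2_space M" if "0 < t" for t
    unfolding U_def[abs_def] using that f by (intro L2_cmult P_L2) auto
  have ZL: "Z t \<in> L2_space M" if "0 < t" for t
    unfolding Z_def[abs_def] using that f g by (intro L2_cmult L2_diff P_L2) auto
  have gen: "(U t, \<lambda>x. exp (- C * t) * P t g x) \<in> generator_graph M P" if "0 < t" for t
    unfolding U_def[abs_def] using that by (intro generator_scale P_generator fg) auto
  have Z: "exp (- C * t) * P t g x - C * U t x = Z t x" for t x
    by (simp add: U_def Z_def algebra_simps)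
  have supU: "AE x in M. (w x * U t x)\<^sup>2 \<le> a * Y t + q t / a" if "0 < t" "0 < a" for t a
    using sup[OF gen[OF that(1)] that(2)] unfolding Z Y_def q_def by simp
  have excU: "(\<integral>x. excess D (w x * U t x) * Z t x \<partial>M) \<le> 0" if "0 < t" "0 \<le> D" for t D
    using exc[OF gen[OF that(1)] that(2)] unfolding Z .
  have UL': "\<forall>\<^sub>F r in at 0. U (t + r) \<in> L2_space M" if "0 < t" for t
    using that by (intro eventually_at_ball[of t 0, THEN eventually_mono]) (auto simp: dist_real_def intro!: UL)
  have lim: "((\<lambda>r. L2_nrm M (\<lambda>x. (U (t + r) x - U t x) / r - Z t x)) \<longlongrightarrow> 0) (at 0)" if "0 < t" for t
    unfolding U_def Z_def by (rule damped_derivative[OF fg that])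
  have Y': "(Y has_real_derivative - 2 * q t) (at t)" if t: "0 < t" for t
  proof -
    have "((\<lambda>t. \<integral>x. ((w x * U t x)\<^sup>2 / 2) / w x \<partial>M) has_real_derivative (\<integral>x. (w x * U t x) * Z t x \<partial>M)) (at t)"
      by (rule DERIV_weighted_entropy[OF w _ _ _ _ UL'[OF t] UL[OF t] ZL[OF t] lim[OF t]])
        (auto intro!: derivative_eq_intros)
    moreover have pointwise: "(w x * y)\<^sup>2 / 2 / w x = (w x * y\<^sup>2) / 2" for x y
      using w(2)[of x] by (simp add: power2_eq_square)
    have "(\<integral>x. ((w x * U t x)\<^sup>2 / 2) / w x \<partial>M) = Y t / 2" for t
      unfolding Y_def pointwise by simp
    ultimately have "((\<lambda>t. Y t / 2) has_real_derivative - q t) (at t)"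
      unfolding q_def minus_minus by (simp only:)
    from DERIV_cmult[OF this, of 2] show ?thesis by simp
  qed
  have Y0: "0 \<le> Y t" for t
    unfolding Y_def using w(2) by (intro integral_nonneg_AE AE_I2 mult_nonneg_nonneg) (auto intro: less_imp_le)
  have L1: "(\<integral>x. \<bar>U t x\<bar> \<partial>M) \<le> m" if t: "0 < t" for t
  proof -
    have t0: "0 \<le> t" using t by simp
    have "(\<integral>x. \<bar>U t x\<bar> \<partial>M) = exp (- C * t) * (\<integral>x. \<bar>P t f x\<bar> \<partial>M)"
      by (simp add: U_def abs_mult)
    also have "\<dots> \<le> 1 * (\<integral>x. \<bar>P t f x\<bar> \<partial>M)"
      using C t by (intro mult_right_mono) auto
    also have "\<dots> \<le> m" using P_L1[OF t0 f] m by simp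
    finally show ?thesis .
  qed
  have nash: "Y t ^ 3 \<le> 4 * m ^ 4 * q t" if t: "0 < t" for t
  proof -
    \<comment> \<open>A constant that dominates a square almost everywhere on a probability space is
      nonnegative.\<close>
    have S0: "0 \<le> a * Y t + q t / a" if "0 < a" for a
    proof -
      have "AE x in M. 0 \<le> a * Y t + q t / a"
        using supU[OF t that] by eventually_elim (rule order_trans[OF zero_le_power2])
      then show ?thesis by simp
    qed
    show ?thesis
    proof (cases "Y t = 0")
      case True
      then have "0 \<le> q t" using S0[of 1] by simp
      then show ?thesis using True by simp
    next
      case False
      then have Yt: "0 < Y t" using Y0[of t] by simp
      \<comment> \<open>Integrating \<open>w U^2 \<le> sqrt S * \<bar>U\<bar>\<close> gives
        \<open>Y^2 \<le> S m^2\<close>. This \<open>a\<close> makes the first part of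
        \<open>S m^2\<close> equal to \<open>Y^2 / 2\<close>, which is absorbed on the left.\<close>
      define a where "a = Y t / (2 * m\<^sup>2)"
      have a: "0 < a" using Yt m by (simp add: a_def)
      define S where "S = a * Y t + q t / a"
      have S: "0 \<le> S" unfolding S_def by (rule S0[OF a])
      have "Y t \<le> (\<integral>x. sqrt S * \<bar>U t x\<bar> \<partial>M)"
        unfolding Y_def
      proof (rule integral_mono_AE')
        show "integrable M (\<lambda>x. sqrt S * \<bar>U t x\<bar>)"
          using UL[OF t] by (intro integrable_mult_right integrable_abs L2_integrable)
        show "AE x in M. w x * (U t x)\<^sup>2 \<le> sqrt S * \<bar>U t x\<bar>"
          using supU[OF t a]
        proof eventually_elim
          case (elim x)
          then have "\<bar>w x * U t x\<bar> \<le> sqrt S" unfolding S_def by (rule real_le_rsqrt[of "\<bar>_\<bar>", simplified])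
          then have "\<bar>w x * U t x\<bar> * \<bar>U t x\<bar> \<le> sqrt S * \<bar>U t x\<bar>" by (rule mult_right_mono) simp
          then show ?case using w(2)[of x] by (simp add: abs_mult power2_eq_square mult.assoc)
        qed
        show "AE x in M. 0 \<le> sqrt S * \<bar>U t x\<bar>" using S by simp
      qed
      also have "\<dots> \<le> sqrt S * m" using L1[OF t] S by (simp add: mult_left_mono)
      finally have "(Y t)\<^sup>2 \<le> (sqrt S * m)\<^sup>2" using Yt by (intro power_mono) auto
      also have "\<dots> = S * m\<^sup>2" using S by (simp add: power_mult_distrib)
      also have "\<dots> = (Y t)\<^sup>2 / 2 + 2 * m ^ 4 * q t / Y t"
        using m Yt by (simp add: S_def a_def field_simps eval_nat_numeral)
      finally have "(Y t)\<^sup>2 / 2 \<le> 2 * m ^ 4 * q t / Y t" by simp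
      then have "(Y t)\<^sup>2 / 2 * Y t \<le> 2 * m ^ 4 * q t" using Yt by (simp add: pos_le_divide_eq)
      then show ?thesis by (simp add: power2_eq_square power3_eq_cube)
    qed
  qed
  have q0: "0 \<le> q t" if "0 < t" for t
  proof -
    have "0 \<le> Y t ^ 3" using Y0[of t] by simp
    also note nash[OF that]
    finally show ?thesis using m by (simp add: zero_le_mult_iff)
  qed
  \<comment> \<open>The decay is run on \<open>[s / 4, s / 2]\<close>, since \<open>Y\<close> is
    differentiable only at positive times; the length \<open>s / 4\<close> produces the factor
    2.\<close>
  have Yhalf: "Y (s / 2) \<le> 2 * m\<^sup>2 / sqrt s"
  proof (rule power2_le_imp_le)
    have "(Y (s / 2))\<^sup>2 \<le> m ^ 4 / (s / 2 - s / 4)"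
    proof (rule cubic_decay[where q = q])
      fix t assume "s / 4 \<le> t"
      then have "0 < t" using s by simp
      then show "(Y has_real_derivative - 2 * q t) (at t)" "Y t ^ 3 \<le> 4 * m ^ 4 * q t"
        by (fact Y' nash)+
    qed (use s m Y0 in auto)
    also have "\<dots> = (2 * m\<^sup>2 / sqrt s)\<^sup>2"
      using s by (simp add: power_divide power_mult_distrib flip: power_mult)
    finally show "(Y (s / 2))\<^sup>2 \<le> (2 * m\<^sup>2 / sqrt s)\<^sup>2" .
    show "0 \<le> 2 * m\<^sup>2 / sqrt s" using s by simp
  qed
  \<comment> \<open>The loss of \<open>Y\<close> over \<open>[s / 2, s]\<close> is at most
    \<open>Y (s / 2)\<close>, so some intermediate \<open>t\<close> has
    \<open>q t \<le> Y (s / 2) / s\<close>. There the Sobolev inequality becomes a uniform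
    bound.\<close>
  have "\<exists>t. s / 2 < t \<and> t < s \<and> Y s - Y (s / 2) = (s - s / 2) * (- 2 * q t)"
  proof (rule MVT2)
    show "(Y has_real_derivative - 2 * q t) (at t)" if "s / 2 \<le> t" for t
      by (rule Y') (use s that in simp)
  qed (use s in simp)
  then obtain t where t: "s / 2 < t" "t < s" and mvt: "Y s - Y (s / 2) = (s - s / 2) * (- 2 * q t)"
    by blast
  have t0: "0 < t" using s t by simp
  have "s * q t \<le> Y (s / 2)" using mvt Y0[of s] by (simp add: field_simps)
  then have qt: "q t \<le> Y (s / 2) / s" using s by (simp add: field_simps)
  have Yt: "Y t \<le> Y (s / 2)"
  proof (rule DERIV_nonpos_imp_nonincreasing[where f = Y])
    show "\<exists>y. (Y has_real_derivative y) (at r) \<and> y \<le> 0" if "s / 2 \<le> r" for r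
      using Y'[of r] q0[of r] that s by (intro exI[of _ "- 2 * q r"]) auto
  qed (use t in simp)
  define D where "D = m * sqrt (2 / sqrt s * (1 + 1 / s))"
  have D: "0 \<le> D" using m s by (simp add: D_def)
  have DS: "Y t + q t \<le> D\<^sup>2"
  proof -
    have "Y t + q t \<le> Y (s / 2) * (1 + 1 / s)" using Yt qt by (simp add: algebra_simps)
    also have "\<dots> \<le> 2 * m\<^sup>2 / sqrt s * (1 + 1 / s)" using Yhalf s by (intro mult_right_mono) auto
    also have "\<dots> = D\<^sup>2" using s by (simp add: D_def power_mult_distrib)
    finally show ?thesis .
  qed
  \<comment> \<open>The Sobolev inequality with \<open>a = 1\<close>, whose right side
    \<open>Y t + q t\<close> is at most \<open>D^2\<close>.\<close>
  have wU: "AE x in M. w x * U t x \<le> D"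
    using supU[OF t0 zero_less_one]
  proof eventually_elim
    case (elim x)
    then have "(w x * U t x)\<^sup>2 \<le> D\<^sup>2" using DS by simp
    then show ?case using D by (rule power2_le_imp_le)
  qed
  \<comment> \<open>\<open>E\<close> measures how far \<open>w U\<close> exceeds \<open>D\<close>.
    It vanishes at time \<open>t\<close>, cannot increase, and is nonnegative, so it still vanishes
    at \<open>s\<close>.\<close>
  define E where "E r = (\<integral>x. excess_primitive D (w x * U r x) / w x \<partial>M)" for r
  have z: "excess_primitive D 0 = 0" "excess D 0 = 0"
    using D by (auto intro!: excess_primitive_eq_0 excess_eq_0)
  have E': "(E has_real_derivative (\<integral>x. excess D (w x * U r x) * Z r x \<partial>M)) (at r)" if "0 < r" for r
    unfolding E_def[abs_def]
    by (rule DERIV_weighted_entropy[OF w DERIV_excess_primitive excess_Lipschitz z UL' UL ZL lim]) (fact that)+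
  have "E s \<le> E t"
  proof (rule DERIV_nonpos_imp_nonincreasing[where f = E])
    show "\<exists>y. (E has_real_derivative y) (at r) \<and> y \<le> 0" if "t \<le> r" for r
      using E'[of r] excU[of r D] D that t0 by (intro exI[of _ "\<integral>x. excess D (w x * U r x) * Z r x \<partial>M"]) auto
  qed (use t in simp)
  also have "E t = 0"
    unfolding E_def by (rule integral_eq_zero_AE) (use wU in \<open>auto simp: excess_primitive_eq_0\<close>)
  finally have Es: "E s \<le> 0" .
  have nn: "0 \<le> excess_primitive D (w x * U s x) / w x" for x
    using w(2)[of x] excess_primitive_nonneg by simp
  have "AE x in M. excess_primitive D (w x * U s x) / w x = 0"
  proof (subst integral_nonneg_eq_0_iff_AE[symmetric])
    show "integrable M (\<lambda>x. excess_primitive D (w x * U s x) / w x)"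
      by (rule integrable_weighted_entropy[OF w DERIV_excess_primitive excess_Lipschitz z UL[OF s]])
    show "(\<integral>x. excess_primitive D (w x * U s x) / w x \<partial>M) = 0"
      using Es nn unfolding E_def by (intro antisym integral_nonneg_AE) auto
  qed (use nn in auto)
  then have "AE x in M. w x * U s x \<le> D"
  proof eventually_elim
    case (elim x)
    then have "excess_primitive D (w x * U s x) = 0" using w(2)[of x] by simp
    then show ?case using excess_primitive_pos[of D "w x * U s x"] by fastforce
  qed
  then show ?thesis
  proof eventually_elim
    case (elim x)
    have "w x * P s f x = exp (C * s) * (w x * U s x)"
      by (simp add: U_def exp_minus)
    also have "\<dots> \<le> exp (C * s) * D" using elim by simp
    finally show ?case by (simp add: D_def)
  qed
qed

end

subsection \<open>The diffusion operator on test functions\<close>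

lemma Ck_DERIV:
  assumes "Ck k f" "j < k"
  shows "((deriv ^^ j) f has_real_derivative (deriv ^^ Suc j) f x) (at x)"
  using assms by (auto simp: Ck_def DERIV_deriv_iff_real_differentiable)

lemma Ck_continuous:
  assumes "Ck k f" "j \<le> k"
  shows "continuous_on A ((deriv ^^ j) f)"
proof (cases "j = k")
  case True
  then show ?thesis using assms by (auto simp: Ck_def intro: continuous_on_subset)
next
  case False
  then show ?thesis using Ck_DERIV[OF assms(1), of j] assms(2)
    by (intro continuous_at_imp_continuous_on) (auto intro: DERIV_isCont)
qed

lemma test_function_Ck: "u \<in> test_functions \<Longrightarrow> Ck k u"
  by (simp add: test_functions_def)

lemma test_function_derivs:
  assumes "u \<in> test_functions"
  shows "(u has_real_derivative deriv u x) (at x)"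
    and "(deriv u has_real_derivative (deriv ^^ 2) u x) (at x)"
    and "continuous_on A u" "continuous_on A (deriv u)" "continuous_on A ((deriv ^^ 2) u)"
  using Ck_DERIV[OF test_function_Ck[OF assms, of 2], of 0 x] Ck_DERIV[OF test_function_Ck[OF assms, of 2], of 1 x]
    Ck_continuous[OF test_function_Ck[OF assms, of 2], of 0 A] Ck_continuous[OF test_function_Ck[OF assms, of 2], of 1 A]
    Ck_continuous[OF test_function_Ck[OF assms, of 2], of 2 A]
  by (simp_all add: numeral_2_eq_2)

lemma DERIV_locally_zero:
  fixes f :: "real \<Rightarrow> real"
  assumes "\<And>x. B < \<bar>x\<bar> \<Longrightarrow> f x = 0" "B < \<bar>x\<bar>"
  shows "deriv f x = 0"
proof (rule DERIV_imp_deriv)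
  have "open {x :: real. B < \<bar>x\<bar>}" by (intro open_Collect_less continuous_intros)
  moreover have "((\<lambda>_. 0) has_real_derivative 0) (at x)" by simp
  ultimately show "(f has_real_derivative 0) (at x)"
    using assms has_field_derivative_transform_within_open[of "\<lambda>_. 0" 0 x "{x. B < \<bar>x\<bar>}" f] by simp
qed

lemma test_function_support:
  assumes "u \<in> test_functions"
  obtains R where "0 < R" "\<And>x. R \<le> \<bar>x\<bar> \<Longrightarrow> u x = 0" "\<And>x. R \<le> \<bar>x\<bar> \<Longrightarrow> deriv u x = 0"
    "\<And>x. R \<le> \<bar>x\<bar> \<Longrightarrow> (deriv ^^ 2) u x = 0"
proof -
  have "bounded {x. u x \<noteq> 0}"
    using assms compact_imp_bounded bounded_subset closure_subset by (auto simp: test_functions_def)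
  then obtain B where B: "0 < B" "\<And>x. u x \<noteq> 0 \<Longrightarrow> \<bar>x\<bar> \<le> B"
    unfolding bounded_pos by auto
  have 0: "u x = 0" if "B < \<bar>x\<bar>" for x using B(2)[of x] that by auto
  have 1: "deriv u x = 0" if "B < \<bar>x\<bar>" for x using DERIV_locally_zero[OF 0 that] .
  have 2: "(deriv ^^ 2) u x = 0" if "B < \<bar>x\<bar>" for x
    using DERIV_locally_zero[OF 1 that] by (simp add: numeral_2_eq_2)
  show thesis by (rule that[of "B + 1"]) (use B(1) 0 1 2 in auto)
qed

lemma integrable_continuous_support:
  fixes f :: "real \<Rightarrow> real"
  assumes "continuous_on UNIV f" "\<And>x. R \<le> \<bar>x\<bar> \<Longrightarrow> f x = 0"
  shows "integrable lborel f"
proof -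
  have "integrable lborel (\<lambda>x. indicator {-R..R} x *\<^sub>R f x)"
    using assms(1) by (intro borel_integrable_compact) (auto intro: continuous_on_subset)
  moreover have "indicator {-R..R} x *\<^sub>R f x = f x" for x
    using assms(2)[of x] by (cases "R \<le> \<bar>x\<bar>") (auto simp: indicator_def)
  ultimately show ?thesis by (simp only:)
qed

lemma bounded_continuous_support:
  fixes f :: "real \<Rightarrow> real"
  assumes "continuous_on UNIV f" "\<And>x. R \<le> \<bar>x\<bar> \<Longrightarrow> f x = 0"
  obtains B where "\<And>x. \<bar>f x\<bar> \<le> B"
proof -
  have "compact (f ` {-R..R})"
    using assms(1) by (intro compact_continuous_image) (auto intro: continuous_on_subset)
  from compact_imp_bounded[OF this] obtain B where B: "0 < B" "\<forall>y\<in>f ` {-R..R}. norm y \<le> B"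
    unfolding bounded_pos by blast
  have "\<bar>f x\<bar> \<le> B" for x
  proof (cases "R \<le> \<bar>x\<bar>")
    case False
    then have "x \<in> {-R..R}" by auto
    with B(2) show ?thesis by simp
  qed (use B(1) assms(2) in simp)
  then show thesis by (rule that)
qed

lemma integral_DERIV_support:
  fixes F f :: "real \<Rightarrow> real"
  assumes F: "\<And>x. (F has_real_derivative f x) (at x)" and f: "continuous_on UNIV f"
    and 0: "\<And>x. R \<le> \<bar>x\<bar> \<Longrightarrow> F x = 0" "\<And>x. R \<le> \<bar>x\<bar> \<Longrightarrow> f x = 0" and R: "0 < R"
  shows "(\<integral>x. f x \<partial>lborel) = 0"
proof -
  have "(\<integral>x. f x * indicator {-R..R} x \<partial>lborel) = F R - F (-R)"
    using R F f by (intro integral_FTC_Icc_real) (auto simp: continuous_on_eq_continuous_at)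
  moreover have "f x * indicator {-R..R} x = f x" for x
    using 0(2)[of x] by (cases "R \<le> \<bar>x\<bar>") (auto simp: indicator_def)
  ultimately show ?thesis using 0(1)[of R] 0(1)[of "-R"] R by simp
qed

locale convex_potential =
  fixes h :: "real \<Rightarrow> real" and c C :: real
  assumes smooth: "h \<in> class_D 4" and even: "\<And>x. h (- x) = h x"
    and bounds: "\<And>x. c \<le> (deriv ^^ 2) h x" "\<And>x. (deriv ^^ 2) h x \<le> C" and c: "0 < c"
    and prob: "prob_space (mu h)"
begin

sublocale prob_space "mu h" by (rule prob)

lemma C_pos: "0 < C"
  using bounds[of 0] c by linarith

lemma h_Ck: "Ck 4 h"
  using smooth by (simp add: class_D_def)

lemma DERIV_h: "(h has_real_derivative deriv h x) (at x)"
  using Ck_DERIV[OF h_Ck, of 0 x] by simp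

lemma DERIV_h': "(deriv h has_real_derivative (deriv ^^ 2) h x) (at x)"
  using Ck_DERIV[OF h_Ck, of 1 x] by (simp add: numeral_2_eq_2)

lemma continuous_h: "continuous_on A h" "continuous_on A (deriv h)" "continuous_on A ((deriv ^^ 2) h)"
  using Ck_continuous[OF h_Ck, of 0 A] Ck_continuous[OF h_Ck, of 1 A] Ck_continuous[OF h_Ck, of 2 A]
  by (simp_all add: numeral_2_eq_2)

section \<open>Quadratic comparison for the even potential\<close>

lemma deriv_h_0: "deriv h 0 = 0"
proof -
  have "((\<lambda>x. h (- x)) has_real_derivative - deriv h 0) (at 0)"
    by (rule DERIV_cong[OF DERIV_chain2[where g = uminus]])
      (use DERIV_h[of 0] in \<open>auto intro!: derivative_eq_intros\<close>)
  then have "(h has_real_derivative - deriv h 0) (at 0)" by (simp add: even)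
  with DERIV_h[of 0] have "deriv h 0 = - deriv h 0" by (rule DERIV_unique)
  then show ?thesis by simp
qed

lemma deriv_h_ge:
  assumes "0 \<le> x" shows "c * x \<le> deriv h x"
proof -
  have "deriv h 0 - c * 0 \<le> deriv h x - c * x"
  proof (rule DERIV_nonneg_imp_nondecreasing[OF assms, where f = "\<lambda>x. deriv h x - c * x"])
    show "\<exists>y. ((\<lambda>x. deriv h x - c * x) has_real_derivative y) (at t) \<and> 0 \<le> y" for t
      using bounds(1)[of t]
      by (intro exI[of _ "(deriv ^^ 2) h t - c"]) (auto intro!: derivative_eq_intros DERIV_h')
  qed
  then show ?thesis by (simp add: deriv_h_0)
qed

lemma deriv_h_le:
  assumes "0 \<le> x" shows "deriv h x \<le> C * x"
proof -
  have "C * 0 - deriv h 0 \<le> C * x - deriv h x"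
  proof (rule DERIV_nonneg_imp_nondecreasing[OF assms, where f = "\<lambda>x. C * x - deriv h x"])
    show "\<exists>y. ((\<lambda>x. C * x - deriv h x) has_real_derivative y) (at t) \<and> 0 \<le> y" for t
      using bounds(2)[of t]
      by (intro exI[of _ "C - (deriv ^^ 2) h t"]) (auto intro!: derivative_eq_intros DERIV_h')
  qed
  then show ?thesis by (simp add: deriv_h_0)
qed

lemma h_ge: "h 0 + c * x\<^sup>2 / 2 \<le> h x"
proof -
  have *: "h 0 + c * x\<^sup>2 / 2 \<le> h x" if "0 \<le> x" for x
  proof -
    have "h 0 - c * 0\<^sup>2 / 2 \<le> h x - c * x\<^sup>2 / 2"
    proof (rule DERIV_nonneg_imp_nondecreasing[OF that, where f = "\<lambda>x. h x - c * x\<^sup>2 / 2"])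
      show "\<exists>y. ((\<lambda>x. h x - c * x\<^sup>2 / 2) has_real_derivative y) (at t) \<and> 0 \<le> y" if "0 \<le> t" for t
        using deriv_h_ge[OF that]
        by (intro exI[of _ "deriv h t - c * t"]) (auto intro!: derivative_eq_intros DERIV_h)
    qed
    then show ?thesis by simp
  qed
  show ?thesis using *[of x] *[of "- x"] even[of x] by (cases "0 \<le> x") auto
qed

lemma h_le: "h x \<le> h 0 + C * x\<^sup>2 / 2"
proof -
  have *: "h x \<le> h 0 + C * x\<^sup>2 / 2" if "0 \<le> x" for x
  proof -
    have "C * 0\<^sup>2 / 2 - h 0 \<le> C * x\<^sup>2 / 2 - h x"
    proof (rule DERIV_nonneg_imp_nondecreasing[OF that, where f = "\<lambda>x. C * x\<^sup>2 / 2 - h x"])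
      show "\<exists>y. ((\<lambda>x. C * x\<^sup>2 / 2 - h x) has_real_derivative y) (at t) \<and> 0 \<le> y" if "0 \<le> t" for t
        using deriv_h_le[OF that]
        by (intro exI[of _ "C * t - deriv h t"]) (auto intro!: derivative_eq_intros DERIV_h)
    qed
    then show ?thesis by simp
  qed
  show ?thesis using *[of x] *[of "- x"] even[of x] by (cases "0 \<le> x") auto
qed

section \<open>The density and the operator on test functions\<close>

definition weight :: "real \<Rightarrow> real" where
  "weight x = exp (- h x)"

lemma weight_pos: "0 < weight x"
  by (simp add: weight_def)

lemma weight_le: "weight x \<le> exp (- h 0)"
proof -
  have "0 \<le> c * x\<^sup>2 / 2" using c by simp
  then show ?thesis using h_ge[of x] by (simp add: weight_def)
qed

lemma weight_continuous: "continuous_on A weight"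
  unfolding weight_def[abs_def] by (intro continuous_intros continuous_h)

lemma weight_measurable: "weight \<in> borel_measurable borel"
  by (rule borel_measurable_continuous_onI[OF weight_continuous])

lemma DERIV_weight: "(weight has_real_derivative - deriv h x * weight x) (at x)"
  unfolding weight_def[abs_def] by (auto intro!: derivative_eq_intros DERIV_h)

lemma sets_mu [measurable_cong, simp]: "sets (mu h) = sets borel"
  by (simp add: mu_def)

lemma space_mu [simp]: "space (mu h) = UNIV"
  by (simp add: mu_def)

lemma integral_mu:
  assumes "f \<in> borel_measurable borel"
  shows "(\<integral>x. f x \<partial>mu h) = (\<integral>x. weight x * f x \<partial>lborel)"
  unfolding mu_def using integral_density[of f lborel weight] assms weight_measurable weight_pos
  by (auto simp: weight_def[abs_def])

lemma DERIV_density: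
  assumes "u \<in> test_functions"
  shows "((\<lambda>x. weight x * u x) has_real_derivative weight x * (deriv u x - deriv h x * u x)) (at x)"
  by (auto intro!: derivative_eq_intros DERIV_weight test_function_derivs(1)[OF assms] simp: algebra_simps)

lemma continuous_density:
  assumes "u \<in> test_functions"
  shows "continuous_on A (\<lambda>x. weight x * u x)"
    "continuous_on A (\<lambda>x. weight x * (deriv u x - deriv h x * u x))"
    "continuous_on A (L_op h u)"
  unfolding L_op_def
  by (intro continuous_intros weight_continuous continuous_h test_function_derivs[OF assms])+

lemma L_op_support:
  assumes "u \<in> test_functions"
  obtains R where "0 < R" "\<And>x. R \<le> \<bar>x\<bar> \<Longrightarrow> u x = 0" "\<And>x. R \<le> \<bar>x\<bar> \<Longrightarrow> deriv u x = 0"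
    "\<And>x. R \<le> \<bar>x\<bar> \<Longrightarrow> L_op h u x = 0"
  using test_function_support[OF assms] unfolding L_op_def
  by (metis mult_zero_right diff_self)

lemma test_function_L2:
  assumes "u \<in> test_functions"
  shows "u \<in> L2_space (mu h)" "L_op h u \<in> L2_space (mu h)"
proof -
  from L_op_support[OF assms] obtain R where R: "0 < R" "\<And>x. R \<le> \<bar>x\<bar> \<Longrightarrow> u x = 0"
    "\<And>x. R \<le> \<bar>x\<bar> \<Longrightarrow> deriv u x = 0" "\<And>x. R \<le> \<bar>x\<bar> \<Longrightarrow> L_op h u x = 0" by metis
  have cu: "continuous_on UNIV u" by (rule test_function_derivs(3)[OF assms])
  note cL = continuous_density(3)[OF assms, of UNIV]
  obtain B where "\<And>x. \<bar>u x\<bar> \<le> B" using bounded_continuous_support[OF cu R(2)] by blast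
  then show "u \<in> L2_space (mu h)"
    using borel_measurable_continuous_onI[OF cu] by (intro L2_bounded[of u B]) (auto cong: measurable_cong_sets)
  obtain B where "\<And>x. \<bar>L_op h u x\<bar> \<le> B" using bounded_continuous_support[OF cL R(4)] by blast
  then show "L_op h u \<in> L2_space (mu h)"
    using borel_measurable_continuous_onI[OF cL] by (intro L2_bounded[of _ B]) (auto cong: measurable_cong_sets)
qed

text \<open>With \<open>\<rho> = weight * u\<close> one has \<open>weight * L_op h u = (\<rho>' + h' \<rho>)'\<close>, and the integrand below is the derivative
  of \<open>\<phi> \<rho> * (\<rho>' + h' \<rho>) - h' (\<rho> * \<phi> \<rho> - G \<rho>)\<close>.\<close>

lemma entropy_production:
  fixes G \<phi> \<phi>' :: "real \<Rightarrow> real"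
  assumes u: "u \<in> test_functions"
    and G: "\<And>r. (G has_real_derivative \<phi> r) (at r)" and \<phi>: "\<And>r. (\<phi> has_real_derivative \<phi>' r) (at r)"
    and \<phi>': "continuous_on UNIV \<phi>'" and z: "G 0 = 0" "\<phi> 0 = 0"
  defines "\<rho> \<equiv> \<lambda>x. weight x * u x" and "\<rho>' \<equiv> \<lambda>x. weight x * (deriv u x - deriv h x * u x)"
  shows "(\<integral>x. \<phi>' (\<rho> x) * (\<rho>' x)\<^sup>2 + \<phi> (\<rho> x) * (weight x * L_op h u x)
    - (deriv ^^ 2) h x * (\<rho> x * \<phi> (\<rho> x) - G (\<rho> x)) \<partial>lborel) = 0"
proof -
  from L_op_support[OF u] obtain R where R: "0 < R" "\<And>x. R \<le> \<bar>x\<bar> \<Longrightarrow> u x = 0"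
    "\<And>x. R \<le> \<bar>x\<bar> \<Longrightarrow> deriv u x = 0" "\<And>x. R \<le> \<bar>x\<bar> \<Longrightarrow> L_op h u x = 0" by metis
  have \<rho>: "(\<rho> has_real_derivative \<rho>' x) (at x)" for x
    unfolding \<rho>_def \<rho>'_def by (rule DERIV_density[OF u])
  have cG: "continuous_on A G" and c\<phi>: "continuous_on A \<phi>" for A
    using G \<phi> by (blast intro: continuous_at_imp_continuous_on DERIV_isCont)+
  have comp: "continuous_on UNIV (\<lambda>x. F (\<rho> x))" if "continuous_on UNIV F" for F :: "real \<Rightarrow> real"
    using continuous_on_compose2[OF that continuous_density(1)[OF u]] by (auto simp: \<rho>_def)
  \<comment> \<open>The primitive is written with
    \<open>\<rho>' + h' \<rho> = weight * deriv u\<close>; it has compact support because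
    \<open>\<phi>\<close> and \<open>G\<close> vanish at 0.\<close>
  show ?thesis
  proof (rule integral_DERIV_support[where R = R and
        F = "\<lambda>x. \<phi> (\<rho> x) * (weight x * deriv u x) - deriv h x * (\<rho> x * \<phi> (\<rho> x) - G (\<rho> x))"])
    show "((\<lambda>x. \<phi> (\<rho> x) * (weight x * deriv u x) - deriv h x * (\<rho> x * \<phi> (\<rho> x) - G (\<rho> x))) has_real_derivative
      \<phi>' (\<rho> x) * (\<rho>' x)\<^sup>2 + \<phi> (\<rho> x) * (weight x * L_op h u x)
      - (deriv ^^ 2) h x * (\<rho> x * \<phi> (\<rho> x) - G (\<rho> x))) (at x)" for x
      by (auto intro!: derivative_eq_intros DERIV_weight DERIV_h' \<rho> DERIV_chain2[OF G \<rho>] DERIV_chain2[OF \<phi> \<rho>]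
          test_function_derivs(2)[OF u])
        (simp add: \<rho>_def \<rho>'_def L_op_def power2_eq_square algebra_simps)
    show "continuous_on UNIV (\<lambda>x. \<phi>' (\<rho> x) * (\<rho>' x)\<^sup>2 + \<phi> (\<rho> x) * (weight x * L_op h u x)
      - (deriv ^^ 2) h x * (\<rho> x * \<phi> (\<rho> x) - G (\<rho> x)))"
      using continuous_density[OF u, of UNIV] test_function_derivs(3,4)[OF u, of UNIV] comp[OF \<phi>'] comp[OF cG] comp[OF c\<phi>]
      unfolding \<rho>_def \<rho>'_def by (intro continuous_intros weight_continuous continuous_h)
  qed (use R z in \<open>auto simp: \<rho>_def \<rho>'_def\<close>)
qed

text \<open>In the identity of \<open>entropy_production\<close> all discarded terms have a sign:
  the squared gradient has the factor \<open>excess_deriv \<ge> 0\<close>;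
  \<open>\<rho> * excess D \<rho>\<close> is nonnegative because \<open>D \<ge> 0\<close>, so
  \<open>h'' \<le> C\<close> applies to it; and \<open>h'' * excess_primitive\<close> is nonnegative
  by convexity of \<open>h\<close>.\<close>

lemma test_function_excess:
  assumes u: "u \<in> test_functions" and D: "0 \<le> D"
  shows "(\<integral>x. excess D (weight x * u x) * (L_op h u x - C * u x) \<partial>mu h) \<le> 0"
proof -
  define \<rho> where "\<rho> = (\<lambda>x. weight x * u x)"
  define \<rho>' where "\<rho>' = (\<lambda>x. weight x * (deriv u x - deriv h x * u x))"
  let ?I = "\<lambda>x. excess_deriv D (\<rho> x) * (\<rho>' x)\<^sup>2 + excess D (\<rho> x) * (weight x * L_op h u x)
    - (deriv ^^ 2) h x * (\<rho> x * excess D (\<rho> x) - excess_primitive D (\<rho> x))"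
  let ?J = "\<lambda>x. excess D (\<rho> x) * (L_op h u x - C * u x)"
  from L_op_support[OF u] obtain R where R: "0 < R" "\<And>x. R \<le> \<bar>x\<bar> \<Longrightarrow> u x = 0"
    "\<And>x. R \<le> \<bar>x\<bar> \<Longrightarrow> deriv u x = 0" "\<And>x. R \<le> \<bar>x\<bar> \<Longrightarrow> L_op h u x = 0" by metis
  have cG: "continuous_on A (excess_primitive D)" and c\<phi>: "continuous_on A (excess D)" for A
    using DERIV_excess_primitive DERIV_excess by (blast intro: continuous_at_imp_continuous_on DERIV_isCont)+
  have comp: "continuous_on UNIV (\<lambda>x. F (\<rho> x))" if "continuous_on UNIV F" for F :: "real \<Rightarrow> real"
    using continuous_on_compose2[OF that continuous_density(1)[OF u]] by (auto simp: \<rho>_def)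
  have cJ: "continuous_on UNIV ?J"
    using continuous_density(3)[OF u, of UNIV] comp[OF c\<phi>] test_function_derivs(3)[OF u, of UNIV]
    by (intro continuous_intros)
  have iI: "integrable lborel ?I"
  proof (rule integrable_continuous_support[where R = R])
    show "continuous_on UNIV ?I"
      using continuous_density[OF u, of UNIV] test_function_derivs(3,4)[OF u, of UNIV] comp[OF continuous_excess_deriv] comp[OF cG] comp[OF c\<phi>]
      unfolding \<rho>_def \<rho>'_def by (intro continuous_intros weight_continuous continuous_h)
  qed (use R D in \<open>auto simp: \<rho>_def \<rho>'_def excess_eq_0 excess_primitive_eq_0\<close>)
  have iJ: "integrable lborel (\<lambda>x. weight x * ?J x)"
    by (rule integrable_continuous_support[where R = R])
      (use R cJ in \<open>auto intro!: continuous_intros weight_continuous\<close>)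
  have "(\<integral>x. ?J x \<partial>mu h) = (\<integral>x. weight x * ?J x \<partial>lborel)"
    by (rule integral_mu[OF borel_measurable_continuous_onI[OF cJ]])
  also have "\<dots> \<le> (\<integral>x. ?I x \<partial>lborel)"
  proof (rule integral_mono[OF iJ iI])
    fix x
    have "0 \<le> \<rho> x * excess D (\<rho> x)"
      using D excess_eq_0[of "\<rho> x" D] excess_nonneg[of D "\<rho> x"] by (cases "\<rho> x \<le> D") auto
    then have "(deriv ^^ 2) h x * (\<rho> x * excess D (\<rho> x)) \<le> C * (\<rho> x * excess D (\<rho> x))"
      using bounds(2) by (intro mult_right_mono)
    moreover have "0 \<le> (deriv ^^ 2) h x * excess_primitive D (\<rho> x)"
      using bounds(1)[of x] c excess_primitive_nonneg by (intro mult_nonneg_nonneg) auto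
    moreover have "0 \<le> excess_deriv D (\<rho> x) * (\<rho>' x)\<^sup>2"
      using excess_deriv_bounds by simp
    ultimately show "weight x * ?J x \<le> ?I x"
      by (simp add: \<rho>_def algebra_simps)
  qed
  also have "\<dots> = 0"
    unfolding \<rho>_def \<rho>'_def using D
    by (intro entropy_production u DERIV_excess_primitive DERIV_excess continuous_excess_deriv
        excess_primitive_eq_0 excess_eq_0)
  finally show ?thesis by (simp add: \<rho>_def)
qed

text \<open>By \<open>entropy_production\<close> with \<open>G r = r^2 / 2\<close>, the right side
  is the integral of \<open>a \<rho>^2 + \<rho>'^2 / a + (C - h'' / 2) \<rho>^2 / a\<close>. This
  integrand is nonnegative and, by Young's inequality, dominates
  \<open>2 \<rho> \<rho>' = (\<rho>^2)'\<close>, which is integrated from the left of the support up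
  to \<open>x0\<close>.\<close>

lemma test_function_sup:
  assumes u: "u \<in> test_functions" and a: "0 < a"
  shows "(weight x0 * u x0)\<^sup>2 \<le> a * (\<integral>x. weight x * (u x)\<^sup>2 \<partial>mu h)
    - (\<integral>x. weight x * u x * (L_op h u x - C * u x) \<partial>mu h) / a"
proof -
  define \<rho> where "\<rho> = (\<lambda>x. weight x * u x)"
  define \<rho>' where "\<rho>' = (\<lambda>x. weight x * (deriv u x - deriv h x * u x))"
  \<comment> \<open>The factor 1 is the derivative of the identity \<open>\<phi>\<close>, kept so
    that the term matches \<open>entropy_production\<close> literally.\<close>
  let ?I = "\<lambda>x. 1 * (\<rho>' x)\<^sup>2 + \<rho> x * (weight x * L_op h u x)
    - (deriv ^^ 2) h x * (\<rho> x * \<rho> x - (\<rho> x)\<^sup>2 / 2)"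
  let ?J = "\<lambda>x. weight x * u x * (L_op h u x - C * u x)"
  from L_op_support[OF u] obtain R where R: "0 < R" "\<And>x. R \<le> \<bar>x\<bar> \<Longrightarrow> u x = 0"
    "\<And>x. R \<le> \<bar>x\<bar> \<Longrightarrow> deriv u x = 0" "\<And>x. R \<le> \<bar>x\<bar> \<Longrightarrow> L_op h u x = 0" by metis
  have I0: "(\<integral>x. ?I x \<partial>lborel) = 0"
    unfolding \<rho>_def \<rho>'_def
    by (rule entropy_production[OF u, where G = "\<lambda>r. r\<^sup>2 / 2"]) (auto intro!: derivative_eq_intros)
  note cd = continuous_density[OF u, of UNIV] test_function_derivs(3,4)[OF u, of UNIV]
  have cI: "continuous_on UNIV ?I"
    using cd unfolding \<rho>_def \<rho>'_def by (intro continuous_intros weight_continuous continuous_h) auto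
  have cJ: "continuous_on UNIV ?J" using cd by (intro continuous_intros weight_continuous)
  have cN: "continuous_on UNIV (\<lambda>x. weight x * (u x)\<^sup>2)"
    using cd by (intro continuous_intros weight_continuous)
  have iI: "integrable lborel ?I"
    by (rule integrable_continuous_support[OF cI, where R = R]) (use R in \<open>auto simp: \<rho>_def \<rho>'_def\<close>)
  have iJ: "integrable lborel (\<lambda>x. weight x * ?J x)"
    by (rule integrable_continuous_support[where R = R])
      (use R cJ in \<open>auto intro!: continuous_intros weight_continuous\<close>)
  have iN: "integrable lborel (\<lambda>x. weight x * (weight x * (u x)\<^sup>2))"
    by (rule integrable_continuous_support[where R = R])
      (use R cN in \<open>auto intro!: continuous_intros weight_continuous\<close>)
  have key: "(\<integral>x. a * (weight x * (weight x * (u x)\<^sup>2)) + (?I x - weight x * ?J x) / a \<partial>lborel)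
    = a * (\<integral>x. weight x * (u x)\<^sup>2 \<partial>mu h) - (\<integral>x. ?J x \<partial>mu h) / a"
    using iI iJ iN I0
    by (simp add: integral_mu[OF borel_measurable_continuous_onI[OF cN]]
        integral_mu[OF borel_measurable_continuous_onI[OF cJ]] del: mult_1)
  let ?S = "\<lambda>x. a * (weight x * (weight x * (u x)\<^sup>2)) + (?I x - weight x * ?J x) / a"
  have ge: "2 * \<rho> x * \<rho>' x \<le> ?S x"
    and nn: "0 \<le> ?S x" for x
  proof -
    have S: "?S x = a * (\<rho> x)\<^sup>2 + (\<rho>' x)\<^sup>2 / a + (C - (deriv ^^ 2) h x / 2) * (\<rho> x)\<^sup>2 / a"
      using a by (simp add: \<rho>_def field_simps power2_eq_square)
    have "0 \<le> (C - (deriv ^^ 2) h x / 2) * (\<rho> x)\<^sup>2 / a"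
      using a bounds[of x] c by (intro divide_nonneg_pos mult_nonneg_nonneg) auto
    moreover have "0 \<le> (a * \<rho> x - \<rho>' x)\<^sup>2 / a" using a by simp
    moreover have "(a * \<rho> x - \<rho>' x)\<^sup>2 / a = a * (\<rho> x)\<^sup>2 + (\<rho>' x)\<^sup>2 / a - 2 * \<rho> x * \<rho>' x"
      using a by (simp add: field_simps power2_eq_square)
    moreover have "0 \<le> a * (\<rho> x)\<^sup>2 + (\<rho>' x)\<^sup>2 / a" using a by simp
    ultimately show "2 * \<rho> x * \<rho>' x \<le> ?S x" "0 \<le> ?S x" unfolding S by linarith+
  qed
  have iS: "integrable lborel ?S" using iI iJ iN by simp
  have "(weight x0 * u x0)\<^sup>2 \<le> (\<integral>x. ?S x \<partial>lborel)"
  proof (cases "- R \<le> x0")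
    case False
    then have "u x0 = 0" using R by auto
    then show ?thesis using integral_nonneg_AE[where M = lborel and f = ?S] nn by simp
  next
    case True
    have "has_bochner_integral lborel (\<lambda>x. (2 * \<rho> x * \<rho>' x) * indicator {-R..x0} x) ((\<rho> x0)\<^sup>2 - (\<rho> (-R))\<^sup>2)"
    proof (rule has_bochner_integral_FTC_Icc_real[OF True])
      show "((\<lambda>x. (\<rho> x)\<^sup>2) has_real_derivative 2 * \<rho> x * \<rho>' x) (at x)" for x
        using DERIV_power[OF DERIV_density[OF u, of x], of 2] unfolding \<rho>_def \<rho>'_def by (simp add: mult_ac)
      have "continuous_on UNIV (\<lambda>x. 2 * \<rho> x * \<rho>' x)"
        using cd unfolding \<rho>_def \<rho>'_def
        by (intro continuous_intros weight_continuous continuous_h) auto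
      then show "isCont (\<lambda>x. 2 * \<rho> x * \<rho>' x) x" for x
        by (simp add: continuous_on_eq_continuous_at)
    qed
    moreover have "\<rho> (-R) = 0" using R by (simp add: \<rho>_def)
    ultimately have B: "has_bochner_integral lborel (\<lambda>x. (2 * \<rho> x * \<rho>' x) * indicator {-R..x0} x) ((\<rho> x0)\<^sup>2)"
      by simp
    then have "(\<rho> x0)\<^sup>2 = (\<integral>x. (2 * \<rho> x * \<rho>' x) * indicator {-R..x0} x \<partial>lborel)"
      by (simp add: has_bochner_integral_integral_eq)
    also have "\<dots> \<le> (\<integral>x. ?S x \<partial>lborel)"
      using B iS ge nn by (intro integral_mono) (auto simp: has_bochner_integral_iff indicator_def)
    finally show ?thesis by (simp add: \<rho>_def)
  qed
  then show ?thesis unfolding key .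
qed

section \<open>From test functions to the generator by closure\<close>

lemma semigroup_of_symmetric_markov:
  assumes "semigroup_of h P" shows "symmetric_markov_semigroup (mu h) P"
  using assms by unfold_locales (auto simp: semigroup_of_def)

text \<open>This is where \<open>semigroup_of\<close> enters: the generator is the closure of the
  operator on test functions, and convergence in the graph norm also gives convergence after
  subtracting \<open>C u\<close>.\<close>

lemma generator_approximation:
  assumes P: "semigroup_of h P" and uv: "(u, v) \<in> generator_graph (mu h) P"
  obtains f where "\<And>n::nat. f n \<in> test_functions"
    "(\<lambda>n. L2_nrm (mu h) (\<lambda>x. f n x - u x)) \<longlonglongrightarrow> 0"
    "(\<lambda>n. L2_nrm (mu h) (\<lambda>x. (L_op h (f n) x - C * f n x) - (v x - C * u x))) \<longlonglongrightarrow> 0"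
proof -
  have cl: "(u, v) \<in> closure_graph (mu h) {(f, L_op h f) | f. f \<in> test_functions}"
    using P uv by (simp add: semigroup_of_def)
  then have uL: "u \<in> L2_space (mu h)" and vL: "v \<in> L2_space (mu h)" by (auto simp: closure_graph_def)
  from cl obtain f w where *: "\<And>n::nat. (f n, w n) \<in> {(f, L_op h f) | f. f \<in> test_functions}"
    "(\<lambda>n. L2_nrm (mu h) (\<lambda>x. f n x - u x)) \<longlonglongrightarrow> 0" "(\<lambda>n. L2_nrm (mu h) (\<lambda>x. w n x - v x)) \<longlonglongrightarrow> 0"
    unfolding closure_graph_def mem_Collect_eq case_prod_conv by blast
  have f: "f n \<in> test_functions" and w: "w n = L_op h (f n)" for n using *(1)[of n] by auto
  note fL = test_function_L2[OF f]
  have "(\<lambda>n. L2_nrm (mu h) (\<lambda>x. (L_op h (f n) x - C * f n x) - (v x - C * u x))) \<longlonglongrightarrow> 0"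
  proof (rule tendsto_sandwich[OF _ _ tendsto_const])
    show "(\<lambda>n. L2_nrm (mu h) (\<lambda>x. L_op h (f n) x - v x)
        + \<bar>- C\<bar> * L2_nrm (mu h) (\<lambda>x. f n x - u x)) \<longlonglongrightarrow> 0"
      using *(2,3) unfolding w by (auto intro!: tendsto_eq_intros)
    have "L2_nrm (mu h) (\<lambda>x. (L_op h (f n) x - v x) + - C * (f n x - u x))
        \<le> L2_nrm (mu h) (\<lambda>x. L_op h (f n) x - v x) + L2_nrm (mu h) (\<lambda>x. - C * (f n x - u x))" for n
      by (intro L2_triangle L2_diff L2_cmult fL uL vL)
    moreover have "(L_op h (f n) x - C * f n x) - (v x - C * u x) = (L_op h (f n) x - v x) + - C * (f n x - u x)"
      for n x by (simp add: algebra_simps)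
    ultimately show "\<forall>\<^sub>F n in sequentially. L2_nrm (mu h) (\<lambda>x. (L_op h (f n) x - C * f n x) - (v x - C * u x))
        \<le> L2_nrm (mu h) (\<lambda>x. L_op h (f n) x - v x) + \<bar>- C\<bar> * L2_nrm (mu h) (\<lambda>x. f n x - u x)"
      by (simp only: L2_nrm_cmult eventually_sequentially) simp
  qed simp
  with f *(2) show thesis by (rule that)
qed

text \<open>\<open>weight\<close> is largest at the centre, with value \<open>exp (- h 0)\<close>,
  so multiplication by it followed by a 1-Lipschitz \<open>\<phi>\<close> is Lipschitz on
  L2.\<close>

lemma weighted_L2_tendsto:
  assumes f: "\<And>n. f n \<in> L2_space (mu h)" "u \<in> L2_space (mu h)"
    and lim: "(\<lambda>n::nat. L2_nrm (mu h) (\<lambda>x. f n x - u x)) \<longlonglongrightarrow> 0"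
    and \<phi>: "\<And>a b. \<bar>\<phi> a - \<phi> b\<bar> \<le> \<bar>a - b\<bar>" "\<phi> 0 = 0" "\<phi> \<in> borel_measurable borel"
  shows "(\<lambda>n. L2_nrm (mu h) (\<lambda>x. \<phi> (weight x * f n x) - \<phi> (weight x * u x))) \<longlonglongrightarrow> 0"
    and "u' \<in> L2_space (mu h) \<Longrightarrow> (\<lambda>x. \<phi> (weight x * u' x)) \<in> L2_space (mu h)"
proof -
  have w: "\<bar>weight x * a\<bar> \<le> exp (- h 0) * \<bar>a\<bar>" for x a
    using weight_pos[of x] weight_le[of x] by (simp add: abs_mult mult_right_mono)
  have wm: "weight \<in> borel_measurable (mu h)"
    using weight_measurable by (simp cong: measurable_cong_sets)
  have m: "(\<lambda>x. \<phi> (weight x * u' x)) \<in> borel_measurable (mu h)" if "u' \<in> L2_space (mu h)" for u'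
    using measurable_compose[OF borel_measurable_times[OF wm L2_measurable[OF that]] \<phi>(3)] .
  show "(\<lambda>x. \<phi> (weight x * u' x)) \<in> L2_space (mu h)" if u': "u' \<in> L2_space (mu h)"
  proof (rule L2_dominated[OF u' m[OF u']])
    show "AE x in mu h. \<bar>\<phi> (weight x * u' x)\<bar> \<le> exp (- h 0) * \<bar>u' x\<bar>"
      using \<phi>(1)[of _ 0] \<phi>(2) w by (intro AE_I2) (simp, meson order_trans)
  qed
  show "(\<lambda>n. L2_nrm (mu h) (\<lambda>x. \<phi> (weight x * f n x) - \<phi> (weight x * u x))) \<longlonglongrightarrow> 0"
  proof (rule L2_tendsto_Lipschitz[OF f m[OF f(1)] m[OF f(2)] _ lim])
    show "\<bar>\<phi> (weight x * f n x) - \<phi> (weight x * u x)\<bar> \<le> exp (- h 0) * \<bar>f n x - u x\<bar>" for n x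
      using \<phi>(1)[of "weight x * f n x" "weight x * u x"] w[of x "f n x - u x"]
      by (simp add: right_diff_distrib)
  qed
qed

lemma generator_sup:
  assumes P: "semigroup_of h P" and uv: "(u, v) \<in> generator_graph (mu h) P" and a: "0 < a"
  shows "AE x in mu h. (weight x * u x)\<^sup>2 \<le> a * (\<integral>x. weight x * (u x)\<^sup>2 \<partial>mu h)
    - (\<integral>x. weight x * u x * (v x - C * u x) \<partial>mu h) / a"
proof -
  obtain f where f: "\<And>n::nat. f n \<in> test_functions"
    "(\<lambda>n. L2_nrm (mu h) (\<lambda>x. f n x - u x)) \<longlonglongrightarrow> 0"
    "(\<lambda>n. L2_nrm (mu h) (\<lambda>x. (L_op h (f n) x - C * f n x) - (v x - C * u x))) \<longlonglongrightarrow> 0"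
    using generator_approximation[OF P uv] by blast
  interpret symmetric_markov_semigroup "mu h" P by (rule semigroup_of_symmetric_markov[OF P])
  note uL = generator_L2(1)[OF uv] and vL = generator_L2(2)[OF uv]
  note fL = test_function_L2[OF f(1)]
  have zL: "(\<lambda>x. v x - C * u x) \<in> L2_space (mu h)" "(\<lambda>x. L_op h (f n) x - C * f n x) \<in> L2_space (mu h)" for n
    by (intro L2_diff L2_cmult uL vL fL)+
  note wt = weighted_L2_tendsto[OF fL(1) uL f(2), of "\<lambda>r. r", simplified]
  have 1: "(\<lambda>n. \<integral>x. weight x * f n x * f n x \<partial>mu h) \<longlonglongrightarrow> (\<integral>x. weight x * u x * u x \<partial>mu h)"
    by (intro L2_tendsto_inner wt fL uL f(2))
  have 2: "(\<lambda>n. \<integral>x. weight x * f n x * (L_op h (f n) x - C * f n x) \<partial>mu h)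
      \<longlonglongrightarrow> (\<integral>x. weight x * u x * (v x - C * u x) \<partial>mu h)"
    by (intro L2_tendsto_inner wt fL uL f(3) zL)
  have lim: "(\<lambda>n. a * (\<integral>x. weight x * (f n x)\<^sup>2 \<partial>mu h)
      - (\<integral>x. weight x * f n x * (L_op h (f n) x - C * f n x) \<partial>mu h) / a)
      \<longlonglongrightarrow> a * (\<integral>x. weight x * (u x)\<^sup>2 \<partial>mu h) - (\<integral>x. weight x * u x * (v x - C * u x) \<partial>mu h) / a"
    using 1 2 a unfolding power2_eq_square mult.assoc by (intro tendsto_intros) auto
  \<comment> \<open>The integrals converge along the whole sequence, but the left side is pointwise
    and converges only along a subsequence, for almost every \<open>x\<close>.\<close>
  obtain r where r: "strict_mono r" "AE x in mu h. (\<lambda>n. f (r n) x) \<longlonglongrightarrow> u x"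
    using L2_tendsto_AE_subseq[OF fL(1) uL f(2)] by blast
  from r(2) show ?thesis
  proof eventually_elim
    case (elim x)
    show ?case
    proof (rule LIMSEQ_le[OF _ LIMSEQ_subseq_LIMSEQ[OF lim r(1)]])
      show "(\<lambda>n. (weight x * f (r n) x)\<^sup>2) \<longlonglongrightarrow> (weight x * u x)\<^sup>2"
        by (intro tendsto_intros elim)
      show "\<exists>N. \<forall>n\<ge>N. (weight x * f (r n) x)\<^sup>2 \<le> ((\<lambda>n. a * (\<integral>x. weight x * (f n x)\<^sup>2 \<partial>mu h)
      - (\<integral>x. weight x * f n x * (L_op h (f n) x - C * f n x) \<partial>mu h) / a) \<circ> r) n"
        using test_function_sup[OF f(1) a] by auto
    qed
  qed
qed

text \<open>The Lipschitz property of \<open>excess D\<close> gives L2 convergence of the first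
  factor, and the graph norm gives that of the second, so the pairing converges.\<close>

lemma generator_excess:
  assumes P: "semigroup_of h P" and uv: "(u, v) \<in> generator_graph (mu h) P" and D: "0 \<le> D"
  shows "(\<integral>x. excess D (weight x * u x) * (v x - C * u x) \<partial>mu h) \<le> 0"
proof -
  obtain f where f: "\<And>n::nat. f n \<in> test_functions"
    "(\<lambda>n. L2_nrm (mu h) (\<lambda>x. f n x - u x)) \<longlonglongrightarrow> 0"
    "(\<lambda>n. L2_nrm (mu h) (\<lambda>x. (L_op h (f n) x - C * f n x) - (v x - C * u x))) \<longlonglongrightarrow> 0"
    using generator_approximation[OF P uv] by blast
  interpret symmetric_markov_semigroup "mu h" P by (rule semigroup_of_symmetric_markov[OF P])
  note uL = generator_L2(1)[OF uv] and vL = generator_L2(2)[OF uv]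
  note fL = test_function_L2[OF f(1)]
  have zL: "(\<lambda>x. v x - C * u x) \<in> L2_space (mu h)" "(\<lambda>x. L_op h (f n) x - C * f n x) \<in> L2_space (mu h)" for n
    by (intro L2_diff L2_cmult uL vL fL)+
  have "continuous_on UNIV (excess D)"
    using DERIV_excess by (blast intro: continuous_at_imp_continuous_on DERIV_isCont)
  then have em: "excess D \<in> borel_measurable borel" by (rule borel_measurable_continuous_onI)
  note wt = weighted_L2_tendsto[OF fL(1) uL f(2) excess_Lipschitz excess_eq_0[OF D] em]
  have "(\<lambda>n. \<integral>x. excess D (weight x * f n x) * (L_op h (f n) x - C * f n x) \<partial>mu h)
      \<longlonglongrightarrow> (\<integral>x. excess D (weight x * u x) * (v x - C * u x) \<partial>mu h)"
    by (intro L2_tendsto_inner wt fL uL f(3) zL)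
  then show ?thesis
    by (rule LIMSEQ_le_const2) (use test_function_excess[OF f(1) D] in auto)
qed

lemma test_function_generator:
  assumes P: "semigroup_of h P" and f: "f \<in> test_functions"
  shows "(f, L_op h f) \<in> generator_graph (mu h) P"
proof -
  have "(f, L_op h f) \<in> closure_graph (mu h) {(f, L_op h f) | f. f \<in> test_functions}"
    unfolding closure_graph_def mem_Collect_eq case_prod_conv
    by (intro conjI exI[of _ "\<lambda>_::nat. f"] exI[of _ "\<lambda>_::nat. L_op h f"] test_function_L2 f)
      (use f in \<open>auto simp: L2_nrm_def\<close>)
  then show ?thesis using P by (simp add: semigroup_of_def)
qed

lemma test_function_smoothing:
  assumes P: "semigroup_of h P" and f: "f \<in> test_functions" and s: "0 < s"
    and m: "0 < m" "(\<integral>x. \<bar>f x\<bar> \<partial>mu h) \<le> m"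
  shows "AE x in mu h. P s f x \<le> exp (C * s) * sqrt (2 / sqrt s * (1 + 1 / s)) * m * exp (h x)"
proof -
  interpret symmetric_markov_semigroup "mu h" P by (rule semigroup_of_symmetric_markov[OF P])
  have "AE x in mu h. weight x * P s f x \<le> exp (C * s) * (m * sqrt (2 / sqrt s * (1 + 1 / s)))"
  proof (rule ultracontractive_bound[OF _ weight_pos weight_le _ generator_sup[OF P] generator_excess[OF P]
        test_function_generator[OF P f] s m])
    show "weight \<in> borel_measurable (mu h)" using weight_measurable by (simp cong: measurable_cong_sets)
    show "0 \<le> C" using C_pos by simp
  qed
  then show ?thesis
  proof eventually_elim
    case (elim x)
    have "P s f x = weight x * P s f x * exp (h x)"
      by (simp add: weight_def exp_minus)
    also have "\<dots> \<le> exp (C * s) * (m * sqrt (2 / sqrt s * (1 + 1 / s))) * exp (h x)"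
      using elim by (intro mult_right_mono) auto
    finally show ?case by (simp add: mult_ac)
  qed
qed

end

subsection \<open>Density of the test functions\<close>

text \<open>Smoothness of a whole family follows from one derivative computation, with no formula
  for the higher derivatives of an individual member.\<close>

lemma Ck_if_closed_under_derivative:
  assumes "\<And>f. f \<in> S \<Longrightarrow> \<exists>f'\<in>S. \<forall>x. (f has_real_derivative f' x) (at x)" and f: "f \<in> S"
  shows "Ck k f"
proof -
  have deriv: "deriv g \<in> S \<and> (\<forall>x. g differentiable (at x))" if g: "g \<in> S" for g
  proof -
    obtain g' where g': "g' \<in> S" "\<And>x. (g has_real_derivative g' x) (at x)" using assms(1)[OF g] by blast
    then have "deriv g = g'" by (intro ext DERIV_imp_deriv)
    with g' show ?thesis using real_differentiable_def by blast
  qed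
  have S: "(deriv ^^ j) f \<in> S" for j by (induction j) (use f deriv in auto)
  show ?thesis unfolding Ck_def using S deriv
    by (auto intro!: continuous_at_imp_continuous_on differentiable_imp_continuous_within)
qed

lemma Ck_lincomb:
  assumes f: "Ck k f" and g: "Ck k g"
  shows "Ck k (\<lambda>x. a * f x + b * g x)"
proof -
  have D: "((\<lambda>x. a * (deriv ^^ j) f x + b * (deriv ^^ j) g x) has_real_derivative
      a * (deriv ^^ Suc j) f x + b * (deriv ^^ Suc j) g x) (at x)" if "j < k" for j x
    by (intro DERIV_add DERIV_cmult Ck_DERIV[OF f that] Ck_DERIV[OF g that])
  have eq: "(deriv ^^ j) (\<lambda>x. a * f x + b * g x) = (\<lambda>x. a * (deriv ^^ j) f x + b * (deriv ^^ j) g x)"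
    if "j \<le> k" for j
    using that
  proof (induction j)
    case (Suc j)
    have "(deriv ^^ Suc j) (\<lambda>x. a * f x + b * g x) = deriv (\<lambda>x. a * (deriv ^^ j) f x + b * (deriv ^^ j) g x)"
      using Suc by simp
    also have "\<dots> = (\<lambda>x. a * (deriv ^^ Suc j) f x + b * (deriv ^^ Suc j) g x)"
      by (intro ext DERIV_imp_deriv D) (use Suc.prems in simp)
    finally show ?case .
  qed simp
  have "(deriv ^^ j) (\<lambda>x. a * f x + b * g x) differentiable (at x)" if "j < k" for j x
    using D[OF that, of x] eq[of j] that real_differentiable_def by auto
  moreover have "continuous_on UNIV ((deriv ^^ k) (\<lambda>x. a * f x + b * g x))"
    unfolding eq[OF order_refl] by (intro continuous_intros Ck_continuous[OF f order_refl] Ck_continuous[OF g order_refl])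
  ultimately show ?thesis by (simp add: Ck_def)
qed

lemma test_functions_lincomb:
  assumes "f \<in> test_functions" "g \<in> test_functions"
  shows "(\<lambda>x. a * f x + b * g x) \<in> test_functions"
proof -
  have "bounded {x. f x \<noteq> 0}" "bounded {x. g x \<noteq> 0}"
    using assms compact_imp_bounded bounded_subset closure_subset by (auto simp: test_functions_def)
  then have "bounded ({x. f x \<noteq> 0} \<union> {x. g x \<noteq> 0})" by (rule bounded_Un[THEN iffD2, OF conjI])
  then have "bounded {x. a * f x + b * g x \<noteq> 0}" by (rule bounded_subset) auto
  then show ?thesis using assms Ck_lincomb by (auto simp: test_functions_def)
qed

text \<open>A family containing the bump functions \<open>exp (- \<epsilon> / ((x - a) * (b - x)))\<close> that is closed under
  differentiation.\<close>

definition bump :: "real \<Rightarrow> real \<Rightarrow> real \<Rightarrow> real poly \<Rightarrow> nat \<Rightarrow> real \<Rightarrow> real" where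
  "bump \<epsilon> a b p k x = (if a < x \<and> x < b
     then poly p x / ((x - a) * (b - x)) ^ k * exp (- \<epsilon> / ((x - a) * (b - x))) else 0)"

text \<open>The \<open>N\<close>-th power of \<open>y \<le> exp y\<close> at
  \<open>y = \<epsilon> / (q * N)\<close>, inverted.\<close>

lemma exp_neg_divide_le_power:
  fixes q :: real
  assumes "0 < q" "0 < \<epsilon>" "0 < N"
  shows "exp (- \<epsilon> / q) \<le> (real N / \<epsilon>) ^ N * q ^ N"
proof -
  have "(\<epsilon> / (q * real N)) ^ N \<le> exp (\<epsilon> / (q * real N)) ^ N"
  proof (rule power_mono)
    show "\<epsilon> / (q * real N) \<le> exp (\<epsilon> / (q * real N))"
      using exp_ge_add_one_self[of "\<epsilon> / (q * real N)"] by linarith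
  qed (use assms in simp)
  also have "\<dots> = exp (\<epsilon> / q)" using assms by (simp flip: exp_of_nat_mult)
  finally have "inverse (exp (\<epsilon> / q)) \<le> inverse ((\<epsilon> / (q * real N)) ^ N)"
    using assms by (intro le_imp_inverse_le) auto
  then show ?thesis using assms
    by (simp add: exp_minus power_divide power_mult_distrib field_simps)
qed

lemma DERIV_zero_quadratic:
  fixes f :: "real \<Rightarrow> real"
  assumes "\<And>y. \<bar>f y - f x\<bar> \<le> K * (y - x)\<^sup>2"
  shows "(f has_real_derivative 0) (at x)"
  unfolding DERIV_def
proof (rule Lim_null_comparison)
  show "((\<lambda>d. K * \<bar>d\<bar>) \<longlongrightarrow> 0) (at 0)" by (auto intro!: tendsto_eq_intros)
  show "\<forall>\<^sub>F d in at 0. norm ((f (x + d) - f x) / d) \<le> K * \<bar>d\<bar>"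
    using eventually_neq_at_within[of 0]
  proof eventually_elim
    case (elim d)
    have "\<bar>f (x + d) - f x\<bar> \<le> K * \<bar>d\<bar> * \<bar>d\<bar>"
      using assms[of "x + d"] by (simp add: power2_eq_square mult.assoc)
    then show ?case using elim by (simp add: pos_divide_le_eq)
  qed
qed

text \<open>With \<open>q = (y - a) * (b - y)\<close>, the exponential beats any power of
  \<open>1 / q\<close>, and \<open>q \<le> (b - a) * \<bar>y - x\<bar>\<close> as soon as
  \<open>x\<close> lies outside the open interval. The endpoints are included, and they are the
  delicate points for differentiability.\<close>

lemma bump_quadratic_bound:
  assumes \<epsilon>: "0 < \<epsilon>" and ab: "a < b"
  obtains K where "\<And>x y. \<not> (a < x \<and> x < b) \<Longrightarrow> \<bar>bump \<epsilon> a b p k y\<bar> \<le> K * (y - x)\<^sup>2"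
proof -
  have "compact (poly p ` {a..b})" by (intro compact_continuous_image continuous_intros) auto
  from compact_imp_bounded[OF this] obtain B where B: "0 < B" "\<forall>y\<in>poly p ` {a..b}. norm y \<le> B"
    unfolding bounded_pos by blast
  define A where "A = (real (k + 2) / \<epsilon>) ^ (k + 2)"
  have A: "0 \<le> A" using \<epsilon> by (simp add: A_def)
  have "\<bar>bump \<epsilon> a b p k y\<bar> \<le> B * A * (b - a)\<^sup>2 * (y - x)\<^sup>2" if x: "\<not> (a < x \<and> x < b)" for x y
  proof (cases "a < y \<and> y < b")
    case False
    then have "bump \<epsilon> a b p k y = 0" by (auto simp: bump_def)
    then show ?thesis using A B by simp
  next
    case True
    define q where "q = (y - a) * (b - y)"
    have q: "0 < q" using True by (simp add: q_def)
    have "q \<le> (b - a) * \<bar>y - x\<bar>"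
    proof (cases "x \<le> a")
      case True
      have "q = (b - y) * (y - a)" by (simp add: q_def)
      also have "\<dots> \<le> (b - a) * \<bar>y - x\<bar>"
        using True \<open>a < y \<and> y < b\<close> by (intro mult_mono) auto
      finally show ?thesis .
    next
      case False
      then have "b \<le> x" using x by auto
      then show ?thesis unfolding q_def using \<open>a < y \<and> y < b\<close> by (intro mult_mono) auto
    qed
    then have "q\<^sup>2 \<le> ((b - a) * \<bar>y - x\<bar>)\<^sup>2" using q by (intro power_mono) auto
    then have q2: "q\<^sup>2 \<le> (b - a)\<^sup>2 * (y - x)\<^sup>2" by (simp add: power_mult_distrib)
    have "\<bar>bump \<epsilon> a b p k y\<bar> = \<bar>poly p y\<bar> / q ^ k * exp (- \<epsilon> / q)"
      using True q by (simp add: bump_def q_def abs_mult)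
    \<comment> \<open>Exponent \<open>k + 2\<close>: \<open>k\<close> powers cancel the denominator
      and two remain for the quadratic bound.\<close>
    also have "\<dots> \<le> B / q ^ k * (A * q ^ (k + 2))"
      unfolding A_def using True B q \<epsilon>
      by (intro mult_mono divide_right_mono exp_neg_divide_le_power) auto
    also have "\<dots> = B * A * q\<^sup>2" using q by (simp add: power_add power2_eq_square)
    also have "\<dots> \<le> B * A * ((b - a)\<^sup>2 * (y - x)\<^sup>2)" using q2 A B by (intro mult_left_mono) auto
    finally show ?thesis by (simp add: mult.assoc)
  qed
  then show thesis by (rule that)
qed

text \<open>Outside the open interval, endpoints included, the quadratic bound forces derivative 0.
  Inside, \<open>Q\<close> is \<open>(x - a) * (b - x)\<close> as a polynomial and \<open>Q'\<close>
  its derivative; the quotient rule is brought to the common denominator \<open>Q ^ (k + 2)\<close>,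
  so the result is again a member of the family.\<close>

lemma DERIV_bump:
  assumes \<epsilon>: "0 < \<epsilon>" and ab: "a < b"
  defines "Q \<equiv> [:- a * b, a + b, - 1:]" and "Q' \<equiv> [:a + b, - 2:]"
  shows "(bump \<epsilon> a b p k has_real_derivative
    bump \<epsilon> a b (pderiv p * Q\<^sup>2 - smult (of_nat k) (p * Q' * Q) + smult \<epsilon> (p * Q')) (k + 2) x) (at x)"
    (is "(_ has_real_derivative bump _ _ _ ?p _ _) _")
proof (cases "a < x \<and> x < b")
  case False
  obtain K where K: "\<And>x y. \<not> (a < x \<and> x < b) \<Longrightarrow> \<bar>bump \<epsilon> a b p k y\<bar> \<le> K * (y - x)\<^sup>2"
    using bump_quadratic_bound[OF \<epsilon> ab] by blast
  have "bump \<epsilon> a b p' k' x = 0" for p' k' using False by (auto simp: bump_def)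
  then show ?thesis using DERIV_zero_quadratic[of "bump \<epsilon> a b p k" x K] K[OF False] by simp
next
  case True
  define q where "q y = (y - a) * (b - y)" for y
  have q: "0 < q x" using True by (simp add: q_def)
  have Q: "poly Q x = q x" by (simp add: Q_def q_def algebra_simps)
  have Q': "poly Q' x = a + b - 2 * x" by (simp add: Q'_def)
  have dq: "(q has_real_derivative a + b - 2 * x) (at x)"
    unfolding q_def by (auto intro!: derivative_eq_intros)
  have d1: "((\<lambda>y. poly p y / q y ^ k) has_real_derivative
      poly (pderiv p) x / q x ^ k - real k * poly p x * (a + b - 2 * x) / q x ^ (k + 1)) (at x)"
  proof (cases k)
    case 0
    then show ?thesis using poly_DERIV[of p x] by simp
  next
    case (Suc n)
    show ?thesis unfolding Suc using q
      by (intro DERIV_cong[OF DERIV_divide[OF poly_DERIV DERIV_power[OF dq]]])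
        (simp_all add: field_simps)
  qed
  have d2: "((\<lambda>y. exp (- \<epsilon> / q y)) has_real_derivative exp (- \<epsilon> / q x) * (\<epsilon> * (a + b - 2 * x) / (q x)\<^sup>2)) (at x)"
    using q by (intro DERIV_fun_exp DERIV_cong[OF DERIV_divide[OF DERIV_const dq]])
      (simp_all add: field_simps power2_eq_square)
  have "((\<lambda>y. poly p y / q y ^ k * exp (- \<epsilon> / q y)) has_real_derivative bump \<epsilon> a b ?p (k + 2) x) (at x)"
  proof (rule DERIV_cong[OF DERIV_mult[OF d1 d2]])
    have alg: "(p1 / T - n * p0 * s / (T * r)) * e + e * (\<epsilon> * s / r\<^sup>2) * (p0 / T)
      = (p1 * r\<^sup>2 - n * (p0 * s * r) + \<epsilon> * (p0 * s)) / (T * r\<^sup>2) * e"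
      if "r \<noteq> 0" "T \<noteq> 0" for p0 p1 T n s r e :: real
      using that by (simp add: field_simps power2_eq_square)
    have "bump \<epsilon> a b ?p (k + 2) x = poly ?p x / (q x ^ k * (q x)\<^sup>2) * exp (- \<epsilon> / q x)"
      using True by (simp add: bump_def q_def power_add power2_eq_square)
    also have "poly ?p x = poly (pderiv p) x * (q x)\<^sup>2 - real k * (poly p x * (a + b - 2 * x) * q x)
        + \<epsilon> * (poly p x * (a + b - 2 * x))"
      by (simp add: Q Q')
    finally show "(poly (pderiv p) x / q x ^ k - real k * poly p x * (a + b - 2 * x) / q x ^ (k + 1)) * exp (- \<epsilon> / q x)
        + exp (- \<epsilon> / q x) * (\<epsilon> * (a + b - 2 * x) / (q x)\<^sup>2) * (poly p x / q x ^ k) = bump \<epsilon> a b ?p (k + 2) x"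
      using alg[of "q x" "q x ^ k"] q by (simp add: mult.commute[of "q x" "q x ^ k"])
  qed
  then show ?thesis
    by (rule has_field_derivative_transform_within_open[of _ _ _ "{a<..<b}"])
      (use True in \<open>auto simp: bump_def q_def\<close>)
qed

lemma bump_test_function:
  assumes "0 < \<epsilon>" "a < b"
  shows "bump \<epsilon> a b p k \<in> test_functions"
proof -
  have "Ck n (bump \<epsilon> a b p k)" for n
    by (rule Ck_if_closed_under_derivative[of "{bump \<epsilon> a b p k | p k. True}"])
      (use DERIV_bump[OF assms] in blast)+
  moreover have "bounded {x. bump \<epsilon> a b p k x \<noteq> 0}"
    by (rule bounded_subset[OF bounded_closed_interval[of a b]]) (auto simp: bump_def split: if_splits)
  ultimately show ?thesis by (auto simp: test_functions_def)
qed

section \<open>Approximation in mean square\<close>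

definition approximable :: "real measure \<Rightarrow> (real \<Rightarrow> real) \<Rightarrow> bool" where
  "approximable M f \<longleftrightarrow> (\<forall>\<epsilon>>0. \<exists>u\<in>test_functions. L2_nrm M (\<lambda>x. u x - f x) < \<epsilon>)"

context
  fixes M :: "real measure"
  assumes M: "finite_measure M" "sets M = sets borel"
begin

interpretation finite_measure M by (rule M)

lemma test_function_L2_finite:
  assumes "u \<in> test_functions" shows "u \<in> L2_space M"
proof -
  have c: "continuous_on UNIV u" by (rule test_function_derivs(3)[OF assms])
  from test_function_support[OF assms] obtain R where "\<And>x. R \<le> \<bar>x\<bar> \<Longrightarrow> u x = 0" by metis
  from bounded_continuous_support[OF c this] obtain B where "\<And>x. \<bar>u x\<bar> \<le> B" by metis
  then show ?thesis
    using borel_measurable_continuous_onI[OF c]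
    by (intro L2_bounded[of u B]) (auto simp: measurable_cong_sets[OF M(2) refl])
qed

lemma approximable_lincomb:
  assumes f: "approximable M f" "f \<in> L2_space M" and g: "approximable M g" "g \<in> L2_space M"
  shows "approximable M (\<lambda>x. a * f x + b * g x)"
  unfolding approximable_def
proof (intro allI impI)
  fix \<epsilon> :: real assume \<epsilon>: "0 < \<epsilon>"
  define \<delta> where "\<delta> = \<epsilon> / (\<bar>a\<bar> + \<bar>b\<bar> + 1)"
  have \<delta>: "0 < \<delta>" using \<epsilon> by (simp add: \<delta>_def)
  obtain u where u: "u \<in> test_functions" "L2_nrm M (\<lambda>x. u x - f x) < \<delta>"
    using f(1) \<delta> by (auto simp: approximable_def)
  obtain v where v: "v \<in> test_functions" "L2_nrm M (\<lambda>x. v x - g x) < \<delta>"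
    using g(1) \<delta> by (auto simp: approximable_def)
  have "L2_nrm M (\<lambda>x. a * (u x - f x) + b * (v x - g x))
      \<le> L2_nrm M (\<lambda>x. a * (u x - f x)) + L2_nrm M (\<lambda>x. b * (v x - g x))"
    by (intro L2_triangle L2_cmult L2_diff test_function_L2_finite u v f g)
  also have "\<dots> \<le> \<bar>a\<bar> * \<delta> + \<bar>b\<bar> * \<delta>"
    unfolding L2_nrm_cmult using u v by (intro add_mono mult_left_mono) auto
  also have "\<dots> < (\<bar>a\<bar> + \<bar>b\<bar> + 1) * \<delta>" using \<delta> by (simp add: algebra_simps)
  also have "\<dots> = \<epsilon>" by (simp add: \<delta>_def add_nonneg_pos[THEN less_imp_neq, symmetric])
  finally have "L2_nrm M (\<lambda>x. (a * u x + b * v x) - (a * f x + b * g x)) < \<epsilon>"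
    by (simp add: algebra_simps)
  then show "\<exists>w\<in>test_functions. L2_nrm M (\<lambda>x. w x - (a * f x + b * g x)) < \<epsilon>"
    by (rule bexI[OF _ test_functions_lincomb[OF u(1) v(1)]])
qed

lemma approximable_limit:
  assumes f: "\<And>n. approximable M (f n)" "\<And>n. f n \<in> L2_space M" and g: "g \<in> L2_space M"
    and lim: "(\<lambda>n::nat. L2_nrm M (\<lambda>x. f n x - g x)) \<longlonglongrightarrow> 0"
  shows "approximable M g"
  unfolding approximable_def
proof (intro allI impI)
  fix \<epsilon> :: real assume \<epsilon>: "0 < \<epsilon>"
  then have "\<forall>\<^sub>F n in sequentially. L2_nrm M (\<lambda>x. f n x - g x) < \<epsilon> / 2"
    using lim by (intro order_tendstoD) auto
  then obtain n where n: "L2_nrm M (\<lambda>x. f n x - g x) < \<epsilon> / 2" by (auto simp: eventually_sequentially)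
  obtain u where u: "u \<in> test_functions" "L2_nrm M (\<lambda>x. u x - f n x) < \<epsilon> / 2"
    using f(1)[of n] \<epsilon> half_gt_zero[OF \<epsilon>] unfolding approximable_def by blast
  have "L2_nrm M (\<lambda>x. u x - g x) \<le> L2_nrm M (\<lambda>x. u x - f n x) + L2_nrm M (\<lambda>x. f n x - g x)"
    by (intro L2_triangle_diff test_function_L2_finite u f g)
  then show "\<exists>u\<in>test_functions. L2_nrm M (\<lambda>x. u x - g x) < \<epsilon>" using u n by force
qed

lemma approximable_bounded_limit:
  assumes f: "\<And>n. approximable M (f n)" "\<And>n. f n \<in> borel_measurable borel" "\<And>n x. \<bar>f n x\<bar> \<le> B"
    and g: "g \<in> borel_measurable borel" and lim: "\<And>x. (\<lambda>n::nat. f n x) \<longlonglongrightarrow> g x"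
  shows "approximable M g"
proof -
  note meas = f(2)[unfolded measurable_cong_sets[OF M(2)[symmetric] refl]]
    g[unfolded measurable_cong_sets[OF M(2)[symmetric] refl]]
  have gB: "\<bar>g x\<bar> \<le> B" for x
    using tendsto_rabs[OF lim[of x]] f(3) by (intro LIMSEQ_le_const2) auto
  show ?thesis
  proof (rule approximable_limit[OF f(1)])
    show "f n \<in> L2_space M" for n by (rule L2_bounded[OF meas(1)]) (use f(3) in auto)
    show "g \<in> L2_space M" by (rule L2_bounded[OF meas(2)]) (use gB in auto)
    have "\<bar>f n x\<bar> \<le> \<bar>B\<bar>" "\<bar>g x\<bar> \<le> \<bar>B\<bar>" for n x
      using f(3)[of n x] gB[of x] by linarith+
    then show "(\<lambda>n. L2_nrm M (\<lambda>x. f n x - g x)) \<longlonglongrightarrow> 0"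
      by (intro L2_dominated_convergence[OF meas L2_const[of B]]) (use lim in auto)
  qed
qed

lemma approximable_test_function: "u \<in> test_functions \<Longrightarrow> approximable M u"
  unfolding approximable_def by (auto intro!: bexI[of _ u] simp: L2_nrm_def)

lemma approximable_0: "approximable M (\<lambda>_. 0)"
proof -
  have t: "bump 1 0 1 1 0 \<in> test_functions" by (rule bump_test_function) auto
  from approximable_test_function[OF test_functions_lincomb[OF t t, of 0 0]] show ?thesis by simp
qed

lemma indicator_empty_fun: "(indicator {} :: 'a \<Rightarrow> real) = (\<lambda>_. 0)"
  by auto

text \<open>The bumps with numerator 1 and exponent 0 lie between 0 and 1 and tend to the indicator
  pointwise as \<epsilon> decreases to 0.\<close>

lemma approximable_interval: "approximable M (indicator {a<..<b})"
proof (cases "a < b")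
  case True
  show ?thesis
  proof (rule approximable_bounded_limit[where B = 1])
    fix n :: nat
    have e: "0 < inverse (real (Suc n))" by simp
    have t: "bump (inverse (real (Suc n))) a b 1 0 \<in> test_functions" by (rule bump_test_function[OF e True])
    show "approximable M (bump (inverse (real (Suc n))) a b 1 0)" by (rule approximable_test_function[OF t])
    show "bump (inverse (real (Suc n))) a b 1 0 \<in> borel_measurable borel"
      by (rule borel_measurable_continuous_onI[OF test_function_derivs(3)[OF t]])
    show "\<bar>bump (inverse (real (Suc n))) a b 1 0 x\<bar> \<le> 1" for x
      by (auto simp: bump_def divide_nonneg_pos)
  next
    show "(\<lambda>n. bump (inverse (real (Suc n))) a b 1 0 x) \<longlonglongrightarrow> indicator {a<..<b} x" for x
    proof (cases "a < x \<and> x < b")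
      case True
      have "(\<lambda>n. exp (- inverse (real (Suc n)) / ((x - a) * (b - x)))) \<longlonglongrightarrow> exp (- 0 / ((x - a) * (b - x)))"
        by (intro tendsto_intros LIMSEQ_inverse_real_of_nat) (use True in auto)
      then show ?thesis using True by (simp add: bump_def)
    qed (auto simp: bump_def indicator_def)
  qed simp
next
  case False
  then show ?thesis using approximable_0 by (simp add: indicator_empty_fun)
qed

lemma indicator_L2: "A \<in> sets borel \<Longrightarrow> indicator A \<in> L2_space M"
  using M(2) by (intro L2_bounded[of _ 1]) (auto simp: indicator_def)

lemma approximable_1: "approximable M (\<lambda>_. 1)"
proof (rule approximable_bounded_limit[where B = 1])
  show "approximable M (indicator {- real n<..<real n})" for n by (rule approximable_interval)
  show "(\<lambda>n. indicator {- real n<..<real n} x) \<longlonglongrightarrow> (1 :: real)" for x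
  proof (rule tendsto_eventually)
    obtain N where N: "\<bar>x\<bar> < real N" using reals_Archimedean2 by blast
    have "indicator {- real n<..<real n} x = (1 :: real)" if "N \<le> n" for n
    proof -
      have "real N \<le> real n" using that by simp
      then show ?thesis using N by (auto simp: indicator_def)
    qed
    then show "\<forall>\<^sub>F n in sequentially. indicator {- real n<..<real n} x = (1 :: real)"
      by (auto simp: eventually_sequentially)
  qed
qed (auto simp: indicator_def)

text \<open>A Dynkin argument on the open intervals, which are stable under intersection.
  Complements use that the constant 1 is approximable; disjoint unions are limits of finite ones,
  whose indicators add up.\<close>

lemma approximable_indicator:
  assumes "A \<in> sets borel" shows "approximable M (indicator A)"
proof -
  let ?G = "range (\<lambda>(a, b). box a b :: real set)"
  have sb: "sets borel = sigma_sets UNIV ?G" by (subst borel_eq_box) (simp add: sets_measure_of)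
  have "Int_stable ?G"
  proof (rule Int_stableI)
    fix A B assume "A \<in> ?G" "B \<in> ?G"
    then obtain a b c d where "A = {a<..<b}" "B = {c<..<d}" by auto
    then have "A \<inter> B = box (max a c) (min b d)" by auto
    then show "A \<inter> B \<in> ?G" by auto
  qed
  moreover have "?G \<subseteq> Pow UNIV" by simp
  moreover have "A \<in> sigma_sets UNIV ?G" using assms sb by simp
  ultimately show ?thesis
  proof (induction rule: sigma_sets_induct_disjoint)
    case (basic A)
    then show ?case using approximable_interval by auto
  next
    case empty
    show ?case using approximable_0 by (simp add: indicator_empty_fun)
  next
    case (compl A)
    then have A: "A \<in> sets borel" using sb by simp
    have "approximable M (\<lambda>x. 1 * 1 + (- 1) * indicator A x)"
      by (rule approximable_lincomb[OF approximable_1 L2_const compl(2) indicator_L2[OF A]])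
    moreover have "(\<lambda>x. 1 * 1 + (- 1) * indicator A x) = (indicator (UNIV - A) :: real \<Rightarrow> real)"
      by (auto simp: indicator_def)
    ultimately show ?case by simp
  next
    case (union A)
    then have A: "A i \<in> sets borel" for i using sb by auto
    have U: "(\<Union>i<n. A i) \<in> sets borel" for n by (intro sets.finite_UN A) auto
    have disj: "(indicator (\<Union>i<Suc n. A i) :: real \<Rightarrow> real) = (\<lambda>x. 1 * indicator (\<Union>i<n. A i) x + 1 * indicator (A n) x)" for n
    proof
      fix x
      have "A i \<inter> A n = {}" if "i < n" for i
        using disjoint_family_onD[OF union(1), of i n] that by simp
      then have "x \<notin> (\<Union>i<n. A i)" if "x \<in> A n" using that by fastforce
      moreover have "x \<in> (\<Union>i<Suc n. A i) \<longleftrightarrow> x \<in> (\<Union>i<n. A i) \<or> x \<in> A n"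
        by (auto simp: less_Suc_eq)
      ultimately show "indicator (\<Union>i<Suc n. A i) x = 1 * indicator (\<Union>i<n. A i) x + 1 * (indicator (A n) x :: real)"
        unfolding indicator_def by (cases "x \<in> A n") simp_all
    qed
    have step: "approximable M (indicator (\<Union>i<n. A i))" for n
    proof (induction n)
      case 0
      show ?case using approximable_0 by (simp add: indicator_empty_fun)
    next
      case (Suc n)
      show ?case unfolding disj
        by (rule approximable_lincomb[OF Suc indicator_L2[OF U] union(3) indicator_L2[OF A]])
    qed
    show ?case
    proof (rule approximable_bounded_limit[OF step, where B = 1])
      show "indicator (\<Union> (range A)) \<in> borel_measurable borel" using A by auto
      show "(\<lambda>n. indicator (\<Union>i<n. A i) x) \<longlonglongrightarrow> (indicator (\<Union> (range A)) x :: real)" for x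
        by (rule LIMSEQ_indicator_UN)
    qed (use U in \<open>auto simp: indicator_def\<close>)
  qed
qed

lemma approximable_bounded_nonneg:
  assumes f: "f \<in> borel_measurable borel" "\<And>x. 0 \<le> f x" "\<And>x. f x \<le> B"
  shows "approximable M f"
proof -
  have L2: "u \<in> L2_space M" if "u \<in> borel_measurable borel" "\<And>x. 0 \<le> u x" "\<And>x. u x \<le> B" for u :: "real \<Rightarrow> real" and B
    using that by (intro L2_bounded[of u B]) (auto simp: measurable_cong_sets[OF M(2) refl])
  \<comment> \<open>The bound is quantified inside the induction because a factor or a summand has a
    bound of its own, for instance \<open>B / c\<close> after scaling.\<close>
  have "\<forall>B. (\<forall>x. f x \<le> B) \<longrightarrow> approximable M f"
    using f(1,2)
  proof (induction rule: borel_measurable_induct_real)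
    case (set A)
    then show ?case using approximable_indicator by simp
  next
    case (mult u c)
    show ?case
    proof (intro allI impI)
      fix B assume B: "\<forall>x. c * u x \<le> B"
      show "approximable M (\<lambda>x. c * u x)"
      proof (cases "c = 0")
        case True
        then show ?thesis using approximable_0 by simp
      next
        case False
        then have uB: "u x \<le> B / c" for x using B mult(1) by (simp add: field_simps)
        then have "approximable M u" using mult.IH by blast
        from approximable_lincomb[OF this L2[OF mult(2,3) uB] this L2[OF mult(2,3) uB], of c 0]
        show ?thesis by simp
      qed
    qed
  next
    case (add u v)
    show ?case
    proof (intro allI impI)
      fix B assume B: "\<forall>x. v x + u x \<le> B"
      have uB: "u x \<le> B" and vB: "v x \<le> B" for x
        using B[rule_format, of x] add(2,4)[of x] by linarith+
      have "approximable M u" "approximable M v" using add.IH uB vB by blast+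
      from approximable_lincomb[OF this(2) L2[OF _ _ vB] this(1) L2[OF _ _ uB], of 1 1]
      show "approximable M (\<lambda>x. v x + u x)" using add by simp
    qed
  next
    case (seq U)
    show ?case
    proof (intro allI impI)
      fix B assume B: "\<forall>x. f x \<le> B"
      have UB: "U i x \<le> B" for i x
      proof -
        have "U i x \<le> f x"
          using seq(4)[of x] seq(3) by (intro incseq_le) (auto simp: incseq_def le_fun_def)
        then show ?thesis using B by (meson order_trans)
      qed
      show "approximable M f"
      proof (rule approximable_bounded_limit[where f = U and B = B])
        show "approximable M (U n)" for n using seq.IH UB by blast
        show "\<bar>U n x\<bar> \<le> B" for n x using seq(2)[of n x] UB[of n x] by simp
        show "(\<lambda>n. U n x) \<longlonglongrightarrow> f x" for x using seq(4)[of x] by simp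
      qed (use seq(1) f(1) in auto)
    qed
  qed
  then show ?thesis using f(3) by blast
qed

end

subsection \<open>Level sets of the potential\<close>

context convex_potential
begin

section \<open>Smoothing of bounded and of integrable functions\<close>

definition smoothing_constant :: "real \<Rightarrow> real" where
  "smoothing_constant s = exp (C * s) * sqrt (2 / sqrt s * (1 + 1 / s))"

lemma smoothing_constant_pos:
  assumes "0 < s" shows "0 < smoothing_constant s"
proof -
  have "0 < 2 / sqrt s * (1 + 1 / s)" using assms by (intro mult_pos_pos add_pos_pos) auto
  then show ?thesis by (simp add: smoothing_constant_def)
qed

text \<open>Approximating test functions may have a slightly larger L1 norm than \<open>f\<close>.
  The strict inequality for \<open>m\<close> leaves room for this, since on a probability space the
  L1 error is at most the L2 error. Contraction carries the convergence to \<open>P s\<close>, and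
  an almost everywhere convergent subsequence carries the pointwise bound.\<close>

lemma bounded_function_smoothing:
  assumes P: "semigroup_of h P" and f: "f \<in> borel_measurable borel" "\<And>x. 0 \<le> f x" "\<And>x. f x \<le> B"
    and s: "0 < s" and m: "(\<integral>x. f x \<partial>mu h) < m"
  shows "AE x in mu h. P s f x \<le> smoothing_constant s * m * exp (h x)"
proof -
  interpret symmetric_markov_semigroup "mu h" P by (rule semigroup_of_symmetric_markov[OF P])
  have s0: "0 \<le> s" using s by simp
  have "0 \<le> (\<integral>x. f x \<partial>mu h)" using f(2) by (intro integral_nonneg_AE) auto
  then have m0: "0 < m" using m by simp
  have fL: "f \<in> L2_space (mu h)"
    using f by (intro L2_bounded[of f B]) (auto simp: measurable_cong_sets[OF sets_mu refl])
  have "approximable (mu h) f"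
    by (rule approximable_bounded_nonneg[OF finite_measure_axioms sets_mu f])
  then have "\<exists>u\<in>test_functions. L2_nrm (mu h) (\<lambda>x. u x - f x) < inverse (real (Suc n))" for n
    unfolding approximable_def by simp
  then obtain u where u: "\<And>n. u n \<in> test_functions"
    and un: "\<And>n. L2_nrm (mu h) (\<lambda>x. u n x - f x) < inverse (real (Suc n))" by metis
  note uL = test_function_L2(1)[OF u]
  have lim: "(\<lambda>n. L2_nrm (mu h) (\<lambda>x. u n x - f x)) \<longlonglongrightarrow> 0"
    by (rule tendsto_sandwich[OF _ _ tendsto_const LIMSEQ_inverse_real_of_nat])
      (use un in \<open>auto intro!: always_eventually less_imp_le\<close>)
  have L1: "(\<integral>x. \<bar>u n x\<bar> \<partial>mu h) \<le> (\<integral>x. f x \<partial>mu h) + L2_nrm (mu h) (\<lambda>x. u n x - f x)" for n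
  proof -
    have dL: "(\<lambda>x. u n x - f x) \<in> L2_space (mu h)" by (intro L2_diff uL fL)
    have aL: "(\<lambda>x. \<bar>u n x - f x\<bar>) \<in> L2_space (mu h)"
      by (rule L2_dominated[OF dL, of _ 1]) (use L2_measurable[OF dL] in auto)
    have "(\<integral>x. \<bar>u n x\<bar> \<partial>mu h) \<le> (\<integral>x. f x + \<bar>u n x - f x\<bar> \<partial>mu h)"
    proof (rule integral_mono)
      show "integrable (mu h) (\<lambda>x. \<bar>u n x\<bar>)" by (rule integrable_abs[OF L2_integrable[OF uL]])
      show "integrable (mu h) (\<lambda>x. f x + \<bar>u n x - f x\<bar>)"
        by (rule Bochner_Integration.integrable_add[OF L2_integrable[OF fL] L2_integrable[OF aL]])
      show "\<bar>u n x\<bar> \<le> f x + \<bar>u n x - f x\<bar>" for x using f(2)[of x] by linarith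
    qed
    also have "\<dots> = (\<integral>x. f x \<partial>mu h) + (\<integral>x. \<bar>u n x - f x\<bar> * 1 \<partial>mu h)"
      using L2_integrable[OF fL] L2_integrable[OF aL] by simp
    also have "(\<integral>x. \<bar>u n x - f x\<bar> * 1 \<partial>mu h) \<le> L2_nrm (mu h) (\<lambda>x. \<bar>u n x - f x\<bar>) * L2_nrm (mu h) (\<lambda>_. 1)"
      using L2_Cauchy_Schwarz[OF aL L2_const[of 1]] by (simp add: abs_le_iff)
    also have "\<dots> = L2_nrm (mu h) (\<lambda>x. u n x - f x)"
      using prob_space by (simp add: L2_nrm_def)
    finally show ?thesis by simp
  qed
  have "\<forall>\<^sub>F n in sequentially. L2_nrm (mu h) (\<lambda>x. u n x - f x) < m - (\<integral>x. f x \<partial>mu h)"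
    using lim m by (intro order_tendstoD) auto
  then obtain N where N: "\<And>n. N \<le> n \<Longrightarrow> L2_nrm (mu h) (\<lambda>x. u n x - f x) < m - (\<integral>x. f x \<partial>mu h)"
    by (auto simp: eventually_sequentially)
  \<comment> \<open>The condition on \<open>n\<close> is kept inside the statement so that a single
    null set serves all \<open>n\<close>.\<close>
  have "AE x in mu h. N \<le> n \<longrightarrow> P s (u n) x \<le> smoothing_constant s * m * exp (h x)" for n
  proof (cases "N \<le> n")
    case True
    have "(\<integral>x. \<bar>u n x\<bar> \<partial>mu h) \<le> m" using L1[of n] N[OF True] by simp
    from test_function_smoothing[OF P u s m0 this] show ?thesis by (simp add: smoothing_constant_def)
  qed simp
  then have bound: "AE x in mu h. \<forall>n. N \<le> n \<longrightarrow> P s (u n) x \<le> smoothing_constant s * m * exp (h x)"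
    by (simp add: AE_all_countable)
  have PL: "P s (u n) \<in> L2_space (mu h)" "P s f \<in> L2_space (mu h)" for n
    by (intro P_L2 s0 uL fL)+
  have "(\<lambda>n. L2_nrm (mu h) (\<lambda>x. P s (u n) x - P s f x)) \<longlonglongrightarrow> 0"
  proof (rule tendsto_sandwich[OF _ _ tendsto_const lim])
    have "L2_nrm (mu h) (\<lambda>x. P s (u n) x - P s f x) \<le> L2_nrm (mu h) (\<lambda>x. u n x - f x)" for n
    proof -
      have dL: "(\<lambda>x. u n x - f x) \<in> L2_space (mu h)" by (intro L2_diff uL fL)
      have "L2_nrm (mu h) (\<lambda>x. P s (u n) x - P s f x) = L2_nrm (mu h) (P s (\<lambda>x. u n x - f x))"
        using P_diff[OF s0 uL fL, of n]
        by (intro L2_nrm_cong_AE borel_measurable_diff P_measurable s0 uL fL dL) auto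
      then show ?thesis using P_contraction[OF s0 dL] by simp
    qed
    then show "\<forall>\<^sub>F n in sequentially. L2_nrm (mu h) (\<lambda>x. P s (u n) x - P s f x)
        \<le> L2_nrm (mu h) (\<lambda>x. u n x - f x)" by simp
  qed simp
  from L2_tendsto_AE_subseq[OF PL this] obtain r
    where r: "strict_mono r" "AE x in mu h. (\<lambda>n. P s (u (r n)) x) \<longlonglongrightarrow> P s f x" by metis
  from r(2) bound show ?thesis
  proof eventually_elim
    case (elim x)
    have "\<exists>M. \<forall>n\<ge>M. P s (u (r n)) x \<le> smoothing_constant s * m * exp (h x)"
      using elim(2) seq_suble[OF r(1)] by (meson order_trans)
    with elim(1) show ?case by (rule LIMSEQ_le_const2)
  qed
qed

text \<open>The bound on the truncations is uniform in \<open>n\<close> and there are countably many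
  of them, so it passes to the supremum off one null set.\<close>

lemma extend_L1_smoothing:
  assumes P: "semigroup_of h P" and g: "integrable (mu h) g" "AE x in mu h. 0 \<le> g x"
    and s: "0 < s" and m: "(\<integral>x. g x \<partial>mu h) < m"
  shows "AE x in mu h. extend_L1 (P s) g x \<le> ennreal (smoothing_constant s * m * exp (h x))"
proof -
  interpret symmetric_markov_semigroup "mu h" P by (rule semigroup_of_symmetric_markov[OF P])
  have gm: "g \<in> borel_measurable borel"
    using g(1) borel_measurable_integrable by (auto simp: measurable_cong_sets[OF sets_mu refl])
  have "AE x in mu h. P s (\<lambda>y. min (g y) (real n)) x \<le> smoothing_constant s * m * exp (h x)" for n
  proof -
    \<comment> \<open>As \<open>g\<close> is nonnegative only almost everywhere, the truncation is
      also cut at 0 from below; \<open>P_cong\<close> carries the result back.\<close>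
    define f where "f y = max 0 (min (g y) (real n))" for y
    have f: "f \<in> borel_measurable borel" "\<And>x. 0 \<le> f x" "\<And>x. f x \<le> real n"
      using gm by (auto simp: f_def[abs_def])
    have fm: "f \<in> borel_measurable (mu h)" "(\<lambda>y. min (g y) (real n)) \<in> borel_measurable (mu h)"
      using f(1) gm by (auto simp: measurable_cong_sets[OF sets_mu refl])
    have eq: "AE x in mu h. f x = min (g x) (real n)"
      using g(2) by eventually_elim (simp add: f_def)
    have fL: "f \<in> L2_space (mu h)" using f by (intro L2_bounded[OF fm(1), of "real n"]) auto
    have gL: "(\<lambda>y. min (g y) (real n)) \<in> L2_space (mu h)"
      using g(2) by (intro L2_bounded[OF fm(2), of "real n"]) auto
    have "(\<integral>x. f x \<partial>mu h) \<le> (\<integral>x. g x \<partial>mu h)"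
      using g(2) by (intro integral_mono_AE L2_integrable fL g(1)) (auto simp: f_def)
    then have "AE x in mu h. P s f x \<le> smoothing_constant s * m * exp (h x)"
      using m by (intro bounded_function_smoothing[OF P f s]) simp
    with P_cong[OF less_imp_le[OF s] fL gL eq] show ?thesis by eventually_elim simp
  qed
  then have "AE x in mu h. \<forall>n. P s (\<lambda>y. min (g y) (real n)) x \<le> smoothing_constant s * m * exp (h x)"
    by (simp add: AE_all_countable)
  then show ?thesis
    by eventually_elim (auto simp: extend_L1_def intro!: SUP_least ennreal_leI)
qed

section \<open>Gaussian tails of the measure\<close>

lemma h_strict_mono:
  assumes "0 \<le> x" "x < y" shows "h x < h y"
proof (rule DERIV_pos_imp_increasing_open[OF assms(2)])
  show "\<exists>d. (h has_real_derivative d) (at z) \<and> 0 < d" if "x < z" for z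
  proof -
    have "0 < c * z" using c that assms by (intro mult_pos_pos) auto
    then show ?thesis using DERIV_h[of z] deriv_h_ge[of z] that assms by (intro exI[of _ "deriv h z"]) auto
  qed
qed (rule continuous_h)

lemma emeasure_mu:
  assumes "A \<in> sets borel"
  shows "emeasure (mu h) A = (\<integral>\<^sup>+x. ennreal (weight x) * indicator A x \<partial>lborel)"
  unfolding mu_def weight_def using assms continuous_h(1)[of UNIV]
  by (intro emeasure_density) (auto intro!: borel_measurable_continuous_onI continuous_intros)

lemma weight_tendsto_0: "(weight \<longlongrightarrow> 0) at_top"
proof -
  have "filterlim (\<lambda>x. h 0 + c / 2 * x) at_top at_top"
    by (intro filterlim_tendsto_add_at_top[OF tendsto_const] filterlim_tendsto_pos_mult_at_top[OF tendsto_const]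
        filterlim_ident) (use c in simp)
  moreover have "\<forall>\<^sub>F x in at_top. h 0 + c / 2 * x \<le> h x"
    using eventually_ge_at_top[of 1]
  proof eventually_elim
    case (elim x)
    have "c / 2 * x \<le> c / 2 * x\<^sup>2"
      using elim c self_le_power[of x 2] by (intro mult_left_mono) auto
    then show ?case using h_ge[of x] by simp
  qed
  ultimately have "filterlim h at_top at_top" by (rule filterlim_at_top_mono)
  then have "filterlim (\<lambda>x. - h x) at_bot at_top" by (simp add: filterlim_uminus_at_bot)
  from filterlim_compose[OF exp_at_bot this] show ?thesis by (simp add: weight_def[abs_def])
qed

text \<open>On \<open>[r, \<infinity>)\<close> one has \<open>weight \<le> h' * weight / (c r)\<close>, and the right-hand side is an exact derivative.\<close>

lemma emeasure_mu_atLeast: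
  assumes r: "0 < r"
  shows "emeasure (mu h) {r..} \<le> ennreal (weight r / (c * r))"
proof -
  have cr: "0 < c * r" using c r by simp
  have "emeasure (mu h) {r..} = (\<integral>\<^sup>+x. ennreal (weight x) * indicator {r..} x \<partial>lborel)"
    by (rule emeasure_mu) simp
  also have "\<dots> \<le> (\<integral>\<^sup>+x. ennreal (deriv h x * weight x / (c * r)) * indicator {r..} x \<partial>lborel)"
  proof (intro nn_integral_mono)
    fix x
    show "ennreal (weight x) * indicator {r..} x \<le> ennreal (deriv h x * weight x / (c * r)) * indicator {r..} x"
    proof (cases "r \<le> x")
      case True
      have "c * r \<le> c * x" using c True by simp
      also have "\<dots> \<le> deriv h x" using r True by (intro deriv_h_ge) simp
      finally have "c * r * weight x \<le> deriv h x * weight x" using weight_pos[of x] by (intro mult_right_mono) auto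
      then have "weight x \<le> deriv h x * weight x / (c * r)" using cr by (simp add: pos_le_divide_eq mult.commute)
      then show ?thesis by (intro mult_right_mono ennreal_leI) auto
    qed simp
  qed
  also have "\<dots> = ennreal (0 - (- weight r / (c * r)))"
  proof (rule nn_integral_FTC_atLeast[where F = "\<lambda>x. - weight x / (c * r)"])
    show "(\<lambda>x. deriv h x * weight x / (c * r)) \<in> borel_measurable borel"
      by (intro borel_measurable_continuous_onI continuous_intros continuous_h weight_continuous) (use cr in auto)
    show "((\<lambda>x. - weight x / (c * r)) has_real_derivative deriv h x * weight x / (c * r)) (at x)" for x
      by (rule DERIV_cong[OF DERIV_cdivide[OF DERIV_minus[OF DERIV_weight]]]) simp
    show "0 \<le> deriv h x * weight x / (c * r)" if "r \<le> x" for x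
    proof -
      have "0 \<le> c * x" using c r that by simp
      then have "0 \<le> deriv h x" using deriv_h_ge[of x] r that by simp
      then show ?thesis using weight_pos[of x] cr by simp
    qed
    show "((\<lambda>x. - weight x / (c * r)) \<longlongrightarrow> 0) at_top"
      using cr by (auto intro!: tendsto_eq_intros weight_tendsto_0)
  qed
  finally show ?thesis by simp
qed

lemma emeasure_mu_atMost:
  assumes r: "0 < r"
  shows "emeasure (mu h) {..- r} = emeasure (mu h) {r..}"
proof -
  have "emeasure (mu h) {..- r} = (\<integral>\<^sup>+x. ennreal (weight x) * indicator {..- r} x \<partial>lborel)"
    by (rule emeasure_mu) simp
  also have "\<dots> = (\<integral>\<^sup>+x. ennreal (weight (0 + - 1 * x)) * indicator {..- r} (0 + - 1 * x) \<partial>lborel)"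
    using weight_measurable by (subst nn_integral_real_affine[where c = "-1" and t = 0]) auto
  also have "\<dots> = (\<integral>\<^sup>+x. ennreal (weight x) * indicator {r..} x \<partial>lborel)"
    by (intro nn_integral_cong) (auto simp: weight_def even indicator_def)
  also have "\<dots> = emeasure (mu h) {r..}" by (rule emeasure_mu[symmetric]) simp
  finally show ?thesis .
qed

text \<open>The superlevel set is contained in the two tails beyond the point \<open>r > 0\<close>
  with \<open>h r = l\<close>. There \<open>weight r = exp (- l)\<close>, and the upper quadratic
  bound on \<open>h\<close> keeps \<open>r\<close> away from 0, which supplies the square root in
  the denominator.\<close>

lemma superlevel_measure:
  assumes l: "h 0 < l"
  shows "measure (mu h) {x. l \<le> h x} \<le> 2 * exp (- l) / (c * sqrt (2 * (l - h 0) / C))"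
proof -
  \<comment> \<open>At \<open>b\<close> the lower quadratic bound on \<open>h\<close> reaches
    \<open>l\<close>, so the intermediate value theorem finds \<open>r\<close> in
    \<open>[0, b]\<close>.\<close>
  define b where "b = sqrt (2 * (l - h 0) / c)"
  have b: "0 \<le> b" "c * b\<^sup>2 / 2 = l - h 0" using l c by (auto simp: b_def)
  then have "l \<le> h b" using h_ge[of b] by linarith
  from IVT'[of h 0 l b, OF less_imp_le[OF l] this b(1) continuous_h(1)] obtain r
    where r: "0 \<le> r" "h r = l" by blast
  then have r0: "0 < r" using l by (cases "r = 0") auto
  have "2 * (l - h 0) / C \<le> r\<^sup>2" using h_le[of r] r(2) C_pos by (simp add: field_simps)
  then have "sqrt (2 * (l - h 0) / C) \<le> r" using r0 by (intro real_le_lsqrt) auto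
  then have rge: "c * sqrt (2 * (l - h 0) / C) \<le> c * r" using c by simp
  have "{x. l \<le> h x} \<subseteq> {r..} \<union> {..- r}"
  proof
    fix x assume x: "x \<in> {x. l \<le> h x}"
    show "x \<in> {r..} \<union> {..- r}"
      using x r h_strict_mono[of x r] h_strict_mono[of "- x" r] even[of x] by (cases "0 \<le> x") force+
  qed
  then have "emeasure (mu h) {x. l \<le> h x} \<le> emeasure (mu h) ({r..} \<union> {..- r})"
    by (intro emeasure_mono) auto
  also have "\<dots> \<le> emeasure (mu h) {r..} + emeasure (mu h) {..- r}"
    by (intro emeasure_subadditive) auto
  also have "\<dots> \<le> ennreal (weight r / (c * r)) + ennreal (weight r / (c * r))"
    unfolding emeasure_mu_atMost[OF r0] by (intro add_mono emeasure_mu_atLeast r0)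
  also have "\<dots> = ennreal (2 * (weight r / (c * r)))"
    using weight_pos[of r] c r0 by (subst ennreal_plus[symmetric]) auto
  finally have "measure (mu h) {x. l \<le> h x} \<le> 2 * (weight r / (c * r))"
    using weight_pos[of r] c r0 by (simp add: emeasure_eq_measure)
  also have "\<dots> \<le> 2 * exp (- l) / (c * sqrt (2 * (l - h 0) / C))"
    using rge r(2) c C_pos l r0 by (auto simp: weight_def intro!: divide_left_mono mult_pos_pos)
  finally show ?thesis .
qed

text \<open>Total mass 1 compared with the Gaussian majorant of variance \<open>1 / c\<close>. It
  bounds \<open>h 0\<close>, the only feature of \<open>h\<close> not yet controlled by
  \<open>c\<close> and \<open>C\<close>.\<close>

lemma exp_h_0_le: "exp (h 0) \<le> sqrt (2 * pi / c)"
proof -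
  let ?k = "\<lambda>x. exp (- h 0) * sqrt (2 * pi / c) * normal_density 0 (1 / sqrt c) x"
  have "(1 :: real) = (\<integral>x. 1 \<partial>mu h)" using prob_space by simp
  also have "\<dots> = (\<integral>x. weight x \<partial>lborel)" using integral_mu[of "\<lambda>_. 1"] by simp
  also have "\<dots> \<le> (\<integral>x. ?k x \<partial>lborel)"
  proof (rule integral_mono_AE')
    show "integrable lborel ?k" using c by (intro integrable_mult_right integrable_normal_density) simp
    have "weight x \<le> ?k x" for x
    proof -
      have "weight x \<le> exp (- h 0) * exp (- (c * x\<^sup>2 / 2))"
        using h_ge[of x] by (simp add: weight_def flip: exp_add)
      also have "\<dots> = ?k x"
        using c by (simp add: normal_density_def power_divide real_sqrt_divide)
      finally show ?thesis .
    qed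
    then show "AE x in lborel. weight x \<le> ?k x" by simp
    show "AE x in lborel. 0 \<le> ?k x" using c by simp
  qed
  also have "\<dots> = exp (- h 0) * sqrt (2 * pi / c)" using c by (simp add: integral_normal_density)
  finally show ?thesis by (simp add: exp_minus field_simps)
qed

end

text \<open>\<open>K\<close> is twice the smoothing constant, and \<open>T\<close> is the threshold
  beyond which \<open>h 0\<close> uses up at most half of \<open>ln t\<close>. The first summand
  serves \<open>t \<ge> T\<close>, the second \<open>t < T\<close>, where a probability is at most
  1. The absolute value keeps the second summand nonnegative when \<open>T < 1\<close>.\<close>

definition deviation_constant :: "real \<Rightarrow> real \<Rightarrow> real \<Rightarrow> real" where
  "deviation_constant s c C = (let K = 2 * (exp (C * s) * sqrt (2 / sqrt s * (1 + 1 / s)));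
     T = (K * sqrt (2 * pi / c))\<^sup>2 in 2 * K * sqrt C / c + T * sqrt \<bar>ln T\<bar>)"

lemma (in convex_potential) deviation_bound:
  assumes P: "semigroup_of h P" and g: "integrable (mu h) g" "AE x in mu h. 0 \<le> g x" "0 < (\<integral>x. g x \<partial>mu h)"
    and s: "0 < s" and t: "2 \<le> t"
  shows "measure (mu h) {x. ennreal (t * (\<integral>y. g y \<partial>mu h)) \<le> extend_L1 (P s) g x}
    \<le> deviation_constant s c C * (1 / (t * sqrt (ln t)))" (is "measure _ ?A \<le> _")
proof -
  define m where "m = (\<integral>y. g y \<partial>mu h)"
  define K where "K = 2 * smoothing_constant s"
  define S where "S = sqrt (2 * pi / c)"
  define T where "T = (K * S)\<^sup>2"
  have m: "0 < m" using g(3) by (simp add: m_def)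
  have K: "0 < K" using smoothing_constant_pos[OF s] by (simp add: K_def)
  have S: "0 < S" using c by (simp add: S_def)
  have lnt: "0 < ln t" and t0: "0 < t" using t by auto
  have D: "deviation_constant s c C = 2 * K * sqrt C / c + T * sqrt \<bar>ln T\<bar>"
    by (simp add: deviation_constant_def Let_def K_def S_def T_def smoothing_constant_def)
  have pos: "0 \<le> 2 * K * sqrt C / c" "0 \<le> T * sqrt \<bar>ln T\<bar>" "0 < 1 / (t * sqrt (ln t))"
    using K C_pos c t0 lnt by (auto simp: T_def)
  show ?thesis
  proof (cases "T \<le> t")
    \<comment> \<open>Below the threshold, monotonicity of \<open>t * sqrt (ln t)\<close> makes the
      claimed bound at least 1.\<close>
    case False
    have "t * sqrt (ln t) \<le> T * sqrt \<bar>ln T\<bar>"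
      using False t by (intro mult_mono real_sqrt_le_mono order_trans[OF _ abs_ge_self]) auto
    then have "1 \<le> T * sqrt \<bar>ln T\<bar> * (1 / (t * sqrt (ln t)))"
      using t0 lnt by (simp add: pos_le_divide_eq)
    also have "\<dots> \<le> deviation_constant s c C * (1 / (t * sqrt (ln t)))"
      unfolding D using pos by (intro mult_right_mono) auto
    finally show ?thesis using prob_le_1[of ?A] by linarith
  next
    case True
    define l where "l = ln (t / K)"
    \<comment> \<open>From \<open>T \<le> t\<close>: \<open>ln K + ln S\<close> is at most
      \<open>ln t / 2\<close>, and \<open>h 0 \<le> ln S\<close>, so the level
      \<open>l = ln t - ln K\<close> exceeds \<open>h 0\<close> by at least
      \<open>ln t / 2\<close>.\<close>
    have "K * S \<le> sqrt t" using True K S by (intro real_le_rsqrt) (simp add: T_def)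
    then have "ln (K * S) \<le> ln (sqrt t)" using K S t0 by simp
    then have "ln K + ln S \<le> ln t / 2" using K S t0 by (simp add: ln_mult ln_sqrt)
    moreover have "h 0 \<le> ln S"
      using exp_h_0_le S by (subst ln_ge_iff) (auto simp: S_def)
    moreover have "l = ln t - ln K" using K t0 by (simp add: l_def ln_div)
    ultimately have l: "ln t / 2 \<le> l - h 0" by linarith
    then have l0: "h 0 < l" using lnt by linarith
    \<comment> \<open>The smoothing bound asks for a number strictly above the integral; the choice
      \<open>2 * m\<close> is the origin of the factor 2 in \<open>K\<close>.\<close>
    have "(\<integral>x. g x \<partial>mu h) < 2 * m" using m by (simp add: m_def)
    from extend_L1_smoothing[OF P g(1,2) s this]
    have sub: "AE x in mu h. x \<in> ?A \<longrightarrow> x \<in> {x. l \<le> h x}"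
      unfolding mem_Collect_eq m_def[symmetric]
    proof eventually_elim
      case (elim x)
      show ?case
      proof
        assume "ennreal (t * m) \<le> extend_L1 (P s) g x"
        also note elim
        finally have "t * m \<le> smoothing_constant s * (2 * m) * exp (h x)"
          using smoothing_constant_pos[OF s] m by (simp add: ennreal_le_iff)
        then have "t \<le> K * exp (h x)" using m by (simp add: K_def)
        then have "t / K \<le> exp (h x)" using K by (simp add: pos_divide_le_eq mult.commute)
        then show "l \<le> h x" unfolding l_def using K t0 by (metis divide_pos_pos ln_exp ln_le_cancel_iff exp_gt_zero)
      qed
    qed
    have "measure (mu h) ?A \<le> measure (mu h) {x. l \<le> h x}"
    proof (rule finite_measure_mono_AE[OF sub])
      have "closed {x. l \<le> h x}" by (intro closed_Collect_le continuous_intros continuous_h)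
      then show "{x. l \<le> h x} \<in> sets (mu h)" by simp
    qed
    also have "\<dots> \<le> 2 * exp (- l) / (c * sqrt (2 * (l - h 0) / C))" by (rule superlevel_measure[OF l0])
    also have "\<dots> \<le> 2 * exp (- l) / (c * sqrt (ln t / C))"
      using l l0 lnt c C_pos
      by (intro divide_left_mono mult_left_mono real_sqrt_le_mono divide_right_mono mult_pos_pos) auto
    also have "\<dots> = 2 * K * sqrt C / c * (1 / (t * sqrt (ln t)))"
      using K t0 c C_pos by (simp add: l_def exp_minus real_sqrt_divide field_simps)
    also have "\<dots> \<le> deviation_constant s c C * (1 / (t * sqrt (ln t)))"
      unfolding D using pos by (intro mult_right_mono) auto
    finally show ?thesis .
  qed
qed

theorem theorem2p6:
  fixes s c C K :: real
  assumes "s > 0" and "c > 0" and "C > 0"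
  shows "\<exists>D::real. \<forall>(h :: real \<Rightarrow> real) (P :: real \<Rightarrow> (real \<Rightarrow> real) \<Rightarrow> (real \<Rightarrow> real)).
     h \<in> class_D 4 \<longrightarrow>
     (\<forall>x. h (- x) = h x) \<longrightarrow>
     (\<forall>x. c \<le> (deriv ^^ 2) h x \<and> (deriv ^^ 2) h x \<le> C) \<longrightarrow>
     prob_space (mu h) \<longrightarrow>
     bdd_below (range (V_pot h)) \<longrightarrow>
     bdd_above ((deriv ^^ 2) (V_pot h) ` {0..}) \<longrightarrow>
     (SUP x\<in>{0..}. (deriv ^^ 2) (V_pot h) x) = K \<longrightarrow>
     semigroup_of h P \<longrightarrow>
     (\<forall>g :: real \<Rightarrow> real.
        integrable (mu h) g \<longrightarrow>
        (AE x in mu h. 0 \<le> g x) \<longrightarrow>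
        (\<integral>x. g x \<partial>mu h) > 0 \<longrightarrow>
        (\<forall>t\<ge>2.
           measure (mu h) {x. ennreal (t * (\<integral>y. g y \<partial>mu h)) \<le> extend_L1 (P s) g x}
             \<le> D * (1 / (t * sqrt (ln t)))))"
\<comment> \<open>The witness is fixed before \<open>h\<close>, \<open>P\<close>, \<open>g\<close>
  and \<open>t\<close>, which expresses the uniformity of the constant.\<close>
proof (intro exI[of _ "deviation_constant s c C"] allI impI)
  fix h g :: "real \<Rightarrow> real" and P and t :: real
  assume "h \<in> class_D 4" "\<forall>x. h (- x) = h x" "\<forall>x. c \<le> (deriv ^^ 2) h x \<and> (deriv ^^ 2) h x \<le> C"
    "prob_space (mu h)"
  then interpret convex_potential h c C
    using \<open>c > 0\<close> by (intro convex_potential.intro) blast+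
  assume "semigroup_of h P" "integrable (mu h) g" "AE x in mu h. 0 \<le> g x" "(\<integral>x. g x \<partial>mu h) > 0" "2 \<le> t"
  then show "measure (mu h) {x. ennreal (t * (\<integral>y. g y \<partial>mu h)) \<le> extend_L1 (P s) g x}
      \<le> deviation_constant s c C * (1 / (t * sqrt (ln t)))"
    using \<open>s > 0\<close> by (intro deviation_bound)
qed

end
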